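(* Let $I=[0,1]$, let $O$ be an open subset of $I\times\mathbf R\times\mathbf R$ (in the relative topology), and let $E=\mathbf R\times\mathbf R\times C^\infty(O)$. Let $\Sigma$ be the set of all $(\eta_0,\eta_1,\varphi,y)$ with $\eta_0,\eta_1\in\mathbf R$, $\varphi\in C^\infty(O)$, $y\in C^2(I)$ such that $y(0)=\eta_0$, $y(1)=\eta_1$ and, for all $s\in I$, $(s,y(s),y'(s))\in O$ and $y''(s)=\varphi(s,y(s),y'(s))$. Let $\Sigma_0$ be the set of regular elements of $\Sigma$. Then for every $w\in\Sigma_0$ there is an open set $W$ in $E\times C^2(I)$ with $w\in W$ such that $(E,C^\infty(I),\Sigma\cap W)\in C^\infty_\pi$; i.e. $\Sigma\cap W$ is (the graph of) a function $(\eta_0,\eta_1,\varphi)\mapsto y$ with open domain in $E$ and values in $C^\infty(I)$ which is of class $C^\infty_\pi$ as a map into $C^\infty(I)$.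
   Context: All spaces are real. Regularity: $w=(\eta_0,\eta_1,\varphi,y)\in\Sigma$ is regular if, writing $p_\iota(s)=\partial_\iota\varphi(s,y(s),y'(s))$ for $\iota=2,3$ (partial derivatives with respect to the second and third real variables) and $F_0=\{u\in C^2(I):u(0)=u(1)=0\}$, for every $v\in F_0$ there is a unique $u\in F_0$ with $u''-p_3u'-p_2u=v''$. Function spaces (real-valued functions): $C^i(I)$, $i\in\{0,1,2,\dots\}\cup\{\infty\}$, is the space of functions of class $C^i$ on $I$ (up to the boundary) with the topology of uniform convergence of all derivatives of order $<i+1$. $C^\infty(O)$ is the space of continuous $\varphi:O\to\mathbf R$ which are $C^\infty$ on the interior of $O$ in $\mathbf R^3$ and all of whose partial derivatives extend continuously to $O$ (the extensions are denoted by the same symbols), with the topology of uniform convergence of all partial derivatives on compact subsets of $O$. Products carry the product topology. Class $C^\infty_\pi$ (Keller): for locally convex $E,F$ and a function $f$ with $\operatorname{dom}f\subseteq E$ and values in $F$, put $d_uf(x)=\lim_{t\to0}t^{-1}(f(x+tu)-f(x))$ and $d(u_1,\dots,u_l)f=d_{u_l}\cdots d_{u_1}f$. $(E,F,f)\in C^\infty_\pi$ means: $\operatorname{dom}f$ is open in $E$ and for every integer $l\ge0$ and $x\in\operatorname{dom}f$, the map $d^lf(x):(u_1,\dots,u_l)\mapsto d(u_1,\dots,u_l)f(x)$ is everywhere defined, $l$-linear and continuous $E^l\to F$, and for every zero neighbourhood $W$ in $F$ there is a zero neighbourhood $U$ in $E$ such that for every $\varepsilon>0$ there is a zero neighbourhood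 $V$ in $E$ with $(d^lf(x+v)-d^lf(x))[U^l]\subseteq\varepsilon W$ for all $v\in V$. *)

theory Defs
  imports "HOL-Analysis.Analysis" "HOL-Library.Function_Algebras"
begin

instantiation "fun" :: (type, real_vector) real_vector
begin

definition scaleR_fun_def: "r *\<^sub>R f = (\<lambda>x. r *\<^sub>R f x)"

instance
  by standard (simp_all add: scaleR_fun_def fun_eq_iff scaleR_add_left scaleR_add_right)

end

lemma scaleR_fun_apply [simp]: "(r *\<^sub>R f) x = r *\<^sub>R f x"
  by (simp add: scaleR_fun_def)

text \<open>
  Spaces of real functions on a set \<open>S\<close> are linear subspaces of \<^typ>\<open>'c \<Rightarrow> real\<close>: a function on \<open>S\<close>
  is represented by its extension by zero, so that the pointwise operations and the
  equality of total functions are those of functions on \<open>S\<close>. A topological vector space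
  is a value \<open>T\<close> of type \<^typ>\<open>'a::real_vector topology\<close> whose carrier \<^term>\<open>topspace T\<close> is a linear
  subspace of the type. The class topology of \<open>'a\<close> plays no role.
\<close>


subsection \<open>Locally convex spaces and the class \<open>C\<^sup>\<infinity>\<^sub>\<pi>\<close>\<close>

definition zero_nhd :: "'a::real_vector topology \<Rightarrow> 'a set \<Rightarrow> bool" where
  "zero_nhd T W \<longleftrightarrow> W \<subseteq> topspace T \<and> (\<exists>U. openin T U \<and> 0 \<in> U \<and> U \<subseteq> W)"

definition locally_convex_space :: "'a::real_vector topology \<Rightarrow> bool" where
  "locally_convex_space T \<longleftrightarrow>
     subspace (topspace T) \<and>
     continuous_map (prod_topology T T) T (\<lambda>(x, y). x + y) \<and>
     continuous_map (prod_topology euclideanreal T) T (\<lambda>(c, x). c *\<^sub>R x) \<and>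
     Hausdorff_space T \<and>
     (\<forall>W. zero_nhd T W \<longrightarrow> (\<exists>U. zero_nhd T U \<and> convex U \<and> U \<subseteq> W))"

text \<open>
  A partial function is its graph, a single-valued relation \<open>f\<close> with domain \<^term>\<open>Domain f\<close>.
\<close>

definition fun_val :: "('a \<times> 'b) set \<Rightarrow> 'a \<Rightarrow> 'b" where
  "fun_val f x = (THE y. (x, y) \<in> f)"

text \<open>
  \<open>dir_deriv F u f\<close> is the partial function \<open>d\<^sub>u f\<close>, defined at those \<open>x\<close> where the limit exists in \<open>F\<close>.
\<close>

definition dir_deriv ::
  "'b::real_vector topology \<Rightarrow> 'a::real_vector \<Rightarrow> ('a \<times> 'b) set \<Rightarrow> ('a \<times> 'b) set" where
  "dir_deriv F u f =
     {(x, d). x \<in> Domain f \<and> (\<forall>\<^sub>F t in at 0. x + t *\<^sub>R u \<in> Domain f) \<and>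
        limitin F (\<lambda>t. inverse t *\<^sub>R (fun_val f (x + t *\<^sub>R u) - fun_val f x)) d (at (0::real))}"

text \<open>
  The directions \<open>u\<^sub>1, \<dots>, u\<^sub>l\<close> are \<open>us 0, \<dots>, us (l - 1)\<close>; the derivative along \<open>u\<^sub>1\<close> is taken first.
\<close>

definition iter_dir_deriv ::
  "'b::real_vector topology \<Rightarrow> nat \<Rightarrow> (nat \<Rightarrow> 'a::real_vector) \<Rightarrow> ('a \<times> 'b) set \<Rightarrow> ('a \<times> 'b) set" where
  "iter_dir_deriv F l us f = fold (dir_deriv F) (map us [0..<l]) f"

definition multilinear_on ::
  "nat \<Rightarrow> 'a::real_vector set \<Rightarrow> ((nat \<Rightarrow> 'a) \<Rightarrow> 'b::real_vector) \<Rightarrow> bool" where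
  "multilinear_on l S m \<longleftrightarrow>
     (\<forall>us \<in> {..<l} \<rightarrow>\<^sub>E S. \<forall>i<l. \<forall>a\<in>S. \<forall>b\<in>S. \<forall>c.
        m (us(i := a + b)) = m (us(i := a)) + m (us(i := b)) \<and>
        m (us(i := c *\<^sub>R a)) = c *\<^sub>R m (us(i := a)))"

definition Cinf_pi ::
  "'a::real_vector topology \<Rightarrow> 'b::real_vector topology \<Rightarrow> ('a \<times> 'b) set \<Rightarrow> bool" where
  "Cinf_pi E F f \<longleftrightarrow>
     locally_convex_space E \<and> locally_convex_space F \<and>
     single_valued f \<and> Range f \<subseteq> topspace F \<and> openin E (Domain f) \<and>
     (\<forall>l. \<forall>x \<in> Domain f.
        let D = (\<lambda>x us. fun_val (iter_dir_deriv F l us f) x) in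
          (\<forall>us \<in> {..<l} \<rightarrow>\<^sub>E topspace E. x \<in> Domain (iter_dir_deriv F l us f)) \<and>
          multilinear_on l (topspace E) (D x) \<and>
          continuous_map (product_topology (\<lambda>_. E) {..<l}) F (D x) \<and>
          (\<forall>W. zero_nhd F W \<longrightarrow>
             (\<exists>U. zero_nhd E U \<and>
                (\<forall>\<epsilon>>0. \<exists>V. zero_nhd E V \<and>
                   (\<forall>v\<in>V. x + v \<in> Domain f \<and>
                      (\<forall>us \<in> {..<l} \<rightarrow>\<^sub>E U. D (x + v) us - D x us \<in> (*\<^sub>R) \<epsilon> ` W))))))"


subsection \<open>Topologies of uniform convergence\<close>

text \<open>
  Uniform convergence on \<open>K\<close> of the functions \<open>D f\<close>, for all pairs \<open>(D, K)\<close> in \<open>P\<close>.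
\<close>

definition uniform_nhd ::
  "'a set \<Rightarrow> (('a \<Rightarrow> 'c \<Rightarrow> real) \<times> 'c set) set \<Rightarrow> real \<Rightarrow> 'a \<Rightarrow> 'a set" where
  "uniform_nhd X Q \<epsilon> f = {g \<in> X. \<forall>(D, K) \<in> Q. \<forall>z\<in>K. \<bar>D g z - D f z\<bar> < \<epsilon>}"

definition uniform_topology ::
  "'a set \<Rightarrow> (('a \<Rightarrow> 'c \<Rightarrow> real) \<times> 'c set) set \<Rightarrow> 'a topology" where
  "uniform_topology X P =
     topology (\<lambda>U. U \<subseteq> X \<and>
       (\<forall>f\<in>U. \<exists>Q \<epsilon>. finite Q \<and> Q \<subseteq> P \<and> 0 < \<epsilon> \<and> uniform_nhd X Q \<epsilon> f \<subseteq> U))"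

lemma uniform_nhd_mono:
  "\<lbrakk>Q \<subseteq> Q'; \<epsilon>' \<le> \<epsilon>\<rbrakk> \<Longrightarrow> uniform_nhd X Q' \<epsilon>' f \<subseteq> uniform_nhd X Q \<epsilon> f"
proof
  fix g assume le: "Q \<subseteq> Q'" "\<epsilon>' \<le> \<epsilon>" and g: "g \<in> uniform_nhd X Q' \<epsilon>' f"
  have "\<bar>D g z - D f z\<bar> < \<epsilon>" if "(D, K) \<in> Q" "z \<in> K" for D K z
  proof -
    have "(D, K) \<in> Q'" using le(1) that(1) by (rule subsetD)
    then have "\<bar>D g z - D f z\<bar> < \<epsilon>'"
      using g that(2) unfolding uniform_nhd_def by fast
    with le(2) show ?thesis by linarith
  qed
  with g show "g \<in> uniform_nhd X Q \<epsilon> f"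
    unfolding uniform_nhd_def by fast
qed

lemma openin_uniform_topology:
  "openin (uniform_topology X P) U \<longleftrightarrow>
     U \<subseteq> X \<and> (\<forall>f\<in>U. \<exists>Q \<epsilon>. finite Q \<and> Q \<subseteq> P \<and> 0 < \<epsilon> \<and> uniform_nhd X Q \<epsilon> f \<subseteq> U)"
proof -
  define L where "L = (\<lambda>U. U \<subseteq> X \<and>
    (\<forall>f\<in>U. \<exists>Q \<epsilon>. finite Q \<and> Q \<subseteq> P \<and> 0 < \<epsilon> \<and> uniform_nhd X Q \<epsilon> f \<subseteq> U))"
  have "L (S \<inter> T)" if S: "L S" and T: "L T" for S T
    unfolding L_def
  proof (intro conjI ballI)
    show "S \<inter> T \<subseteq> X" using S unfolding L_def by (meson inf.coboundedI1)
    fix f assume f: "f \<in> S \<inter> T"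
    obtain Q1 e1 where 1: "finite Q1" "Q1 \<subseteq> P" "0 < e1" "uniform_nhd X Q1 e1 f \<subseteq> S"
      using S f unfolding L_def by (meson IntD1)
    obtain Q2 e2 where 2: "finite Q2" "Q2 \<subseteq> P" "0 < e2" "uniform_nhd X Q2 e2 f \<subseteq> T"
      using T f unfolding L_def by (meson IntD2)
    have "uniform_nhd X (Q1 \<union> Q2) (min e1 e2) f \<subseteq> S"
      using uniform_nhd_mono[of Q1 "Q1 \<union> Q2" "min e1 e2" e1 X f] 1(4) by simp
    moreover have "uniform_nhd X (Q1 \<union> Q2) (min e1 e2) f \<subseteq> T"
      using uniform_nhd_mono[of Q2 "Q1 \<union> Q2" "min e1 e2" e2 X f] 2(4) by simp
    ultimately show "\<exists>Q \<epsilon>. finite Q \<and> Q \<subseteq> P \<and> 0 < \<epsilon> \<and> uniform_nhd X Q \<epsilon> f \<subseteq> S \<inter> T"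
      using 1(1-3) 2(1-3) by (intro exI[of _ "Q1 \<union> Q2"] exI[of _ "min e1 e2"]) simp
  qed
  moreover have "L (\<Union>\<K>)" if K: "\<forall>K\<in>\<K>. L K" for \<K>
    unfolding L_def
  proof (intro conjI ballI)
    show "\<Union>\<K> \<subseteq> X" using K unfolding L_def by (meson Sup_least)
    fix f assume "f \<in> \<Union>\<K>"
    then obtain K where K': "K \<in> \<K>" "f \<in> K" by (rule UnionE)
    then obtain Q e where "finite Q" "Q \<subseteq> P" "0 < e" "uniform_nhd X Q e f \<subseteq> K"
      using K unfolding L_def by meson
    with K'(1) show "\<exists>Q \<epsilon>. finite Q \<and> Q \<subseteq> P \<and> 0 < \<epsilon> \<and> uniform_nhd X Q \<epsilon> f \<subseteq> \<Union>\<K>"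
      by (meson Sup_upper subset_trans)
  qed
  ultimately have "istopology L"
    unfolding istopology_def by (intro conjI allI impI)
  then have "openin (topology L) U = L U"
    by (simp only: topology_inverse')
  then show ?thesis
    unfolding uniform_topology_def L_def .
qed

lemma topspace_uniform_topology [simp]: "topspace (uniform_topology X P) = X"
proof (rule subset_antisym)
  show "topspace (uniform_topology X P) \<subseteq> X"
    using openin_topspace[of "uniform_topology X P"] by (simp only: openin_uniform_topology)
  have "uniform_nhd X {} 1 f \<subseteq> X" for f
    by (simp add: uniform_nhd_def)
  then have "openin (uniform_topology X P) X"
    unfolding openin_uniform_topology
    by (intro conjI ballI exI[of _ "{}"] exI[of _ "1::real"]) simp_all
  then show "X \<subseteq> topspace (uniform_topology X P)"
    by (rule openin_subset)
qed


subsection \<open>The spaces \<open>C\<^sup>i(I)\<close>\<close>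

definition ideriv :: "nat \<Rightarrow> (real \<Rightarrow> real) \<Rightarrow> real \<Rightarrow> real" where
  "ideriv k = (\<lambda>f s. vector_derivative f (at s within {0..1})) ^^ k"

definition CI :: "enat \<Rightarrow> (real \<Rightarrow> real) set" where
  "CI i = {f. (\<forall>s. s \<notin> {0..1} \<longrightarrow> f s = 0) \<and>
     (\<forall>k. enat k < i \<longrightarrow> (\<forall>s\<in>{0..1}. ideriv k f differentiable (at s within {0..1}))) \<and>
     (\<forall>k. enat k \<le> i \<longrightarrow> continuous_on {0..1} (ideriv k f))}"

definition CI_topology :: "enat \<Rightarrow> (real \<Rightarrow> real) topology" where
  "CI_topology i = uniform_topology (CI i) {(ideriv k, {0..1}) |k. enat k < i + 1}"


subsection \<open>The space \<open>C\<^sup>\<infinity>(\<Omega>)\<close>\<close>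

type_synonym real3 = "real \<times> real \<times> real"

definition partial_deriv :: "real3 \<Rightarrow> (real3 \<Rightarrow> real) \<Rightarrow> real3 \<Rightarrow> real" where
  "partial_deriv b \<phi> z = vector_derivative (\<lambda>t. \<phi> (z + t *\<^sub>R b)) (at 0)"

text \<open>Iterated partial derivatives along a list of standard basis vectors, first entry first.\<close>

definition partial_derivs :: "real3 list \<Rightarrow> (real3 \<Rightarrow> real) \<Rightarrow> real3 \<Rightarrow> real" where
  "partial_derivs bs \<phi> = fold partial_deriv bs \<phi>"

definition smooth_on :: "real3 set \<Rightarrow> (real3 \<Rightarrow> real) \<Rightarrow> bool" where
  "smooth_on U \<phi> \<longleftrightarrow> (\<forall>bs \<in> lists Basis.
     continuous_on U (partial_derivs bs \<phi>) \<and>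
     (\<forall>b\<in>Basis. \<forall>z\<in>U. (\<lambda>t. partial_derivs bs \<phi> (z + t *\<^sub>R b)) differentiable (at 0)))"

definition CO :: "real3 set \<Rightarrow> (real3 \<Rightarrow> real) set" where
  "CO \<Omega> = {\<phi>. (\<forall>z. z \<notin> \<Omega> \<longrightarrow> \<phi> z = 0) \<and> continuous_on \<Omega> \<phi> \<and> smooth_on (interior \<Omega>) \<phi> \<and>
     (\<forall>bs \<in> lists Basis. \<exists>\<psi>. continuous_on \<Omega> \<psi> \<and>
        (\<forall>z \<in> interior \<Omega>. \<psi> z = partial_derivs bs \<phi> z))}"

text \<open>
  The continuous extension to \<open>\<Omega>\<close> of an iterated partial derivative. It is unique, and given
  by this limit, when \<open>interior \<Omega>\<close> is dense in \<open>\<Omega>\<close>, as it is for \<open>\<Omega>\<close> relatively open in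
  \<open>{0..1} \<times> UNIV \<times> UNIV\<close>.
\<close>

definition ext_partial :: "real3 set \<Rightarrow> real3 list \<Rightarrow> (real3 \<Rightarrow> real) \<Rightarrow> real3 \<Rightarrow> real" where
  "ext_partial \<Omega> bs \<phi> z = Lim (at z within interior \<Omega>) (partial_derivs bs \<phi>)"

definition CO_topology :: "real3 set \<Rightarrow> (real3 \<Rightarrow> real) topology" where
  "CO_topology \<Omega> = uniform_topology (CO \<Omega>)
     {(ext_partial \<Omega> bs, K) |bs K. bs \<in> lists Basis \<and> compact K \<and> K \<subseteq> \<Omega>}"


subsection \<open>The boundary value problem\<close>

type_synonym bvp_data = "real \<times> real \<times> (real3 \<Rightarrow> real)"

definition data_topology :: "real3 set \<Rightarrow> bvp_data topology" where
  "data_topology \<Omega> = prod_topology euclideanreal (prod_topology euclideanreal (CO_topology \<Omega>))"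

definition solution_set :: "real3 set \<Rightarrow> (bvp_data \<times> (real \<Rightarrow> real)) set" where
  "solution_set \<Omega> = {((\<eta>\<^sub>0, \<eta>\<^sub>1, \<phi>), y). \<phi> \<in> CO \<Omega> \<and> y \<in> CI 2 \<and> y 0 = \<eta>\<^sub>0 \<and> y 1 = \<eta>\<^sub>1 \<and>
     (\<forall>s\<in>{0..1}. (s, y s, ideriv 1 y s) \<in> \<Omega> \<and> ideriv 2 y s = \<phi> (s, y s, ideriv 1 y s))}"

definition F0 :: "(real \<Rightarrow> real) set" where
  "F0 = {u \<in> CI 2. u 0 = 0 \<and> u 1 = 0}"

definition regular :: "real3 set \<Rightarrow> bvp_data \<times> (real \<Rightarrow> real) \<Rightarrow> bool" where
  "regular \<Omega> = (\<lambda>((\<eta>\<^sub>0, \<eta>\<^sub>1, \<phi>), y).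
     let p\<^sub>2 = (\<lambda>s. ext_partial \<Omega> [(0, 1, 0)] \<phi> (s, y s, ideriv 1 y s));
         p\<^sub>3 = (\<lambda>s. ext_partial \<Omega> [(0, 0, 1)] \<phi> (s, y s, ideriv 1 y s))
     in \<forall>v\<in>F0. \<exists>!u. u \<in> F0 \<and>
          (\<forall>s\<in>{0..1}. ideriv 2 u s - p\<^sub>3 s * ideriv 1 u s - p\<^sub>2 s * u s = ideriv 2 v s))"

definition regular_solution_set :: "real3 set \<Rightarrow> (bvp_data \<times> (real \<Rightarrow> real)) set" where
  "regular_solution_set \<Omega> = {w \<in> solution_set \<Omega>. regular \<Omega> w}"

end

theory Submission
  imports Defs
begin

text \<open>
  Near a regular solution the boundary value problem is a uniformly small perturbation of an
  invertible linear one: regularity gives a two-point a priori bound (via Gronwall and the solution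
  of the homogeneous equation with boundary values 0 and 1), and a contraction on the right-hand
  side \<open>y''\<close> yields a unique nearby solution depending in a Lipschitz way on the data. Only the norms
  of finitely many derivatives of \<open>\<phi>\<close> on a fixed compact tube \<open>K\<close> around the base curve enter.

  Both the directional derivatives of the solution map and the \<open>s\<close>-derivatives of its values are
  obtained from the solution and the derivatives of \<open>\<phi>\<close> and the directions along the curve by
  sums, products and solving the linearized problem. Encoding such functions as formal expressions,
  which are closed under both kinds of derivative, reduces the statement about all orders and all
  seminorms of \<open>C\<^sup>\<infinity>(I)\<close> to sup-norm estimates for one expression, proved by structural
  induction.
\<close>

subsection \<open>Topologies of uniform convergence\<close>

text \<open>The topologies involved are given by infinitely many seminorms, and orders interact: the
  l-th derivative of the solution map, measured with k derivatives in \<open>s\<close>, involves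
  derivatives of \<phi> of an order that grows with l and k. The uniformity in
  \<open>Cinf_pi\<close> survives because of the order of choices: the expression fixes an order N,
  the unit ball \<open>B N 1\<close> serves as the set of directions, and only the neighbourhood of
  the base point depends on \<epsilon>. The domain is open already for the seminorms of order one,
  so it does not shrink as l or k grows. A second obstacle is the boundary: partial derivatives of
  \<phi> are genuine only in the interior of \<Omega>, while every solution curve starts and ends on
  the faces s = 0 and s = 1. The extended derivatives therefore have to be shown differentiable
  relative to \<Omega> up to these faces. All constants follow one budget: if the linear problem has
  bound M, a perturbation with Lipschitz constant 1/(2 M) costs at most half of the solution and can
  be absorbed, so each of the two partial derivatives with respect to y and y' may deviate by 1/(4
  M).\<close>

definition uniform_core ::
  "'a set \<Rightarrow> (('a \<Rightarrow> 'c \<Rightarrow> real) \<times> 'c set) set \<Rightarrow> real \<Rightarrow> 'a \<Rightarrow> 'a set" where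
  "uniform_core X Q \<epsilon> f = {g \<in> X. \<exists>\<delta><\<epsilon>. \<forall>(D, K) \<in> Q. \<forall>z\<in>K. \<bar>D g z - D f z\<bar> \<le> \<delta>}"

text \<open>\<open>uniform_nhd\<close> itself need not be open: a strict inequality at each point of
  an infinite \<open>K\<close> still allows the supremum to equal \<epsilon>. The margin \<delta> <
  \<epsilon> in \<open>uniform_core\<close> is uniform in the points, and half of what remains is a
  radius around any member.\<close>

lemma openin_uniform_core:
  assumes "finite Q" "Q \<subseteq> P"
  shows "openin (uniform_topology X P) (uniform_core X Q \<epsilon> f)"
  unfolding openin_uniform_topology
proof (intro conjI ballI)
  show "uniform_core X Q \<epsilon> f \<subseteq> X" by (auto simp: uniform_core_def)
  fix g assume "g \<in> uniform_core X Q \<epsilon> f"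
  then obtain \<delta> where d: "\<delta> < \<epsilon>" "\<forall>(D, K) \<in> Q. \<forall>z\<in>K. \<bar>D g z - D f z\<bar> \<le> \<delta>"
    by (auto simp: uniform_core_def)
  have "uniform_nhd X Q ((\<epsilon> - \<delta>)/2) g \<subseteq> uniform_core X Q \<epsilon> f"
  proof
    fix h assume h: "h \<in> uniform_nhd X Q ((\<epsilon> - \<delta>)/2) g"
    have "\<bar>D h z - D f z\<bar> \<le> (\<epsilon> + \<delta>)/2" if "(D, K) \<in> Q" "z \<in> K" for D K z
    proof -
      have "\<bar>D h z - D g z\<bar> < (\<epsilon> - \<delta>)/2"
        using h that by (fastforce simp: uniform_nhd_def)
      moreover have "\<bar>D g z - D f z\<bar> \<le> \<delta>" using d(2) that by fast
      ultimately show ?thesis by argo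
    qed
    moreover have "(\<epsilon> + \<delta>)/2 < \<epsilon>" using d(1) by simp
    moreover have "h \<in> X" using h by (simp add: uniform_nhd_def)
    ultimately show "h \<in> uniform_core X Q \<epsilon> f"
      unfolding uniform_core_def by blast
  qed
  then show "\<exists>Q' \<epsilon>'. finite Q' \<and> Q' \<subseteq> P \<and> 0 < \<epsilon>' \<and> uniform_nhd X Q' \<epsilon>' g \<subseteq> uniform_core X Q \<epsilon> f"
    using assms d(1) by (intro exI[of _ Q] exI[of _ "(\<epsilon> - \<delta>)/2"]) auto
qed

lemma uniform_core_self: "f \<in> X \<Longrightarrow> 0 < \<epsilon> \<Longrightarrow> f \<in> uniform_core X Q \<epsilon> f"
  unfolding uniform_core_def by auto

lemma uniform_core_subset: "uniform_core X Q \<epsilon> f \<subseteq> uniform_nhd X Q \<epsilon> f"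
  unfolding uniform_core_def uniform_nhd_def by fastforce

lemma uniform_open_nhd:
  assumes "finite Q" "Q \<subseteq> P" "f \<in> X" "0 < \<epsilon>"
  obtains U where "openin (uniform_topology X P) U" "f \<in> U" "U \<subseteq> uniform_nhd X Q \<epsilon> f"
  using openin_uniform_core[OF assms(1,2)] uniform_core_self[OF assms(3,4)] uniform_core_subset
  by metis

lemma limitin_uniform_topologyI:
  assumes "l \<in> X" "\<forall>\<^sub>F i in F. h i \<in> X"
    and "\<And>D K \<epsilon>. (D, K) \<in> P \<Longrightarrow> 0 < \<epsilon> \<Longrightarrow> \<forall>\<^sub>F i in F. \<forall>z\<in>K. \<bar>D (h i) z - D l z\<bar> < \<epsilon>"
  shows "limitin (uniform_topology X P) h l F"
  unfolding limitin_def
proof (intro conjI allI impI)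
  show "l \<in> topspace (uniform_topology X P)" using assms(1) by simp
  fix U assume "openin (uniform_topology X P) U \<and> l \<in> U"
  then obtain Q \<epsilon> where Q: "finite Q" "Q \<subseteq> P" "0 < \<epsilon>" "uniform_nhd X Q \<epsilon> l \<subseteq> U"
    unfolding openin_uniform_topology by meson
  have "\<forall>\<^sub>F i in F. \<forall>q\<in>Q. \<forall>z\<in>snd q. \<bar>fst q (h i) z - fst q l z\<bar> < \<epsilon>"
    using Q assms(3) by (intro eventually_ball_finite) auto
  with assms(2) have "\<forall>\<^sub>F i in F. h i \<in> uniform_nhd X Q \<epsilon> l"
    by eventually_elim (auto simp: uniform_nhd_def)
  then show "\<forall>\<^sub>F i in F. h i \<in> U"
    using Q(4) by (auto elim: eventually_mono)
qed

lemma continuous_map_uniform_topologyI: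
  assumes "\<And>x. x \<in> topspace T \<Longrightarrow> h x \<in> X"
    and "\<And>x D K \<epsilon>. x \<in> topspace T \<Longrightarrow> (D, K) \<in> P \<Longrightarrow> 0 < \<epsilon> \<Longrightarrow>
      \<exists>U. openin T U \<and> x \<in> U \<and> (\<forall>x'\<in>U. \<forall>z\<in>K. \<bar>D (h x') z - D (h x) z\<bar> < \<epsilon>)"
  shows "continuous_map T (uniform_topology X P) h"
  unfolding continuous_map_def
proof (intro conjI allI impI)
  show "h \<in> topspace T \<rightarrow> topspace (uniform_topology X P)" using assms(1) by simp
  fix V assume V: "openin (uniform_topology X P) V"
  have "\<exists>U. openin T U \<and> x \<in> U \<and> U \<subseteq> {x \<in> topspace T. h x \<in> V}"
    if x: "x \<in> topspace T" "h x \<in> V" for x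
  proof -
    obtain Q \<epsilon> where Q: "finite Q" "Q \<subseteq> P" "0 < \<epsilon>" "uniform_nhd X Q \<epsilon> (h x) \<subseteq> V"
      using V x unfolding openin_uniform_topology by meson
    have "\<forall>q\<in>Q. \<exists>U. openin T U \<and> x \<in> U \<and>
        (\<forall>x'\<in>U. \<forall>z\<in>snd q. \<bar>fst q (h x') z - fst q (h x) z\<bar> < \<epsilon>)"
      using assms(2)[OF x(1) _ Q(3)] Q(2) by (simp add: subset_iff split_paired_all)
    from bchoice[OF this] obtain U where U: "\<forall>q\<in>Q. openin T (U q) \<and> x \<in> U q \<and>
        (\<forall>x'\<in>U q. \<forall>z\<in>snd q. \<bar>fst q (h x') z - fst q (h x) z\<bar> < \<epsilon>)" ..
    \<comment> \<open>If \<open>Q\<close> is empty, the intersection of the \<open>U q\<close> is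
      the whole type; intersecting with the carrier keeps \<open>V'\<close> open in
      \<open>T\<close>.\<close>
    define V' where "V' = topspace T \<inter> (\<Inter>q\<in>Q. U q)"
    have "openin T V'"
      using U Q(1) unfolding V'_def
      by (cases "Q = {}") (auto intro!: openin_Int openin_INT2)
    moreover have "x \<in> V'" using U x by (auto simp: V'_def)
    moreover have "h x' \<in> uniform_nhd X Q \<epsilon> (h x)" if "x' \<in> V'" for x'
      using that U assms(1) unfolding V'_def uniform_nhd_def by force
    ultimately show ?thesis using Q(4) unfolding V'_def by (intro exI[of _ V']) (auto simp: V'_def)
  qed
  then show "openin T {x \<in> topspace T. h x \<in> V}"
    by (subst openin_subopen) auto
qed

lemma zero_nhd_uniform_topologyD:
  assumes "zero_nhd (uniform_topology X P) W"
  obtains Q \<epsilon> where "finite Q" "Q \<subseteq> P" "0 < \<epsilon>" "uniform_nhd X Q \<epsilon> 0 \<subseteq> W"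
  using assms unfolding zero_nhd_def openin_uniform_topology by (meson subset_trans)

text \<open>Linearity and boundedness of \<open>D\<close> are required only on the set
  \<open>K\<close> paired with it, where derivatives have a meaning. There the supremum of |D f| is
  a seminorm; its finiteness enters through the continuity of scalar multiplication, and
  \<open>sep\<close> gives the Hausdorff property.\<close>

lemma locally_convex_uniform_topology:
  assumes X: "subspace X"
    and lin': "\<forall>(D, K)\<in>P. \<forall>f\<in>X. \<forall>g\<in>X. \<forall>z\<in>K. \<forall>c. D (c *\<^sub>R f + g) z = c * D f z + D g z"
    and bdd': "\<forall>(D, K)\<in>P. \<forall>f\<in>X. \<exists>C. \<forall>z\<in>K. \<bar>D f z\<bar> \<le> C"
    and sep: "\<And>f g. f \<in> X \<Longrightarrow> g \<in> X \<Longrightarrow> f \<noteq> g \<Longrightarrow> \<exists>(D, K) \<in> P. \<exists>z\<in>K. D f z \<noteq> D g z"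
  shows "locally_convex_space (uniform_topology X P)"
proof -
  note [simp] = subspace_0[OF X]
  note X_add = subspace_add[OF X] and X_scale = subspace_scale[OF X]
  have lin: "D (c *\<^sub>R f + g) z = c * D f z + D g z"
    if "(D, K) \<in> P" "f \<in> X" "g \<in> X" "z \<in> K" for D K f g c z
    using lin' that by blast
  have bdd: "\<exists>C. \<forall>z\<in>K. \<bar>D f z\<bar> \<le> C" if "(D, K) \<in> P" "f \<in> X" for D K f
    using bdd' that by blast
  have lin0: "D 0 z = 0" if "(D, K) \<in> P" "z \<in> K" for D K z
    using lin[of D K 0 0 z 1] that by simp
  have linS: "D (c *\<^sub>R f) z = c * D f z" if "(D, K) \<in> P" "f \<in> X" "z \<in> K" for D K f c z
    using lin[of D K f 0 z c] lin0 that by simp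
  have linA: "D (f + g) z = D f z + D g z" if "(D, K) \<in> P" "f \<in> X" "g \<in> X" "z \<in> K" for D K f g z
    using lin[of D K f g z 1] that by simp
  let ?T = "uniform_topology X P"
  have nhd: "\<exists>U. openin ?T U \<and> f \<in> U \<and> (\<forall>g\<in>U. g \<in> X \<and> (\<forall>z\<in>K. \<bar>D g z - D f z\<bar> < \<epsilon>))"
    if "(D, K) \<in> P" and fX: "f \<in> X" and e: "0 < \<epsilon>" for D K f \<epsilon>
  proof -
    obtain U where "openin ?T U" "f \<in> U" "U \<subseteq> uniform_nhd X {(D, K)} \<epsilon> f"
      using uniform_open_nhd[of "{(D, K)}" P f X \<epsilon>] \<open>(D, K) \<in> P\<close> fX e by auto
    then show ?thesis by (intro exI[of _ U]) (auto simp: uniform_nhd_def)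
  qed
  have add: "continuous_map (prod_topology ?T ?T) ?T (\<lambda>(x, y). x + y)"
  proof (rule continuous_map_uniform_topologyI)
    fix p assume p: "p \<in> topspace (prod_topology ?T ?T)"
    then show "(case p of (x, y) \<Rightarrow> x + y) \<in> X" using X_add by auto
    fix D K and \<epsilon> :: real assume DK: "(D, K) \<in> P" and e: "0 < \<epsilon>"
    obtain f g where fg: "p = (f, g)" "f \<in> X" "g \<in> X" using p by auto
    obtain U where U: "openin ?T U" "f \<in> U" "\<forall>g\<in>U. g \<in> X \<and> (\<forall>z\<in>K. \<bar>D g z - D f z\<bar> < \<epsilon>/2)"
      using nhd[OF DK fg(2), of "\<epsilon>/2"] e by auto
    obtain V where V: "openin ?T V" "g \<in> V" "\<forall>h\<in>V. h \<in> X \<and> (\<forall>z\<in>K. \<bar>D h z - D g z\<bar> < \<epsilon>/2)"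
      using nhd[OF DK fg(3), of "\<epsilon>/2"] e by auto
    have "\<bar>D (f' + g') z - D (f + g) z\<bar> < \<epsilon>" if "f' \<in> U" "g' \<in> V" "z \<in> K" for f' g' z
    proof -
      have "\<bar>D f' z - D f z\<bar> < \<epsilon>/2" "\<bar>D g' z - D g z\<bar> < \<epsilon>/2" using U V that by auto
      moreover have "D (f' + g') z = D f' z + D g' z" "D (f + g) z = D f z + D g z"
        using linA[OF DK] U V that fg by auto
      ultimately show ?thesis by linarith
    qed
    then show "\<exists>U. openin (prod_topology ?T ?T) U \<and> p \<in> U \<and>
        (\<forall>x'\<in>U. \<forall>z\<in>K. \<bar>D (case x' of (x, y) \<Rightarrow> x + y) z - D (case p of (x, y) \<Rightarrow> x + y) z\<bar> < \<epsilon>)"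
      using U V fg by (intro exI[of _ "U \<times> V"]) (auto simp: openin_prod_Times_iff)
  qed
  have scale: "continuous_map (prod_topology euclideanreal ?T) ?T (\<lambda>(c, x). c *\<^sub>R x)"
  proof (rule continuous_map_uniform_topologyI)
    fix p assume p: "p \<in> topspace (prod_topology euclideanreal ?T)"
    then show "(case p of (c, x) \<Rightarrow> c *\<^sub>R x) \<in> X" using X_scale by auto
    fix D K and \<epsilon> :: real assume DK: "(D, K) \<in> P" and e: "0 < \<epsilon>"
    obtain c f where cf: "p = (c, f)" "f \<in> X" using p by auto
    obtain C where C: "\<forall>z\<in>K. \<bar>D f z\<bar> \<le> C" using bdd[OF DK cf(2)] by auto
    \<comment> \<open>The constants split c' f' - c f into c' (f' - f) and (c' - c) f, each allowed
      \<epsilon>/2; the summand 1 avoids a division by zero.\<close>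
    define \<delta> where "\<delta> = \<epsilon> / (2 * (\<bar>C\<bar> + 1))"
    have d: "0 < \<delta>" using e by (simp add: \<delta>_def)
    define \<epsilon>' where "\<epsilon>' = \<epsilon> / (2 * (\<bar>c\<bar> + \<delta>))"
    have e': "0 < \<epsilon>'" unfolding \<epsilon>'_def using e d by (intro divide_pos_pos) auto
    obtain U where U: "openin ?T U" "f \<in> U" "\<forall>g\<in>U. g \<in> X \<and> (\<forall>z\<in>K. \<bar>D g z - D f z\<bar> < \<epsilon>')"
      using nhd[OF DK cf(2) e'] by auto
    have "\<bar>D (c' *\<^sub>R f') z - D (c *\<^sub>R f) z\<bar> < \<epsilon>"
      if c': "c' \<in> ball c \<delta>" and f': "f' \<in> U" and z: "z \<in> K" for c' f' z
    proof -
      have 1: "\<bar>D f' z - D f z\<bar> < \<epsilon>'" using U f' z by auto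
      have 2: "\<bar>c' - c\<bar> < \<delta>" using c' by (simp add: dist_real_def)
      have 3: "\<bar>c'\<bar> < \<bar>c\<bar> + \<delta>" using 2 by linarith
      have "\<bar>c'\<bar> * \<bar>D f' z - D f z\<bar> \<le> (\<bar>c\<bar> + \<delta>) * \<bar>D f' z - D f z\<bar>"
        using 3 by (intro mult_right_mono) auto
      also have "\<dots> < (\<bar>c\<bar> + \<delta>) * \<epsilon>'" using 1 d by (intro mult_strict_left_mono) auto
      also have "\<dots> = \<epsilon>/2" using d by (simp add: \<epsilon>'_def field_simps)
      finally have 4: "\<bar>c' * (D f' z - D f z)\<bar> < \<epsilon>/2" by (simp add: abs_mult)
      have "\<bar>c' - c\<bar> * \<bar>D f z\<bar> \<le> \<delta> * (\<bar>C\<bar> + 1)"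
        using 2 C z d by (intro mult_mono) force+
      also have "\<dots> = \<epsilon>/2" by (simp add: \<delta>_def field_simps)
      finally have 5: "\<bar>(c' - c) * D f z\<bar> \<le> \<epsilon>/2" by (simp add: abs_mult)
      have "D (c' *\<^sub>R f') z - D (c *\<^sub>R f) z = c' * (D f' z - D f z) + (c' - c) * D f z"
        using linS[OF DK] U f' cf z by (simp add: algebra_simps)
      then show ?thesis using 4 5 by linarith
    qed
    then show "\<exists>U. openin (prod_topology euclideanreal ?T) U \<and> p \<in> U \<and>
        (\<forall>x'\<in>U. \<forall>z\<in>K. \<bar>D (case x' of (c, x) \<Rightarrow> c *\<^sub>R x) z - D (case p of (c, x) \<Rightarrow> c *\<^sub>R x) z\<bar> < \<epsilon>)"
      using U cf d by (intro exI[of _ "ball c \<delta> \<times> U"]) (auto simp: openin_prod_Times_iff)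
  qed
  have haus: "Hausdorff_space ?T"
    unfolding Hausdorff_space_def
  proof (intro allI impI, elim conjE)
    fix f g assume f: "f \<in> topspace ?T" and g: "g \<in> topspace ?T" and "f \<noteq> g"
    then obtain D K z where DK: "(D, K) \<in> P" "z \<in> K" "D f z \<noteq> D g z" using sep by fastforce
    define \<epsilon> where "\<epsilon> = \<bar>D f z - D g z\<bar> / 2"
    have "0 < \<epsilon>" using DK by (simp add: \<epsilon>_def)
    obtain U where U: "openin ?T U" "f \<in> U" "\<forall>h\<in>U. h \<in> X \<and> (\<forall>z\<in>K. \<bar>D h z - D f z\<bar> < \<epsilon>)"
      using nhd[OF DK(1) _ \<open>0 < \<epsilon>\<close>, of f] f by auto
    obtain V where V: "openin ?T V" "g \<in> V" "\<forall>h\<in>V. h \<in> X \<and> (\<forall>z\<in>K. \<bar>D h z - D g z\<bar> < \<epsilon>)"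
      using nhd[OF DK(1) _ \<open>0 < \<epsilon>\<close>, of g] g by auto
    have "disjnt U V"
      unfolding disjnt_iff
    proof (intro allI notI, elim conjE)
      fix h assume "h \<in> U" "h \<in> V"
      then have "\<bar>D h z - D f z\<bar> < \<epsilon>" "\<bar>D h z - D g z\<bar> < \<epsilon>" using U V DK by auto
      then show False unfolding \<epsilon>_def by (simp add: abs_if split: if_splits)
    qed
    then show "\<exists>U V. openin ?T U \<and> openin ?T V \<and> f \<in> U \<and> g \<in> V \<and> disjnt U V"
      using U V by blast
  qed
  have conv: "\<exists>U. zero_nhd ?T U \<and> convex U \<and> U \<subseteq> W" if W: "zero_nhd ?T W" for W
  proof -
    obtain Q \<epsilon> where Q: "finite Q" "Q \<subseteq> P" "0 < \<epsilon>" "uniform_nhd X Q \<epsilon> 0 \<subseteq> W"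
      using zero_nhd_uniform_topologyD[OF W] by auto
    obtain U where U: "openin ?T U" "0 \<in> U" "U \<subseteq> uniform_nhd X Q \<epsilon> 0"
      using uniform_open_nhd[OF Q(1,2) subspace_0[OF X] Q(3)] by metis
    moreover have "uniform_nhd X Q \<epsilon> 0 \<subseteq> topspace ?T" by (simp add: uniform_nhd_def)
    ultimately have "zero_nhd ?T (uniform_nhd X Q \<epsilon> 0)" unfolding zero_nhd_def by meson
    moreover have "convex (uniform_nhd X Q \<epsilon> 0)"
      unfolding convex_def
    proof (intro ballI allI impI)
      fix f g and u v :: real
      assume f: "f \<in> uniform_nhd X Q \<epsilon> 0" and g: "g \<in> uniform_nhd X Q \<epsilon> 0"
        and uv: "0 \<le> u" "0 \<le> v" "u + v = 1"
      have fX: "f \<in> X" "g \<in> X" using f g by (auto simp: uniform_nhd_def)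
      have "\<bar>D (u *\<^sub>R f + v *\<^sub>R g) z - D 0 z\<bar> < \<epsilon>" if "(D, K) \<in> Q" "z \<in> K" for D K z
      proof -
        have DK: "(D, K) \<in> P" using that Q by auto
        have "D f z \<in> {-\<epsilon><..<\<epsilon>}" "D g z \<in> {-\<epsilon><..<\<epsilon>}"
          using f g that lin0[OF DK that(2)] by (fastforce simp: uniform_nhd_def)+
        then have "u *\<^sub>R D f z + v *\<^sub>R D g z \<in> {-\<epsilon><..<\<epsilon>}"
          using uv by (intro convexD[OF convex_real_interval(8)]) auto
        moreover have "D (u *\<^sub>R f + v *\<^sub>R g) z = u * D f z + v * D g z"
          using lin[OF DK fX(1) X_scale[OF fX(2)] that(2)] linS[OF DK fX(2) that(2)] by simp
        ultimately show ?thesis using lin0[OF DK that(2)] by (simp add: abs_less_iff)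
      qed
      then show "u *\<^sub>R f + v *\<^sub>R g \<in> uniform_nhd X Q \<epsilon> 0"
        using X_add X_scale fX unfolding uniform_nhd_def by auto
    qed
    ultimately show ?thesis using Q(4) by blast
  qed
  show ?thesis
    unfolding locally_convex_space_def using X add scale haus conv by simp
qed

lemma locally_convex_euclideanreal: "locally_convex_space euclideanreal"
proof -
  have "\<exists>U. zero_nhd euclideanreal U \<and> convex U \<and> U \<subseteq> W" if W: "zero_nhd euclideanreal W" for W :: "real set"
  proof -
    obtain U where "open U" "0 \<in> U" "U \<subseteq> W" using W by (auto simp: zero_nhd_def)
    then obtain e where "e > 0" "ball 0 e \<subseteq> U" using open_contains_ball by blast
    moreover have "zero_nhd euclideanreal (ball 0 e)"
      unfolding zero_nhd_def using \<open>e > 0\<close> by (intro conjI exI[of _ "ball 0 e"]) auto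
    ultimately show ?thesis
      using \<open>U \<subseteq> W\<close> by (intro exI[of _ "ball 0 e"]) (simp add: subset_trans)
  qed
  moreover have "continuous_map (prod_topology euclideanreal euclideanreal) euclideanreal (\<lambda>(x, y). x + y)"
    unfolding case_prod_unfold
    by (intro continuous_map_add continuous_map_fst continuous_map_snd)
  moreover have "continuous_map (prod_topology euclideanreal euclideanreal) euclideanreal (\<lambda>(c, x). c *\<^sub>R x)"
    unfolding case_prod_unfold real_scaleR_def
    by (intro continuous_map_real_mult continuous_map_fst continuous_map_snd)
  ultimately show ?thesis
    unfolding locally_convex_space_def topspace_euclidean
    by (intro conjI subspace_UNIV allI impI) (assumption | rule Hausdorff_space_euclidean | simp)+
qed

lemma locally_convex_prod_topology:
  assumes S: "locally_convex_space S" and T: "locally_convex_space T"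
  shows "locally_convex_space (prod_topology S T)"
proof -
  let ?P = "prod_topology S T"
  have S': "subspace (topspace S)" "continuous_map (prod_topology S S) S (\<lambda>(x, y). x + y)"
    "continuous_map (prod_topology euclideanreal S) S (\<lambda>(c, x). c *\<^sub>R x)" "Hausdorff_space S"
    "\<And>W. zero_nhd S W \<Longrightarrow> \<exists>U. zero_nhd S U \<and> convex U \<and> U \<subseteq> W"
    using S by (auto simp: locally_convex_space_def)
  have T': "subspace (topspace T)" "continuous_map (prod_topology T T) T (\<lambda>(x, y). x + y)"
    "continuous_map (prod_topology euclideanreal T) T (\<lambda>(c, x). c *\<^sub>R x)" "Hausdorff_space T"
    "\<And>W. zero_nhd T W \<Longrightarrow> \<exists>U. zero_nhd T U \<and> convex U \<and> U \<subseteq> W"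
    using T by (auto simp: locally_convex_space_def)
  have f1: "continuous_map (prod_topology ?P ?P) S (\<lambda>p. fst (fst p))"
    "continuous_map (prod_topology ?P ?P) S (\<lambda>p. fst (snd p))"
    "continuous_map (prod_topology ?P ?P) T (\<lambda>p. snd (fst p))"
    "continuous_map (prod_topology ?P ?P) T (\<lambda>p. snd (snd p))"
    by (metis (no_types) continuous_map_compose[unfolded o_def] continuous_map_fst continuous_map_snd)+
  have f2: "continuous_map (prod_topology euclideanreal ?P) euclideanreal fst"
    "continuous_map (prod_topology euclideanreal ?P) S (\<lambda>p. fst (snd p))"
    "continuous_map (prod_topology euclideanreal ?P) T (\<lambda>p. snd (snd p))"
    by (metis (no_types) continuous_map_compose[unfolded o_def] continuous_map_fst continuous_map_snd)+
  have "continuous_map (prod_topology ?P ?P) ?P (\<lambda>p. (fst (fst p) + fst (snd p), snd (fst p) + snd (snd p)))"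
    using continuous_map_compose[OF continuous_map_pairedI[OF f1(1,2)] S'(2)]
      continuous_map_compose[OF continuous_map_pairedI[OF f1(3,4)] T'(2)]
    by (auto simp: continuous_map_paired o_def)
  then have add: "continuous_map (prod_topology ?P ?P) ?P (\<lambda>(x, y). x + y)"
    by (simp add: case_prod_unfold plus_prod_def)
  have "continuous_map (prod_topology euclideanreal ?P) ?P (\<lambda>p. (fst p *\<^sub>R fst (snd p), fst p *\<^sub>R snd (snd p)))"
    using continuous_map_compose[OF continuous_map_pairedI[OF f2(1,2)] S'(3)]
      continuous_map_compose[OF continuous_map_pairedI[OF f2(1,3)] T'(3)]
    by (auto simp: continuous_map_paired o_def)
  then have scale: "continuous_map (prod_topology euclideanreal ?P) ?P (\<lambda>(c, x). c *\<^sub>R x)"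
    by (simp add: case_prod_unfold scaleR_prod_def)
  have conv: "\<exists>U. zero_nhd ?P U \<and> convex U \<and> U \<subseteq> W" if W: "zero_nhd ?P W" for W
  proof -
    obtain O' where "openin ?P O'" "0 \<in> O'" "O' \<subseteq> W" using W by (auto simp: zero_nhd_def)
    then obtain A B where AB: "openin S A" "openin T B" "0 \<in> A" "0 \<in> B" "A \<times> B \<subseteq> W"
      unfolding openin_prod_topology_alt zero_prod_def by (meson subset_trans)
    then have "zero_nhd S A" "zero_nhd T B" by (auto simp: zero_nhd_def openin_subset)
    then obtain U V where U: "zero_nhd S U" "convex U" "U \<subseteq> A" and V: "zero_nhd T V" "convex V" "V \<subseteq> B"
      using S'(5) T'(5) by meson
    obtain U' V' where U': "openin S U'" "0 \<in> U'" "U' \<subseteq> U" and V': "openin T V'" "0 \<in> V'" "V' \<subseteq> V"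
      using U V by (auto simp: zero_nhd_def)
    have "zero_nhd ?P (U \<times> V)"
      unfolding zero_nhd_def
    proof (intro conjI exI)
      show "U \<times> V \<subseteq> topspace ?P" using U(1) V(1) by (auto simp: zero_nhd_def)
      show "openin ?P (U' \<times> V')" using U' V' by (simp add: openin_prod_Times_iff)
      show "0 \<in> U' \<times> V'" "U' \<times> V' \<subseteq> U \<times> V" using U' V' by (auto simp: zero_prod_def)
    qed
    moreover have "convex (U \<times> V)" using U V by (simp add: convex_Times)
    ultimately show ?thesis using U V AB by (intro exI[of _ "U \<times> V"]) auto
  qed
  have "subspace (topspace ?P)" using subspace_Times[OF S'(1) T'(1)] by simp
  then show ?thesis
    unfolding locally_convex_space_def
    using add scale conv S'(4) T'(4) by (simp add: Hausdorff_space_prod_topology)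
qed

subsection \<open>The spaces of functions on the interval\<close>

lemma ideriv_0 [simp]: "ideriv 0 f = f"
  by (simp add: ideriv_def)

lemma ideriv_Suc: "ideriv (Suc k) f s = vector_derivative (ideriv k f) (at s within {0..1})"
  by (simp add: ideriv_def)

lemma vector_derivative_unit_interval:
  assumes "(f has_real_derivative d) (at s within {0..1})" "s \<in> {0..1}"
  shows "vector_derivative f (at s within {0..1}) = d"
  using vector_derivative_within_cbox[of 0 1 s f d] assms
  by (simp add: has_real_derivative_iff_has_vector_derivative)

lemma DERIV_transform_on:
  assumes "(f has_real_derivative d) (at s within S)" "s \<in> S" "\<And>x. x \<in> S \<Longrightarrow> g x = f x"
  shows "(g has_real_derivative d) (at s within S)"
  using assms by (intro has_field_derivative_transform_within[of f d s S 1 g]) auto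

text \<open>\<open>ideriv\<close> rests on \<open>vector_derivative\<close> and hence on a choice
  operator. A chain of genuine derivatives within the interval, one-sided at its ends, determines
  the values order by order.\<close>

lemma ideriv_unique:
  assumes "\<And>s. s \<in> {0..1} \<Longrightarrow> d 0 s = f s"
    and "\<And>j s. j < k \<Longrightarrow> s \<in> {0..1} \<Longrightarrow> (d j has_real_derivative d (Suc j) s) (at s within {0..1})"
    and "s \<in> {0..1}"
  shows "ideriv k f s = d k s"
  using assms(2,3)
proof (induction k arbitrary: s)
  case 0
  then show ?case using assms(1) by simp
next
  case (Suc k)
  have "(ideriv k f has_real_derivative d (Suc k) s) (at s within {0..1})"
    using Suc.IH Suc.prems by (intro DERIV_transform_on[OF Suc.prems(1)[OF lessI]]) simp_all
  then show ?case
    using vector_derivative_unit_interval Suc.prems by (simp add: ideriv_Suc)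
qed

text \<open>The certificate for membership used throughout: the chain \<open>d\<close> has to agree
  with \<open>f\<close> only on the interval, so the extension by zero is never differentiated, and
  the values of \<open>ideriv\<close> come along with the membership.\<close>

lemma CI_memI:
  assumes "\<And>s. s \<notin> {0..1} \<Longrightarrow> f s = 0"
    and "\<And>s. s \<in> {0..1} \<Longrightarrow> d 0 s = f s"
    and deriv: "\<And>k s. enat k < i \<Longrightarrow> s \<in> {0..1} \<Longrightarrow> (d k has_real_derivative d (Suc k) s) (at s within {0..1})"
    and cont: "\<And>k. enat k \<le> i \<Longrightarrow> continuous_on {0..1} (d k)"
  shows "f \<in> CI i" and "\<And>k s. enat k \<le> i \<Longrightarrow> s \<in> {0..1} \<Longrightarrow> ideriv k f s = d k s"
proof -
  show *: "ideriv k f s = d k s" if "enat k \<le> i" "s \<in> {0..1}" for k s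
  proof (rule ideriv_unique)
    show "(d j has_real_derivative d (Suc j) s) (at s within {0..1})" if "j < k" "s \<in> {0..1}" for j s
      using \<open>enat k \<le> i\<close> that by (intro deriv) (auto intro: less_le_trans[of _ "enat k"])
  qed (use assms that in auto)
  have "ideriv k f differentiable (at s within {0..1})" if "enat k < i" "s \<in> {0..1}" for k s
  proof -
    have "(ideriv k f has_real_derivative d (Suc k) s) (at s within {0..1})"
      using that * by (intro DERIV_transform_on[OF deriv[OF that]]) auto
    then show ?thesis by (auto simp: real_differentiable_def)
  qed
  moreover have "continuous_on {0..1} (ideriv k f)" if "enat k \<le> i" for k
    using continuous_on_eq[OF cont[OF that]] * that by metis
  ultimately show "f \<in> CI i" using assms(1) by (auto simp: CI_def)
qed

lemma CI_deriv:
  assumes "f \<in> CI i" "enat k < i" "s \<in> {0..1}"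
  shows "(ideriv k f has_real_derivative ideriv (Suc k) f s) (at s within {0..1})"
  using assms vector_derivative_works[of "ideriv k f" "at s within {0..1}"]
  by (auto simp: CI_def ideriv_Suc has_real_derivative_iff_has_vector_derivative)

lemma CI_continuous: "f \<in> CI i \<Longrightarrow> enat k \<le> i \<Longrightarrow> continuous_on {0..1} (ideriv k f)"
  by (simp add: CI_def)

lemma CI_outside: "f \<in> CI i \<Longrightarrow> s \<notin> {0..1} \<Longrightarrow> f s = 0"
  by (simp add: CI_def)

lemma CI_linear_combination:
  assumes "f \<in> CI i" "g \<in> CI i"
  shows "c *\<^sub>R f + g \<in> CI i"
    and "\<And>k s. enat k \<le> i \<Longrightarrow> s \<in> {0..1} \<Longrightarrow> ideriv k (c *\<^sub>R f + g) s = c * ideriv k f s + ideriv k g s"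
proof -
  let ?d = "\<lambda>k s. c * ideriv k f s + ideriv k g s"
  have 1: "(c *\<^sub>R f + g) s = 0" if "s \<notin> {0..1}" for s
    using CI_outside[OF assms(1) that] CI_outside[OF assms(2) that] by simp
  have 2: "?d 0 s = (c *\<^sub>R f + g) s" for s by simp
  have 3: "(?d k has_real_derivative ?d (Suc k) s) (at s within {0..1})" if "enat k < i" "s \<in> {0..1}" for k s
    using CI_deriv[OF assms(1) that] CI_deriv[OF assms(2) that] by (auto intro!: derivative_eq_intros)
  have 4: "continuous_on {0..1} (?d k)" if "enat k \<le> i" for k
    using CI_continuous[OF assms(1) that] CI_continuous[OF assms(2) that] by (intro continuous_intros)
  show "c *\<^sub>R f + g \<in> CI i" by (rule CI_memI(1)[of _ ?d, OF 1 2 3 4])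
  show "ideriv k (c *\<^sub>R f + g) s = ?d k s" if "enat k \<le> i" "s \<in> {0..1}" for k s
    by (rule CI_memI(2)[of _ ?d, OF 1 2 3 4 that])
qed

lemma zero_in_CI: "0 \<in> CI i"
  by (rule CI_memI(1)[of _ "\<lambda>_ _. 0"]) auto

lemma ideriv_zero: "s \<in> {0..1} \<Longrightarrow> ideriv k 0 s = 0"
  by (rule ideriv_unique[of "\<lambda>_ _. 0"]) auto

lemma subspace_CI: "subspace (CI i)"
proof (rule subspaceI)
  show "x + y \<in> CI i" if "x \<in> CI i" "y \<in> CI i" for x y
    using CI_linear_combination(1)[OF that, of 1] by simp
  show "c *\<^sub>R x \<in> CI i" if "x \<in> CI i" for c x
    using CI_linear_combination(1)[OF that zero_in_CI, of c] by simp
qed (rule zero_in_CI)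

lemma enat_less_add_one_iff: "enat k < i + 1 \<longleftrightarrow> enat k \<le> i"
  by (cases i) (auto simp: one_enat_def)

lemma bounded_on_compact:
  fixes f :: "'a::topological_space \<Rightarrow> real"
  assumes "continuous_on K f" "compact K"
  shows "\<exists>C. \<forall>z\<in>K. \<bar>f z\<bar> \<le> C"
  using compact_imp_bounded[OF compact_continuous_image[OF assms]] by (auto simp: bounded_iff)

lemma locally_convex_CI: "locally_convex_space (CI_topology i)"
  unfolding CI_topology_def
proof (rule locally_convex_uniform_topology[OF subspace_CI])
  let ?P = "{(ideriv k, {0..1::real}) |k. enat k < i + 1}"
  show "\<forall>(D, K)\<in>?P. \<forall>f\<in>CI i. \<forall>g\<in>CI i. \<forall>z\<in>K. \<forall>c.
      D (c *\<^sub>R f + g) z = c * D f z + D g z"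
    using CI_linear_combination(2)[of _ i] by (auto simp: enat_less_add_one_iff)
  show "\<forall>(D, K)\<in>?P. \<forall>f\<in>CI i. \<exists>C. \<forall>z\<in>K. \<bar>D f z\<bar> \<le> C"
    using bounded_on_compact[OF CI_continuous compact_Icc] by (auto simp: enat_less_add_one_iff)
  fix f g assume fg: "f \<in> CI i" "g \<in> CI i" "f \<noteq> g"
  obtain s where s: "f s \<noteq> g s" using fg(3) by (auto simp: fun_eq_iff)
  then have "s \<in> {0..1}"
    using CI_outside[OF fg(1), of s] CI_outside[OF fg(2), of s] by (cases "s \<in> {0..1}") simp_all
  with s show "\<exists>(D, K)\<in>?P. \<exists>z\<in>K. D f z \<noteq> D g z"
    by (intro bexI[of _ "(ideriv 0, {0..1})"]) (auto simp: enat_less_add_one_iff zero_enat_def[symmetric])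
qed

subsection \<open>Smooth functions on a relatively open set\<close>

text \<open>Every index \<open>n \<ge> 2\<close> denotes the third basis vector, so every list of indices is admissible.\<close>

definition dirvec :: "nat \<Rightarrow> real3" where
  "dirvec n = (if n = 0 then (1, 0, 0) else if n = 1 then (0, 1, 0) else (0, 0, 1))"

lemma Basis_real3: "(Basis :: real3 set) = {(1, 0, 0), (0, 1, 0), (0, 0, 1)}"
  by (auto simp: Basis_prod_def zero_prod_def)

lemma dirvec_Basis [simp]: "dirvec n \<in> Basis" "dirvec n \<noteq> 0"
  by (auto simp: dirvec_def Basis_real3 zero_prod_def)

lemma map_dirvec_lists [simp]: "map dirvec ns \<in> lists Basis"
  by auto

lemma partial_derivs_snoc: "partial_derivs (bs @ [b]) \<phi> = partial_deriv b (partial_derivs bs \<phi>)"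
  by (simp add: partial_derivs_def)

lemma partial_derivs_Nil [simp]: "partial_derivs [] \<phi> = \<phi>"
  by (simp add: partial_derivs_def)

lemma smooth_on_has_deriv:
  assumes "smooth_on U \<phi>" "bs \<in> lists Basis" "b \<in> Basis" "z \<in> U"
  shows "((\<lambda>t. partial_derivs bs \<phi> (z + t *\<^sub>R b)) has_real_derivative partial_derivs (bs @ [b]) \<phi> z) (at 0)"
proof -
  have "(\<lambda>t. partial_derivs bs \<phi> (z + t *\<^sub>R b)) differentiable at 0"
    using assms unfolding smooth_on_def by blast
  then show ?thesis
    using vector_derivative_works[of "\<lambda>t. partial_derivs bs \<phi> (z + t *\<^sub>R b)" "at 0"]
    by (simp only: partial_derivs_snoc partial_deriv_def has_real_derivative_iff_has_vector_derivative)
qed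

lemma eventually_line_in_open:
  fixes z b :: "'a::real_normed_vector"
  assumes "open U" "z \<in> U"
  shows "\<forall>\<^sub>F t in nhds 0. z + t *\<^sub>R b \<in> U"
proof -
  have "((\<lambda>t. z + t *\<^sub>R b) \<longlongrightarrow> z + 0 *\<^sub>R b) (nhds 0)"
    by (intro tendsto_add tendsto_const tendsto_scaleR filterlim_ident)
  then show ?thesis using assms by (simp add: topological_tendstoD)
qed

text \<open>\<open>partial_deriv\<close> sees only the values on a short line through
  \<open>z\<close>, which stays in the open set \<open>U\<close>; hence the induction hypothesis can
  be used under the next derivative.\<close>

lemma partial_derivs_linear_combination:
  assumes U: "open U" and \<phi>: "smooth_on U \<phi>" and \<psi>: "smooth_on U \<psi>" and bs: "bs \<in> lists Basis" and z: "z \<in> U"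
  shows "partial_derivs bs (c *\<^sub>R \<phi> + \<psi>) z = c * partial_derivs bs \<phi> z + partial_derivs bs \<psi> z"
  using bs z
proof (induction bs arbitrary: z rule: rev_induct)
  case Nil
  then show ?case by simp
next
  case (snoc b bs)
  have bs: "bs \<in> lists Basis" "b \<in> Basis" using snoc by auto
  have D: "((\<lambda>t. c * partial_derivs bs \<phi> (z + t *\<^sub>R b) + partial_derivs bs \<psi> (z + t *\<^sub>R b)) has_real_derivative
      c * partial_derivs (bs @ [b]) \<phi> z + partial_derivs (bs @ [b]) \<psi> z) (at 0)"
    using smooth_on_has_deriv[OF \<phi> bs snoc.prems(2)] smooth_on_has_deriv[OF \<psi> bs snoc.prems(2)]
    by (auto intro!: derivative_eq_intros)
  have ev: "\<forall>\<^sub>F t in nhds 0. partial_derivs bs (c *\<^sub>R \<phi> + \<psi>) (z + t *\<^sub>R b) =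
      c * partial_derivs bs \<phi> (z + t *\<^sub>R b) + partial_derivs bs \<psi> (z + t *\<^sub>R b)"
    using eventually_line_in_open[OF U snoc.prems(2)] by (rule eventually_mono) (rule snoc.IH[OF bs(1)])
  have "((\<lambda>t. partial_derivs bs (c *\<^sub>R \<phi> + \<psi>) (z + t *\<^sub>R b)) has_real_derivative
      c * partial_derivs (bs @ [b]) \<phi> z + partial_derivs (bs @ [b]) \<psi> z) (at 0)"
    by (rule iffD2[OF DERIV_cong_ev[OF refl ev refl] D])
  then show ?case
    unfolding partial_derivs_snoc[of bs b "c *\<^sub>R \<phi> + \<psi>"] partial_deriv_def
    by (simp add: vector_derivative_at has_real_derivative_iff_has_vector_derivative)
qed

lemma smooth_on_linear_combination:
  assumes U: "open U" and \<phi>: "smooth_on U \<phi>" and \<psi>: "smooth_on U \<psi>"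
  shows "smooth_on U (c *\<^sub>R \<phi> + \<psi>)"
  unfolding smooth_on_def
proof (intro ballI conjI)
  fix bs :: "real3 list" assume bs: "bs \<in> lists Basis"
  note eq = partial_derivs_linear_combination[OF U \<phi> \<psi> bs]
  have "continuous_on U (\<lambda>z. c * partial_derivs bs \<phi> z + partial_derivs bs \<psi> z)"
    using \<phi> \<psi> bs by (intro continuous_intros) (auto simp: smooth_on_def)
  then show "continuous_on U (partial_derivs bs (c *\<^sub>R \<phi> + \<psi>))"
    by (rule continuous_on_eq) (simp add: eq)
  fix b z :: real3 assume b: "b \<in> Basis" and z: "z \<in> U"
  have D: "((\<lambda>t. c * partial_derivs bs \<phi> (z + t *\<^sub>R b) + partial_derivs bs \<psi> (z + t *\<^sub>R b)) has_real_derivative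
      c * partial_derivs (bs @ [b]) \<phi> z + partial_derivs (bs @ [b]) \<psi> z) (at 0)"
    using smooth_on_has_deriv[OF \<phi> bs b z] smooth_on_has_deriv[OF \<psi> bs b z]
    by (auto intro!: derivative_eq_intros)
  have ev: "\<forall>\<^sub>F t in nhds 0. partial_derivs bs (c *\<^sub>R \<phi> + \<psi>) (z + t *\<^sub>R b) =
      c * partial_derivs bs \<phi> (z + t *\<^sub>R b) + partial_derivs bs \<psi> (z + t *\<^sub>R b)"
    using eventually_line_in_open[OF U z] by (rule eventually_mono) (rule eq)
  have "((\<lambda>t. partial_derivs bs (c *\<^sub>R \<phi> + \<psi>) (z + t *\<^sub>R b)) has_real_derivative
      c * partial_derivs (bs @ [b]) \<phi> z + partial_derivs (bs @ [b]) \<psi> z) (at 0)"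
    by (rule iffD2[OF DERIV_cong_ev[OF refl ev refl] D])
  then show "(\<lambda>t. partial_derivs bs (c *\<^sub>R \<phi> + \<psi>) (z + t *\<^sub>R b)) differentiable at 0"
    by (auto simp: real_differentiable_def)
qed

section \<open>Density of the interior of \<Omega> and the continuous extensions of partial
  derivatives\<close>

locale rel_open =
  fixes \<Omega> :: "real3 set"
  assumes rel_open: "openin (top_of_set ({0..1} \<times> UNIV \<times> UNIV)) \<Omega>"
begin

lemma box_in_Omega:
  assumes "(s, a, b) \<in> \<Omega>"
  obtains d where "0 < d"
    "\<And>s' a' b'. s' \<in> {0..1} \<Longrightarrow> \<bar>s' - s\<bar> < d \<Longrightarrow> \<bar>a' - a\<bar> < d \<Longrightarrow> \<bar>b' - b\<bar> < d \<Longrightarrow> (s', a', b') \<in> \<Omega>"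
proof -
  obtain T where T: "open T" "\<Omega> = ({0..1} \<times> UNIV \<times> UNIV) \<inter> T" using rel_open by (auto simp: openin_open)
  then obtain e where e: "0 < e" "ball (s, a, b) e \<subseteq> T" using assms open_contains_ball by blast
  have "(s', a', b') \<in> \<Omega>"
    if "s' \<in> {0..1}" "\<bar>s' - s\<bar> < e/3" "\<bar>a' - a\<bar> < e/3" "\<bar>b' - b\<bar> < e/3" for s' a' b'
  proof -
    have "dist (s, a, b) (s', a', b') \<le> \<bar>s - s'\<bar> + (\<bar>a - a'\<bar> + \<bar>b - b'\<bar>)"
      unfolding dist_prod_def fst_conv snd_conv
      by (intro order.trans[OF sqrt_sum_squares_le_sum] add_mono order.trans[OF sqrt_sum_squares_le_sum])
        (auto simp: dist_real_def)
    also have "\<dots> < e" using that by linarith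
    finally show ?thesis using that e T by auto
  qed
  then show ?thesis using that[of "e/3"] e by auto
qed

lemma Omega_unit: "(s, a, b) \<in> \<Omega> \<Longrightarrow> s \<in> {0..1}"
  using rel_open by (auto simp: openin_open)

lemma interior_Omega: "(s, a, b) \<in> interior \<Omega> \<longleftrightarrow> (s, a, b) \<in> \<Omega> \<and> 0 < s \<and> s < 1"
proof -
  obtain T where T: "open T" "\<Omega> = ({0..1} \<times> UNIV \<times> UNIV) \<inter> T" using rel_open by (auto simp: openin_open)
  have "interior \<Omega> = interior ({0..1} \<times> UNIV \<times> UNIV) \<inter> T"
    using T by (simp add: interior_open)
  then show ?thesis using T by (auto simp: interior_Times)
qed

text \<open>Only the coordinate \<open>s\<close> can keep a point of \<Omega> out of the interior,
  so a small shift of \<open>s\<close> suffices. This makes continuous extensions from the interior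
  unique and the limit in \<open>ext_partial\<close> nontrivial.\<close>

lemma islimpt_interior:
  assumes "z \<in> \<Omega>" shows "z islimpt interior \<Omega>"
proof -
  obtain s a b where z: "z = (s, a, b)" by (cases z) auto
  obtain d where d: "0 < d"
    "\<And>s' a' b'. s' \<in> {0..1} \<Longrightarrow> \<bar>s' - s\<bar> < d \<Longrightarrow> \<bar>a' - a\<bar> < d \<Longrightarrow> \<bar>b' - b\<bar> < d \<Longrightarrow> (s', a', b') \<in> \<Omega>"
    using box_in_Omega assms z by metis
  have s: "s \<in> {0..1}" using assms z Omega_unit by auto
  show ?thesis
    unfolding islimpt_approachable
  proof (intro allI impI)
    fix e :: real assume e: "0 < e"
    define m where "m = min (1/4) (min d e / 2)"
    have m: "0 < m" "m < d" "m < e" "m \<le> 1/4" using d e unfolding m_def by linarith+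
    \<comment> \<open>The shift goes away from the nearer face and has size at most 1/4, so it does
      not reach the opposite one.\<close>
    define s' where "s' = (if s \<le> 1/2 then s + m else s - m)"
    have s': "0 < s'" "s' < 1" "\<bar>s' - s\<bar> = m" using s m by (auto simp: s'_def)
    have "(s', a, b) \<in> interior \<Omega>" using d s' m by (auto simp: interior_Omega)
    moreover have "(s', a, b) \<noteq> z" "dist (s', a, b) z < e"
      using s' m z by (auto simp: dist_prod_def dist_real_def)
    ultimately show "\<exists>x'\<in>interior \<Omega>. x' \<noteq> z \<and> dist x' z < e" by blast
  qed
qed

lemma continuous_on_Omega_unique:
  fixes f g :: "real3 \<Rightarrow> real"
  assumes "continuous_on \<Omega> f" "continuous_on \<Omega> g" "\<And>z. z \<in> interior \<Omega> \<Longrightarrow> f z = g z" "z \<in> \<Omega>"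
  shows "f z = g z"
proof -
  have F: "(f \<longlongrightarrow> f z) (at z within interior \<Omega>)" "(g \<longlongrightarrow> g z) (at z within interior \<Omega>)"
    using assms interior_subset tendsto_within_subset unfolding continuous_on by blast+
  have "(f \<longlongrightarrow> g z) (at z within interior \<Omega>)"
    using F(2) by (rule Lim_transform_eventually) (simp add: eventually_at_filter assms(3))
  moreover have "at z within interior \<Omega> \<noteq> bot"
    using islimpt_interior[OF assms(4)] by (simp add: trivial_limit_within)
  ultimately show ?thesis using F(1) tendsto_unique by metis
qed

lemma CO_outside: "\<phi> \<in> CO \<Omega> \<Longrightarrow> z \<notin> \<Omega> \<Longrightarrow> \<phi> z = 0"
  unfolding CO_def by blast

lemma CO_smooth: "\<phi> \<in> CO \<Omega> \<Longrightarrow> smooth_on (interior \<Omega>) \<phi>"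
  by (simp add: CO_def)

text \<open>\<open>CO\<close> only provides some continuous extension. As the interior accumulates
  at every point of \<Omega>, the limit that defines \<open>ext_partial\<close> exists and equals
  that extension.\<close>

lemma ext_partial:
  assumes "\<phi> \<in> CO \<Omega>" "bs \<in> lists Basis"
  shows "continuous_on \<Omega> (ext_partial \<Omega> bs \<phi>)"
    and "z \<in> interior \<Omega> \<Longrightarrow> ext_partial \<Omega> bs \<phi> z = partial_derivs bs \<phi> z"
proof -
  obtain \<psi> where \<psi>: "continuous_on \<Omega> \<psi>" "\<And>z. z \<in> interior \<Omega> \<Longrightarrow> \<psi> z = partial_derivs bs \<phi> z"
    using assms unfolding CO_def by blast
  have eq: "ext_partial \<Omega> bs \<phi> z = \<psi> z" if z: "z \<in> \<Omega>" for z
  proof -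
    have "(\<psi> \<longlongrightarrow> \<psi> z) (at z within interior \<Omega>)"
      using \<psi> z interior_subset tendsto_within_subset unfolding continuous_on by blast
    then have "(partial_derivs bs \<phi> \<longlongrightarrow> \<psi> z) (at z within interior \<Omega>)"
      by (rule Lim_transform_eventually) (simp add: eventually_at_filter \<psi>(2))
    then show ?thesis
      unfolding ext_partial_def using islimpt_interior[OF z] by (intro tendsto_Lim) (auto simp: trivial_limit_within)
  qed
  show "continuous_on \<Omega> (ext_partial \<Omega> bs \<phi>)"
    using \<psi>(1) by (rule continuous_on_eq) (simp add: eq)
  show "ext_partial \<Omega> bs \<phi> z = partial_derivs bs \<phi> z" if "z \<in> interior \<Omega>"
    using that eq[of z] \<psi>(2)[of z] interior_subset[of \<Omega>] by (simp add: subsetD)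
qed

lemma ext_partial_eqI:
  assumes "\<phi> \<in> CO \<Omega>" "bs \<in> lists Basis" "continuous_on \<Omega> \<psi>"
    "\<And>z. z \<in> interior \<Omega> \<Longrightarrow> \<psi> z = partial_derivs bs \<phi> z" "z \<in> \<Omega>"
  shows "ext_partial \<Omega> bs \<phi> z = \<psi> z"
  by (rule continuous_on_Omega_unique[of "ext_partial \<Omega> bs \<phi>" \<psi>])
    (simp_all add: ext_partial[OF assms(1,2)] assms)

lemma ext_partial_Nil: "\<phi> \<in> CO \<Omega> \<Longrightarrow> z \<in> \<Omega> \<Longrightarrow> ext_partial \<Omega> [] \<phi> z = \<phi> z"
  by (rule ext_partial_eqI[of _ _ \<phi>]) (simp_all add: CO_def)

lemma CO_linear_combination:
  assumes "\<phi> \<in> CO \<Omega>" "\<psi> \<in> CO \<Omega>"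
  shows "c *\<^sub>R \<phi> + \<psi> \<in> CO \<Omega>"
    and "\<And>bs z. bs \<in> lists Basis \<Longrightarrow> z \<in> \<Omega> \<Longrightarrow>
      ext_partial \<Omega> bs (c *\<^sub>R \<phi> + \<psi>) z = c * ext_partial \<Omega> bs \<phi> z + ext_partial \<Omega> bs \<psi> z"
proof -
  have c: "continuous_on \<Omega> (\<lambda>z. c * ext_partial \<Omega> bs \<phi> z + ext_partial \<Omega> bs \<psi> z)" if "bs \<in> lists Basis" for bs
    by (intro continuous_on_add continuous_on_mult continuous_on_const
        ext_partial(1)[OF assms(1) that] ext_partial(1)[OF assms(2) that])
  have eq: "c * ext_partial \<Omega> bs \<phi> z + ext_partial \<Omega> bs \<psi> z = partial_derivs bs (c *\<^sub>R \<phi> + \<psi>) z"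
    if "bs \<in> lists Basis" "z \<in> interior \<Omega>" for bs z
    using partial_derivs_linear_combination[OF open_interior CO_smooth CO_smooth] assms that
    by (simp add: ext_partial(2))
  have "continuous_on \<Omega> (\<lambda>z. c * \<phi> z + \<psi> z)"
    using assms by (intro continuous_intros) (auto simp: CO_def)
  then show 1: "c *\<^sub>R \<phi> + \<psi> \<in> CO \<Omega>"
    unfolding CO_def
  proof (intro CollectI conjI allI impI ballI)
    show "(c *\<^sub>R \<phi> + \<psi>) z = 0" if "z \<notin> \<Omega>" for z
      using CO_outside[OF assms(1) that] CO_outside[OF assms(2) that] by simp
    show "smooth_on (interior \<Omega>) (c *\<^sub>R \<phi> + \<psi>)"
      using smooth_on_linear_combination[OF open_interior CO_smooth CO_smooth] assms by blast
    show "\<exists>\<psi>'. continuous_on \<Omega> \<psi>' \<and>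
        (\<forall>z\<in>interior \<Omega>. \<psi>' z = partial_derivs bs (c *\<^sub>R \<phi> + \<psi>) z)" if "bs \<in> lists Basis" for bs
      using c[OF that] eq[OF that] by blast
  qed (simp add: plus_fun_def)
  show "ext_partial \<Omega> bs (c *\<^sub>R \<phi> + \<psi>) z = c * ext_partial \<Omega> bs \<phi> z + ext_partial \<Omega> bs \<psi> z"
    if "bs \<in> lists Basis" "z \<in> \<Omega>" for bs z
    using ext_partial_eqI[OF 1 that(1) c[OF that(1)] _ that(2)] eq that by blast
qed

lemma partial_derivs_zero: "partial_derivs bs (\<lambda>_. 0) = (\<lambda>_. 0)"
proof (induction bs rule: rev_induct)
  case (snoc b bs)
  then show ?case by (simp add: partial_derivs_snoc partial_deriv_def[abs_def])
qed simp

lemma zero_in_CO: "0 \<in> CO \<Omega>"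
proof -
  have [simp]: "partial_derivs bs 0 = (\<lambda>_. 0)" for bs
    using partial_derivs_zero[of bs] by (simp only: zero_fun_def)
  show ?thesis
    unfolding CO_def smooth_on_def by (auto simp: zero_fun_apply intro: exI[of _ "\<lambda>_. 0"])
qed

lemma subspace_CO: "subspace (CO \<Omega>)"
proof (rule subspaceI)
  show "x + y \<in> CO \<Omega>" if "x \<in> CO \<Omega>" "y \<in> CO \<Omega>" for x y
    using CO_linear_combination(1)[OF that, of 1] by simp
  show "c *\<^sub>R x \<in> CO \<Omega>" if "x \<in> CO \<Omega>" for c x
    using CO_linear_combination(1)[OF that zero_in_CO, of c] by simp
qed (rule zero_in_CO)

lemma locally_convex_CO: "locally_convex_space (CO_topology \<Omega>)"
  unfolding CO_topology_def
proof (rule locally_convex_uniform_topology[OF subspace_CO])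
  let ?P = "{(ext_partial \<Omega> bs, K) |bs K. bs \<in> lists Basis \<and> compact K \<and> K \<subseteq> \<Omega>}"
  show "\<forall>(D, K)\<in>?P. \<forall>f\<in>CO \<Omega>. \<forall>g\<in>CO \<Omega>. \<forall>z\<in>K. \<forall>c.
      D (c *\<^sub>R f + g) z = c * D f z + D g z"
    using CO_linear_combination(2) by blast
  show "\<forall>(D, K)\<in>?P. \<forall>f\<in>CO \<Omega>. \<exists>C. \<forall>z\<in>K. \<bar>D f z\<bar> \<le> C"
    using bounded_on_compact[OF continuous_on_subset[OF ext_partial(1)]] by blast
  fix f g assume fg: "f \<in> CO \<Omega>" "g \<in> CO \<Omega>" "f \<noteq> g"
  obtain z where z: "f z \<noteq> g z" using fg(3) by (auto simp: fun_eq_iff)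
  then have "z \<in> \<Omega>"
    using CO_outside[OF fg(1), of z] CO_outside[OF fg(2), of z] by (cases "z \<in> \<Omega>") simp_all
  with z show "\<exists>(D, K)\<in>?P. \<exists>z\<in>K. D f z \<noteq> D g z"
    using fg by (intro bexI[of _ "(ext_partial \<Omega> [], {z})"]) (auto simp: ext_partial_Nil)
qed

lemma locally_convex_data: "locally_convex_space (data_topology \<Omega>)"
  unfolding data_topology_def
  by (intro locally_convex_prod_topology locally_convex_euclideanreal locally_convex_CO)

end

section \<open>Differentiability of the extended partial derivatives up to the faces\<close>

lemma real_increment_bound:
  fixes g :: "real \<Rightarrow> real"
  assumes "convex S" "x \<in> S" "y \<in> S"
    and "\<And>t. t \<in> S \<Longrightarrow> (g has_real_derivative g' t) (at t)"
    and "\<And>t. t \<in> S \<Longrightarrow> \<bar>g' t - c\<bar> \<le> \<epsilon>"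
  shows "\<bar>g y - g x - c * (y - x)\<bar> \<le> \<epsilon> * \<bar>y - x\<bar>"
proof -
  have "norm ((\<lambda>t. g t - c * t) y - (\<lambda>t. g t - c * t) x) \<le> \<epsilon> * norm (y - x)"
  proof (rule field_differentiable_bound[OF assms(1) _ _ assms(3,2)])
    show "((\<lambda>t. g t - c * t) has_real_derivative g' t - c) (at t within S)" if "t \<in> S" for t
      using assms(4)[OF that] by (auto intro!: derivative_eq_intros dest: has_field_derivative_at_within)
  qed (use assms(5) in auto)
  then show ?thesis by (simp add: algebra_simps)
qed

context rel_open
begin

definition pd :: "nat list \<Rightarrow> (real3 \<Rightarrow> real) \<Rightarrow> real3 \<Rightarrow> real" where
  "pd ns = ext_partial \<Omega> (map dirvec ns)"

lemma pd_continuous: "\<phi> \<in> CO \<Omega> \<Longrightarrow> continuous_on \<Omega> (pd ns \<phi>)"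
  by (simp add: pd_def ext_partial(1))

lemma pd_Nil: "\<phi> \<in> CO \<Omega> \<Longrightarrow> z \<in> \<Omega> \<Longrightarrow> pd [] \<phi> z = \<phi> z"
  by (simp add: pd_def ext_partial_Nil)

lemma pd_linear:
  assumes "\<phi> \<in> CO \<Omega>" "\<psi> \<in> CO \<Omega>" "z \<in> \<Omega>"
  shows "pd ns (c *\<^sub>R \<phi> + \<psi>) z = c * pd ns \<phi> z + pd ns \<psi> z"
  unfolding pd_def by (rule CO_linear_combination(2)[OF assms(1,2) map_dirvec_lists assms(3)])

lemma pd_add: "\<phi> \<in> CO \<Omega> \<Longrightarrow> \<psi> \<in> CO \<Omega> \<Longrightarrow> z \<in> \<Omega> \<Longrightarrow> pd ns (\<phi> + \<psi>) z = pd ns \<phi> z + pd ns \<psi> z"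
  using pd_linear[of \<phi> \<psi> z ns 1] by simp

lemma pd_zero: "z \<in> \<Omega> \<Longrightarrow> pd ns 0 z = 0"
  using pd_linear[OF zero_in_CO zero_in_CO, of z ns 1] by simp

lemma pd_scaleR: "\<phi> \<in> CO \<Omega> \<Longrightarrow> z \<in> \<Omega> \<Longrightarrow> pd ns (c *\<^sub>R \<phi>) z = c * pd ns \<phi> z"
  using pd_linear[OF _ zero_in_CO, of \<phi> z ns c] pd_zero by simp

lemma pd_diff: "\<phi> \<in> CO \<Omega> \<Longrightarrow> \<psi> \<in> CO \<Omega> \<Longrightarrow> z \<in> \<Omega> \<Longrightarrow> pd ns (\<phi> - \<psi>) z = pd ns \<phi> z - pd ns \<psi> z"
  using pd_linear[of \<psi> \<phi> z ns "-1"] by (simp add: algebra_simps)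

lemma pd_interior_deriv:
  assumes \<phi>: "\<phi> \<in> CO \<Omega>" and z: "z \<in> interior \<Omega>"
  shows "((\<lambda>t. pd ns \<phi> (z + t *\<^sub>R dirvec n)) has_real_derivative pd (ns @ [n]) \<phi> z) (at 0)"
proof -
  have D: "((\<lambda>t. partial_derivs (map dirvec ns) \<phi> (z + t *\<^sub>R dirvec n)) has_real_derivative
      partial_derivs (map dirvec ns @ [dirvec n]) \<phi> z) (at 0)"
    by (rule smooth_on_has_deriv[OF CO_smooth[OF \<phi>] map_dirvec_lists dirvec_Basis(1) z])
  have ev: "\<forall>\<^sub>F t in nhds 0. pd ns \<phi> (z + t *\<^sub>R dirvec n) = partial_derivs (map dirvec ns) \<phi> (z + t *\<^sub>R dirvec n)"
    using eventually_line_in_open[OF open_interior z, of "dirvec n"]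
    by (rule eventually_mono) (simp add: pd_def ext_partial(2)[OF \<phi> map_dirvec_lists])
  have "pd (ns @ [n]) \<phi> z = partial_derivs (map dirvec ns @ [dirvec n]) \<phi> z"
    using ext_partial(2)[OF \<phi> map_dirvec_lists z, of "ns @ [n]"] by (simp add: pd_def)
  then show ?thesis using iffD2[OF DERIV_cong_ev[OF refl ev refl] D] by simp
qed

lemma pd_interior_coords:
  assumes \<phi>: "\<phi> \<in> CO \<Omega>" and z: "(s, a, b) \<in> interior \<Omega>"
  shows "((\<lambda>t. pd ns \<phi> (t, a, b)) has_real_derivative pd (ns @ [0]) \<phi> (s, a, b)) (at s)"
    and "((\<lambda>t. pd ns \<phi> (s, t, b)) has_real_derivative pd (ns @ [1]) \<phi> (s, a, b)) (at a)"
    and "((\<lambda>t. pd ns \<phi> (s, a, t)) has_real_derivative pd (ns @ [2]) \<phi> (s, a, b)) (at b)"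
proof -
  have "((\<lambda>t. pd ns \<phi> (t + s, a, b)) has_real_derivative pd (ns @ [0]) \<phi> (s, a, b)) (at 0)"
    using pd_interior_deriv[OF \<phi> z, of ns 0] by (simp add: dirvec_def add.commute)
  then show "((\<lambda>t. pd ns \<phi> (t, a, b)) has_real_derivative pd (ns @ [0]) \<phi> (s, a, b)) (at s)"
    using DERIV_shift[of "\<lambda>t. pd ns \<phi> (t, a, b)" _ 0 s] by simp
  have "((\<lambda>t. pd ns \<phi> (s, t + a, b)) has_real_derivative pd (ns @ [1]) \<phi> (s, a, b)) (at 0)"
    using pd_interior_deriv[OF \<phi> z, of ns 1] by (simp add: dirvec_def add.commute)
  then show "((\<lambda>t. pd ns \<phi> (s, t, b)) has_real_derivative pd (ns @ [1]) \<phi> (s, a, b)) (at a)"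
    using DERIV_shift[of "\<lambda>t. pd ns \<phi> (s, t, b)" _ 0 a] by simp
  have "((\<lambda>t. pd ns \<phi> (s, a, t + b)) has_real_derivative pd (ns @ [2]) \<phi> (s, a, b)) (at 0)"
    using pd_interior_deriv[OF \<phi> z, of ns 2] by (simp add: dirvec_def add.commute)
  then show "((\<lambda>t. pd ns \<phi> (s, a, t)) has_real_derivative pd (ns @ [2]) \<phi> (s, a, b)) (at b)"
    using DERIV_shift[of "\<lambda>t. pd ns \<phi> (s, a, t)" _ 0 b] by simp
qed

text \<open>One coordinate is changed at a time, inside the box, and the one-variable mean value
  inequality is applied to each of the three increments. This needs partial derivatives only, not
  joint differentiability.\<close>

lemma pd_box_interior:
  assumes \<phi>: "\<phi> \<in> CO \<Omega>" and A: "convex A" "A \<subseteq> {0<..<1}" and B: "convex B" and C: "convex C"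
    and sub: "A \<times> B \<times> C \<subseteq> \<Omega>"
    and osc: "\<And>z. z \<in> A \<times> B \<times> C \<Longrightarrow> \<bar>pd (ns @ [0]) \<phi> z - c0\<bar> \<le> \<epsilon> \<and>
      \<bar>pd (ns @ [1]) \<phi> z - c1\<bar> \<le> \<epsilon> \<and> \<bar>pd (ns @ [2]) \<phi> z - c2\<bar> \<le> \<epsilon>"
    and z: "s \<in> A" "a \<in> B" "b \<in> C" and z': "s' \<in> A" "a' \<in> B" "b' \<in> C"
  shows "\<bar>pd ns \<phi> (s', a', b') - pd ns \<phi> (s, a, b) - (c0 * (s' - s) + c1 * (a' - a) + c2 * (b' - b))\<bar>
    \<le> \<epsilon> * (\<bar>s' - s\<bar> + \<bar>a' - a\<bar> + \<bar>b' - b\<bar>)"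
proof -
  have int: "(t, u, v) \<in> interior \<Omega>" if "t \<in> A" "u \<in> B" "v \<in> C" for t u v
    using that sub A by (auto simp: interior_Omega)
  have "\<bar>pd ns \<phi> (s', a', b') - pd ns \<phi> (s, a', b') - c0 * (s' - s)\<bar> \<le> \<epsilon> * \<bar>s' - s\<bar>"
  proof (rule real_increment_bound[OF A(1) z(1) z'(1)])
    fix t assume t: "t \<in> A"
    show "((\<lambda>t. pd ns \<phi> (t, a', b')) has_real_derivative pd (ns @ [0]) \<phi> (t, a', b')) (at t)"
      by (rule pd_interior_coords(1)[OF \<phi> int[OF t z'(2,3)]])
    show "\<bar>pd (ns @ [0]) \<phi> (t, a', b') - c0\<bar> \<le> \<epsilon>"
      using osc[of "(t, a', b')"] t z z' by simp
  qed
  moreover have "\<bar>pd ns \<phi> (s, a', b') - pd ns \<phi> (s, a, b') - c1 * (a' - a)\<bar> \<le> \<epsilon> * \<bar>a' - a\<bar>"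
  proof (rule real_increment_bound[OF B z(2) z'(2)])
    fix t assume t: "t \<in> B"
    show "((\<lambda>t. pd ns \<phi> (s, t, b')) has_real_derivative pd (ns @ [1]) \<phi> (s, t, b')) (at t)"
      by (rule pd_interior_coords(2)[OF \<phi> int[OF z(1) t z'(3)]])
    show "\<bar>pd (ns @ [1]) \<phi> (s, t, b') - c1\<bar> \<le> \<epsilon>"
      using osc[of "(s, t, b')"] t z z' by simp
  qed
  moreover have "\<bar>pd ns \<phi> (s, a, b') - pd ns \<phi> (s, a, b) - c2 * (b' - b)\<bar> \<le> \<epsilon> * \<bar>b' - b\<bar>"
  proof (rule real_increment_bound[OF C z(3) z'(3)])
    fix t assume t: "t \<in> C"
    show "((\<lambda>t. pd ns \<phi> (s, a, t)) has_real_derivative pd (ns @ [2]) \<phi> (s, a, t)) (at t)"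
      by (rule pd_interior_coords(3)[OF \<phi> int[OF z(1,2) t]])
    show "\<bar>pd (ns @ [2]) \<phi> (s, a, t) - c2\<bar> \<le> \<epsilon>"
      using osc[of "(s, a, t)"] t z z' by simp
  qed
  ultimately show ?thesis unfolding distrib_left by linarith
qed

text \<open>The closed faces \<open>s = 0\<close> and \<open>s = 1\<close> are reached by pushing both points towards \<open>s = 1/2\<close>.\<close>

lemma pd_box:
  assumes \<phi>: "\<phi> \<in> CO \<Omega>" and z0: "(s0, a0, b0) \<in> \<Omega>" and d: "0 < d"
    and sub: "\<And>s a b. s \<in> {0..1} \<Longrightarrow> \<bar>s - s0\<bar> < d \<Longrightarrow> \<bar>a - a0\<bar> < d \<Longrightarrow> \<bar>b - b0\<bar> < d \<Longrightarrow> (s, a, b) \<in> \<Omega>"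
    and osc: "\<And>s a b. s \<in> {0..1} \<Longrightarrow> \<bar>s - s0\<bar> < d \<Longrightarrow> \<bar>a - a0\<bar> < d \<Longrightarrow> \<bar>b - b0\<bar> < d \<Longrightarrow>
      \<bar>pd (ns @ [0]) \<phi> (s, a, b) - c0\<bar> \<le> \<epsilon> \<and>
      \<bar>pd (ns @ [1]) \<phi> (s, a, b) - c1\<bar> \<le> \<epsilon> \<and> \<bar>pd (ns @ [2]) \<phi> (s, a, b) - c2\<bar> \<le> \<epsilon>"
    and z: "s \<in> {0..1}" "\<bar>s - s0\<bar> < d" "\<bar>a - a0\<bar> < d" "\<bar>b - b0\<bar> < d"
  shows "\<bar>pd ns \<phi> (s, a, b) - pd ns \<phi> (s0, a0, b0) - (c0 * (s - s0) + c1 * (a - a0) + c2 * (b - b0))\<bar>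
    \<le> \<epsilon> * (\<bar>s - s0\<bar> + \<bar>a - a0\<bar> + \<bar>b - b0\<bar>)"
proof -
  \<comment> \<open>A push with parameter \<tau> moves a point of the unit interval by at most
    \<tau>/2, so for \<tau> up to this value both pushed points stay within \<open>d\<close> of
    \<open>s0\<close>.\<close>
  define \<delta> where "\<delta> = min 1 (d - \<bar>s - s0\<bar>)"
  have \<delta>: "0 < \<delta>" "\<delta> \<le> 1" "\<delta> \<le> d - \<bar>s - s0\<bar>" using z d by (auto simp: \<delta>_def)
  have s0: "s0 \<in> {0..1}" using z0 Omega_unit by auto
  define p where "p = (\<lambda>\<tau> u. u + \<tau> * (1/2 - u) :: real)"
  have p1: "\<bar>p \<tau> u - u\<bar> \<le> \<tau> * (1/2)" if "0 \<le> \<tau>" "u \<in> {0..1}" for \<tau> u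
  proof -
    have "\<bar>\<tau> * (1/2 - u)\<bar> = \<tau> * \<bar>1/2 - u\<bar>" using that by (simp add: abs_mult)
    also have "\<dots> \<le> \<tau> * (1/2)" using that by (intro mult_left_mono) (auto simp: abs_if)
    finally show ?thesis by (simp add: p_def)
  qed
  have p2: "p \<tau> u = (1 - \<tau>) * u + \<tau> * (1/2)" for \<tau> u by (simp add: p_def algebra_simps)
  have p3: "p \<tau> u \<in> {0<..<1}" if "0 < \<tau>" "\<tau> \<le> 1" "u \<in> {0..1}" for \<tau> u
  proof -
    have "0 \<le> (1 - \<tau>) * u" "(1 - \<tau>) * u \<le> 1 - \<tau>"
      using that by (auto intro!: mult_left_le mult_nonneg_nonneg)
    then show ?thesis using that by (simp add: p2)
  qed
  have p4: "p \<tau> u \<in> {0..1}" if "0 \<le> \<tau>" "\<tau> \<le> 1" "u \<in> {0..1}" for \<tau> u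
    using p3[of \<tau> u] that by (cases "\<tau> = 0") (auto simp: p_def)
  have near: "\<bar>p \<tau> u - s0\<bar> < d" if "0 \<le> \<tau>" "\<tau> \<le> \<delta>" "u \<in> {s0, s}" for \<tau> u
  proof -
    have "\<bar>p \<tau> u - u\<bar> \<le> \<tau> * (1/2)" using p1 that z s0 by auto
    moreover have "\<tau> * (1/2) < d - \<bar>s - s0\<bar>" using \<delta> that by linarith
    moreover have "\<bar>u - s0\<bar> \<le> \<bar>s - s0\<bar>" using that(3) by auto
    ultimately show ?thesis by linarith
  qed
  \<comment> \<open>\<open>h\<close> is the excess of the left side over the right side for the
    pushed points. It is continuous in \<tau>, so the bound for \<tau> > 0 passes to \<tau> = 0,
    where \<open>p\<close> is the identity.\<close>
  define h where "h = (\<lambda>\<tau>. \<bar>pd ns \<phi> (p \<tau> s, a, b) - pd ns \<phi> (p \<tau> s0, a0, b0) -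
    (c0 * (p \<tau> s - p \<tau> s0) + c1 * (a - a0) + c2 * (b - b0))\<bar> - \<epsilon> * (\<bar>p \<tau> s - p \<tau> s0\<bar> + \<bar>a - a0\<bar> + \<bar>b - b0\<bar>))"
  have h: "h \<tau> \<le> 0" if \<tau>: "\<tau> \<in> {0<..<\<delta>}" for \<tau>
  proof -
    have "\<bar>pd ns \<phi> (p \<tau> s, a, b) - pd ns \<phi> (p \<tau> s0, a0, b0) -
      (c0 * (p \<tau> s - p \<tau> s0) + c1 * (a - a0) + c2 * (b - b0))\<bar> \<le> \<epsilon> * (\<bar>p \<tau> s - p \<tau> s0\<bar> + \<bar>a - a0\<bar> + \<bar>b - b0\<bar>)"
    proof (rule pd_box_interior[OF \<phi>, of "{0<..<1} \<inter> {s0-d<..<s0+d}" "{a0-d<..<a0+d}" "{b0-d<..<b0+d}"])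
      show "({0<..<1} \<inter> {s0-d<..<s0+d}) \<times> {a0-d<..<a0+d} \<times> {b0-d<..<b0+d} \<subseteq> \<Omega>"
        using sub by auto
    next
      fix w assume w: "w \<in> ({0<..<1} \<inter> {s0-d<..<s0+d}) \<times> {a0-d<..<a0+d} \<times> {b0-d<..<b0+d}"
      obtain s' a' b' where "w = (s', a', b')" by (cases w) auto
      then show "\<bar>pd (ns @ [0]) \<phi> w - c0\<bar> \<le> \<epsilon> \<and> \<bar>pd (ns @ [1]) \<phi> w - c1\<bar> \<le> \<epsilon> \<and> \<bar>pd (ns @ [2]) \<phi> w - c2\<bar> \<le> \<epsilon>"
        using w osc[of s' a' b'] by (auto simp: abs_less_iff)
    next
      have *: "\<bar>p \<tau> s0 - s0\<bar> < d" "\<bar>p \<tau> s - s0\<bar> < d" using near[of \<tau> s0] near[of \<tau> s] \<tau> by auto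
      have **: "p \<tau> s0 \<in> {0<..<1}" "p \<tau> s \<in> {0<..<1}" using p3 \<tau> \<delta> s0 z by auto
      show "p \<tau> s0 \<in> {0<..<1} \<inter> {s0-d<..<s0+d}" "p \<tau> s \<in> {0<..<1} \<inter> {s0-d<..<s0+d}"
        using * ** by (auto simp: abs_less_iff)
    qed (use z d in \<open>auto intro: convex_Int simp: abs_less_iff\<close>)
    then show ?thesis by (simp add: h_def)
  qed
  have c: "continuous_on {0..\<delta>} (\<lambda>\<tau>. pd ns \<phi> (p \<tau> u, v, w))" if "u \<in> {s0, s}" "\<bar>v - a0\<bar> < d" "\<bar>w - b0\<bar> < d" for u v w
  proof (rule continuous_on_compose2[OF pd_continuous[OF \<phi>]])
    show "continuous_on {0..\<delta>} (\<lambda>\<tau>. (p \<tau> u, v, w))" unfolding p_def by (intro continuous_intros)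
    show "(\<lambda>\<tau>. (p \<tau> u, v, w)) ` {0..\<delta>} \<subseteq> \<Omega>"
      using near that p4 \<delta> s0 z by (auto intro!: sub)
  qed
  have cp: "continuous_on {0..\<delta>} (\<lambda>\<tau>. p \<tau> u)" for u unfolding p_def by (intro continuous_intros)
  have "continuous_on {0..\<delta>} h"
    unfolding h_def using d z by (intro continuous_intros c cp) auto
  then have "h 0 \<le> 0"
    using continuous_le_on_closure[of "{0<..<\<delta>}" h 0 0] h \<delta>(1) by (simp add: closure_greaterThanLessThan)
  then show ?thesis by (simp add: h_def p_def)
qed

text \<open>Continuity of the three next partial derivatives bounds their oscillation on a small box
  around \<open>z0\<close>, and \<open>pd_box\<close> turns this into a first-order expansion. The
  tolerance e/3 is paid once for each coordinate. Being relative to \<Omega>, the derivative also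
  exists on the faces.\<close>

lemma pd_has_derivative:
  assumes \<phi>: "\<phi> \<in> CO \<Omega>" and z0: "z0 \<in> \<Omega>"
  shows "(pd ns \<phi> has_derivative (\<lambda>(s, a, b). s * pd (ns @ [0]) \<phi> z0 + a * pd (ns @ [1]) \<phi> z0 + b * pd (ns @ [2]) \<phi> z0))
    (at z0 within \<Omega>)"
  unfolding has_derivative_within_alt
proof (intro conjI allI impI)
  let ?L = "\<lambda>(s, a, b). s * pd (ns @ [0]) \<phi> z0 + a * pd (ns @ [1]) \<phi> z0 + b * pd (ns @ [2]) \<phi> z0"
  have "linear ?L" by (rule linearI) (auto simp: algebra_simps)
  then show "bounded_linear ?L" using linear_conv_bounded_linear by blast
  fix e :: real assume e: "0 < e"
  obtain s0 a0 b0 where z: "z0 = (s0, a0, b0)" by (cases z0) auto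
  obtain d where d: "0 < d" "\<And>s a b. s \<in> {0..1} \<Longrightarrow> \<bar>s - s0\<bar> < d \<Longrightarrow> \<bar>a - a0\<bar> < d \<Longrightarrow> \<bar>b - b0\<bar> < d \<Longrightarrow> (s, a, b) \<in> \<Omega>"
    using box_in_Omega z0 z by metis
  have "\<exists>\<delta>>0. \<forall>w\<in>\<Omega>. dist w z0 < \<delta> \<longrightarrow> \<bar>pd (ns @ [n]) \<phi> w - pd (ns @ [n]) \<phi> z0\<bar> \<le> e / 3" for n
  proof -
    have c: "\<forall>x\<in>\<Omega>. \<forall>e>0. \<exists>\<delta>>0. \<forall>w\<in>\<Omega>. dist w x < \<delta> \<longrightarrow>
        \<bar>pd (ns @ [n]) \<phi> w - pd (ns @ [n]) \<phi> x\<bar> < e"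
      using pd_continuous[OF \<phi>, of "ns @ [n]"] unfolding continuous_on_iff dist_real_def .
    have "0 < e / 3" using e by simp
    from c[rule_format, OF z0 this] obtain \<delta> where "0 < \<delta>"
      "\<forall>w\<in>\<Omega>. dist w z0 < \<delta> \<longrightarrow> \<bar>pd (ns @ [n]) \<phi> w - pd (ns @ [n]) \<phi> z0\<bar> < e / 3"
      by (elim exE conjE)
    then show ?thesis by (meson less_imp_le)
  qed
  then have "\<forall>n::nat. \<exists>\<delta>>0. \<forall>w\<in>\<Omega>. dist w z0 < \<delta> \<longrightarrow> \<bar>pd (ns @ [n]) \<phi> w - pd (ns @ [n]) \<phi> z0\<bar> \<le> e / 3"
    by blast
  from choice[OF this] obtain D where D':
    "\<forall>n. 0 < D n \<and> (\<forall>w\<in>\<Omega>. dist w z0 < D n \<longrightarrow> \<bar>pd (ns @ [n]) \<phi> w - pd (ns @ [n]) \<phi> z0\<bar> \<le> e / 3)" ..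
  have D: "\<And>n. 0 < D n"
    "\<And>n w. w \<in> \<Omega> \<Longrightarrow> dist w z0 < D n \<Longrightarrow> \<bar>pd (ns @ [n]) \<phi> w - pd (ns @ [n]) \<phi> z0\<bar> \<le> e / 3"
    using D' by blast+
  \<comment> \<open>On a box of half-width \<delta> the distance to \<open>z0\<close> is only
    bounded by 3 \<delta>, hence the division of the radii \<open>D n\<close> by three.\<close>
  define \<delta> where "\<delta> = min d (min (D 0) (min (D 1) (D 2)) / 3)"
  have "0 < min (D 0) (min (D 1) (D 2))" using D(1) by simp
  then have \<delta>: "0 < \<delta>" "\<delta> \<le> d" "3 * \<delta> \<le> D 0" "3 * \<delta> \<le> D 1" "3 * \<delta> \<le> D 2"
    using d(1) unfolding \<delta>_def by (auto simp: min_def)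
  have near: "dist (s, a, b) z0 < 3 * \<delta>" if "\<bar>s - s0\<bar> < \<delta>" "\<bar>a - a0\<bar> < \<delta>" "\<bar>b - b0\<bar> < \<delta>" for s a b
  proof -
    have "dist (s, a, b) z0 \<le> \<bar>s - s0\<bar> + (\<bar>a - a0\<bar> + \<bar>b - b0\<bar>)"
      unfolding dist_prod_def fst_conv snd_conv z
      by (intro order.trans[OF sqrt_sum_squares_le_sum] add_mono order.trans[OF sqrt_sum_squares_le_sum])
        (auto simp: dist_real_def)
    then show ?thesis using that by linarith
  qed
  show "\<exists>\<delta>>0. \<forall>w\<in>\<Omega>. norm (w - z0) < \<delta> \<longrightarrow>
      norm (pd ns \<phi> w - pd ns \<phi> z0 - ?L (w - z0)) \<le> e * norm (w - z0)"
  proof (intro exI conjI ballI impI)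
    show "0 < \<delta>" by fact
    fix w assume w: "w \<in> \<Omega>" "norm (w - z0) < \<delta>"
    obtain s a b where w': "w = (s, a, b)" by (cases w) auto
    have n: "\<bar>s - s0\<bar> \<le> norm (w - z0)" "\<bar>a - a0\<bar> \<le> norm (w - z0)" "\<bar>b - b0\<bar> \<le> norm (w - z0)"
      using norm_fst_le[where x = "s - s0" and y = "(a - a0, b - b0)"]
        norm_snd_le[where x = "s - s0" and y = "(a - a0, b - b0)"]
        norm_fst_le[where x = "a - a0" and y = "b - b0"] norm_snd_le[where x = "a - a0" and y = "b - b0"]
      by (simp_all add: w' z)
    have "\<bar>pd ns \<phi> (s, a, b) - pd ns \<phi> (s0, a0, b0) - (pd (ns @ [0]) \<phi> z0 * (s - s0) + pd (ns @ [1]) \<phi> z0 * (a - a0)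
        + pd (ns @ [2]) \<phi> z0 * (b - b0))\<bar> \<le> e / 3 * (\<bar>s - s0\<bar> + \<bar>a - a0\<bar> + \<bar>b - b0\<bar>)"
    proof (rule pd_box[OF \<phi>, where d = \<delta>])
      show "(s', a', b') \<in> \<Omega>" if "s' \<in> {0..1}" "\<bar>s' - s0\<bar> < \<delta>" "\<bar>a' - a0\<bar> < \<delta>" "\<bar>b' - b0\<bar> < \<delta>" for s' a' b'
        using that \<delta> by (intro d(2)) auto
      then show "\<bar>pd (ns @ [0]) \<phi> (s', a', b') - pd (ns @ [0]) \<phi> z0\<bar> \<le> e / 3 \<and>
          \<bar>pd (ns @ [1]) \<phi> (s', a', b') - pd (ns @ [1]) \<phi> z0\<bar> \<le> e / 3 \<and>
          \<bar>pd (ns @ [2]) \<phi> (s', a', b') - pd (ns @ [2]) \<phi> z0\<bar> \<le> e / 3"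
        if "s' \<in> {0..1}" "\<bar>s' - s0\<bar> < \<delta>" "\<bar>a' - a0\<bar> < \<delta>" "\<bar>b' - b0\<bar> < \<delta>" for s' a' b'
        using that near[OF that(2-4)] \<delta>(3-5) by (intro conjI D(2)) auto
    qed (use w w' n z z0 \<delta> Omega_unit[of s a b] in auto)
    also have "\<dots> \<le> e / 3 * (3 * norm (w - z0))" using n e by (intro mult_left_mono) auto
    finally show "norm (pd ns \<phi> w - pd ns \<phi> z0 - ?L (w - z0)) \<le> e * norm (w - z0)"
      by (simp add: w' z mult.commute)
  qed
qed

lemma pd_curve:
  assumes \<phi>: "\<phi> \<in> CO \<Omega>"
    and "(\<alpha> has_real_derivative \<alpha>') (at t within T)" "(\<beta> has_real_derivative \<beta>') (at t within T)"
      "(\<gamma> has_real_derivative \<gamma>') (at t within T)"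
    and T: "t \<in> T" "\<And>\<tau>. \<tau> \<in> T \<Longrightarrow> (\<alpha> \<tau>, \<beta> \<tau>, \<gamma> \<tau>) \<in> \<Omega>"
  shows "((\<lambda>\<tau>. pd ns \<phi> (\<alpha> \<tau>, \<beta> \<tau>, \<gamma> \<tau>)) has_real_derivative
    \<alpha>' * pd (ns @ [0]) \<phi> (\<alpha> t, \<beta> t, \<gamma> t) + \<beta>' * pd (ns @ [1]) \<phi> (\<alpha> t, \<beta> t, \<gamma> t) + \<gamma>' * pd (ns @ [2]) \<phi> (\<alpha> t, \<beta> t, \<gamma> t))
    (at t within T)"
proof -
  let ?g = "\<lambda>\<tau>. (\<alpha> \<tau>, \<beta> \<tau>, \<gamma> \<tau>)"
  have "(?g has_derivative (\<lambda>h. (\<alpha>' * h, \<beta>' * h, \<gamma>' * h))) (at t within T)"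
    using assms(2-4) unfolding has_field_derivative_def by (intro has_derivative_Pair)
  moreover have "(pd ns \<phi> has_derivative (\<lambda>(s, a, b). s * pd (ns @ [0]) \<phi> (?g t) + a * pd (ns @ [1]) \<phi> (?g t)
      + b * pd (ns @ [2]) \<phi> (?g t))) (at (?g t) within ?g ` T)"
    by (rule has_derivative_subset[OF pd_has_derivative[OF \<phi>]]) (use T in auto)
  ultimately have "((pd ns \<phi> \<circ> ?g) has_derivative (\<lambda>(s, a, b). s * pd (ns @ [0]) \<phi> (?g t) + a * pd (ns @ [1]) \<phi> (?g t)
      + b * pd (ns @ [2]) \<phi> (?g t)) \<circ> (\<lambda>h. (\<alpha>' * h, \<beta>' * h, \<gamma>' * h))) (at t within T)"
    by (rule diff_chain_within)
  then show ?thesis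
    unfolding has_field_derivative_def o_def
    by (rule has_derivative_eq_rhs) (simp add: fun_eq_iff algebra_simps)
qed

text \<open>The scalar mean value theorem along the segment gives one intermediate point common to
  both partial derivatives. The first coordinate stays fixed because solutions are always compared
  at the same \<open>s\<close>; the segment is a hypothesis since \<Omega> need not be
  convex.\<close>

lemma pd_mvt:
  assumes \<phi>: "\<phi> \<in> CO \<Omega>"
    and seg: "\<And>t. t \<in> {0..1} \<Longrightarrow> (s, a + t * (a' - a), b + t * (b' - b)) \<in> \<Omega>"
  obtains t where "t \<in> {0..1}"
    "pd ns \<phi> (s, a', b') - pd ns \<phi> (s, a, b) =
      (a' - a) * pd (ns @ [1]) \<phi> (s, a + t * (a' - a), b + t * (b' - b)) +
      (b' - b) * pd (ns @ [2]) \<phi> (s, a + t * (a' - a), b + t * (b' - b))"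
proof -
  let ?g = "\<lambda>t. pd ns \<phi> (s, a + t * (a' - a), b + t * (b' - b))"
  let ?d = "\<lambda>t. (a' - a) * pd (ns @ [1]) \<phi> (s, a + t * (a' - a), b + t * (b' - b)) +
      (b' - b) * pd (ns @ [2]) \<phi> (s, a + t * (a' - a), b + t * (b' - b))"
  have "(?g has_derivative (\<lambda>h. ?d t * h)) (at t within {0..1})" if t: "t \<in> {0..1}" for t
  proof -
    have "(?g has_real_derivative 0 * pd (ns @ [0]) \<phi> (s, a + t * (a' - a), b + t * (b' - b)) + ?d t) (at t within {0..1})"
      unfolding add.assoc[symmetric]
      by (rule pd_curve[OF \<phi> _ _ _ t seg]) (auto intro!: derivative_eq_intros)
    then show ?thesis by (simp add: has_field_derivative_def)
  qed
  then have "\<exists>t\<in>{0..1}. ?g 1 - ?g 0 = ?d t * (1 - 0)"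
    by (intro mvt_very_simple) auto
  then show ?thesis using that by auto
qed

end

subsection \<open>Two-point linear boundary value problems\<close>

text \<open>The second-order equation u'' = \<open>p\<^sub>3\<close> u' + \<open>p\<^sub>2\<close> u
  + g as a first-order system. The derivative \<open>v\<close> is carried along explicitly because
  \<phi> depends on y', so every estimate has to control both functions.\<close>

definition is_sol ::
  "(real \<Rightarrow> real) \<Rightarrow> (real \<Rightarrow> real) \<Rightarrow> real \<Rightarrow> real \<Rightarrow> (real \<Rightarrow> real) \<Rightarrow> (real \<Rightarrow> real) \<Rightarrow> (real \<Rightarrow> real) \<Rightarrow> bool" where
  "is_sol p\<^sub>2 p\<^sub>3 h\<^sub>0 h\<^sub>1 g u v \<longleftrightarrow> u 0 = h\<^sub>0 \<and> u 1 = h\<^sub>1 \<and>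
     (\<forall>s\<in>{0..1}. (u has_real_derivative v s) (at s within {0..1}) \<and>
        (v has_real_derivative p\<^sub>3 s * v s + p\<^sub>2 s * u s + g s) (at s within {0..1}))"

definition solvable :: "(real \<Rightarrow> real) \<Rightarrow> (real \<Rightarrow> real) \<Rightarrow> bool" where
  "solvable p\<^sub>2 p\<^sub>3 \<longleftrightarrow> (\<forall>h\<^sub>0 h\<^sub>1 g. continuous_on {0..1} g \<longrightarrow> (\<exists>u v. is_sol p\<^sub>2 p\<^sub>3 h\<^sub>0 h\<^sub>1 g u v))"

text \<open>A single bound \<gamma> for boundary values and source, with \<gamma> = 0 giving
  uniqueness. Requiring M to be at least 1 lets boundary errors be estimated together with source
  errors and keeps divisions by M harmless.\<close>

definition stable :: "(real \<Rightarrow> real) \<Rightarrow> (real \<Rightarrow> real) \<Rightarrow> real \<Rightarrow> bool" where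
  "stable p\<^sub>2 p\<^sub>3 M \<longleftrightarrow> 1 \<le> M \<and> (\<forall>h\<^sub>0 h\<^sub>1 g u v \<gamma>. is_sol p\<^sub>2 p\<^sub>3 h\<^sub>0 h\<^sub>1 g u v \<longrightarrow> \<bar>h\<^sub>0\<bar> \<le> \<gamma> \<longrightarrow> \<bar>h\<^sub>1\<bar> \<le> \<gamma> \<longrightarrow>
     (\<forall>s\<in>{0..1}. \<bar>g s\<bar> \<le> \<gamma>) \<longrightarrow> (\<forall>s\<in>{0..1}. \<bar>u s\<bar> \<le> M * \<gamma> \<and> \<bar>v s\<bar> \<le> M * \<gamma>))"

lemma is_sol_continuous:
  assumes "is_sol p\<^sub>2 p\<^sub>3 h\<^sub>0 h\<^sub>1 g u v"
  shows "continuous_on {0..1} u" "continuous_on {0..1} v"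
  using assms unfolding is_sol_def continuous_on_eq_continuous_within by (meson DERIV_continuous)+

lemma is_sol_linear_combination:
  assumes "is_sol p\<^sub>2 p\<^sub>3 h\<^sub>0 h\<^sub>1 g u v" "is_sol p\<^sub>2 p\<^sub>3 k\<^sub>0 k\<^sub>1 f w x"
  shows "is_sol p\<^sub>2 p\<^sub>3 (c * h\<^sub>0 + k\<^sub>0) (c * h\<^sub>1 + k\<^sub>1) (\<lambda>s. c * g s + f s) (\<lambda>s. c * u s + w s) (\<lambda>s. c * v s + x s)"
proof -
  have "((\<lambda>s. c * u s + w s) has_real_derivative c * v s + x s) (at s within {0..1})"
    "((\<lambda>s. c * v s + x s) has_real_derivative
      p\<^sub>3 s * (c * v s + x s) + p\<^sub>2 s * (c * u s + w s) + (c * g s + f s)) (at s within {0..1})"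
    if s: "s \<in> {0..1}" for s
  proof -
    have d: "(u has_real_derivative v s) (at s within {0..1})" "(w has_real_derivative x s) (at s within {0..1})"
      "(v has_real_derivative p\<^sub>3 s * v s + p\<^sub>2 s * u s + g s) (at s within {0..1})"
      "(x has_real_derivative p\<^sub>3 s * x s + p\<^sub>2 s * w s + f s) (at s within {0..1})"
      using assms s by (simp_all add: is_sol_def)
    show "((\<lambda>s. c * u s + w s) has_real_derivative c * v s + x s) (at s within {0..1})"
      by (rule DERIV_add[OF DERIV_cmult[OF d(1)] d(2)])
    show "((\<lambda>s. c * v s + x s) has_real_derivative
      p\<^sub>3 s * (c * v s + x s) + p\<^sub>2 s * (c * u s + w s) + (c * g s + f s)) (at s within {0..1})"
      by (rule DERIV_cong[OF DERIV_add[OF DERIV_cmult[OF d(3)] d(4)]]) (simp add: algebra_simps)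
  qed
  then show ?thesis using assms by (simp add: is_sol_def)
qed

lemma is_sol_diff:
  assumes "is_sol p\<^sub>2 p\<^sub>3 h\<^sub>0 h\<^sub>1 g u v" "is_sol p\<^sub>2 p\<^sub>3 k\<^sub>0 k\<^sub>1 f w x"
  shows "is_sol p\<^sub>2 p\<^sub>3 (h\<^sub>0 - k\<^sub>0) (h\<^sub>1 - k\<^sub>1) (\<lambda>s. g s - f s) (\<lambda>s. u s - w s) (\<lambda>s. v s - x s)"
  using is_sol_linear_combination[OF assms(2,1), of "-1"] by simp

lemma is_sol_change:
  assumes "is_sol q\<^sub>2 q\<^sub>3 h\<^sub>0 h\<^sub>1 g u v"
    and "\<And>s. s \<in> {0..1} \<Longrightarrow> q\<^sub>3 s * v s + q\<^sub>2 s * u s + g s = p\<^sub>3 s * v s + p\<^sub>2 s * u s + f s"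
  shows "is_sol p\<^sub>2 p\<^sub>3 h\<^sub>0 h\<^sub>1 f u v"
  using assms by (simp add: is_sol_def)

lemma stableD:
  assumes "stable p\<^sub>2 p\<^sub>3 M" "is_sol p\<^sub>2 p\<^sub>3 h\<^sub>0 h\<^sub>1 g u v" "\<bar>h\<^sub>0\<bar> \<le> \<gamma>" "\<bar>h\<^sub>1\<bar> \<le> \<gamma>"
    "\<And>s. s \<in> {0..1} \<Longrightarrow> \<bar>g s\<bar> \<le> \<gamma>" "s \<in> {0..1}"
  shows "\<bar>u s\<bar> \<le> M * \<gamma>" "\<bar>v s\<bar> \<le> M * \<gamma>"
  using assms unfolding stable_def by blast+

text \<open>The left side is the derivative of u^2 + v^2 along the system. Adding \<gamma>^2 to the
  energy absorbs the source, and 3 P + 2 is the largest coefficient that arises: v^2 collects 1 + 2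
  P + P + 1 from the four terms.\<close>

lemma energy_derivative_bound:
  fixes u v g q\<^sub>2 q\<^sub>3 P \<gamma> :: real
  assumes "\<bar>q\<^sub>2\<bar> \<le> P" "\<bar>q\<^sub>3\<bar> \<le> P" "\<bar>g\<bar> \<le> \<gamma>"
  shows "2 * u * v + 2 * v * (q\<^sub>3 * v + q\<^sub>2 * u + g) \<le> (3 * P + 2) * (u\<^sup>2 + v\<^sup>2 + \<gamma>\<^sup>2)"
proof -
  have P: "0 \<le> P" using assms(1) by linarith
  have 1: "2 * u * v \<le> u\<^sup>2 + v\<^sup>2" by (rule sum_squares_bound)
  have 2: "2 * v * g \<le> v\<^sup>2 + g\<^sup>2" by (rule sum_squares_bound)
  have 3: "g\<^sup>2 \<le> \<gamma>\<^sup>2" using assms(3) by (metis abs_ge_zero order_trans abs_le_square_iff abs_of_nonneg)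
  have 4: "q\<^sub>3 * v\<^sup>2 \<le> P * v\<^sup>2" using assms(2) by (intro mult_right_mono) auto
  have "2 * (u * v) * q\<^sub>2 \<le> \<bar>2 * (u * v)\<bar> * \<bar>q\<^sub>2\<bar>" by (metis abs_ge_self abs_mult)
  also have "\<dots> \<le> (u\<^sup>2 + v\<^sup>2) * P"
  proof (rule mult_mono)
    show "\<bar>2 * (u * v)\<bar> \<le> u\<^sup>2 + v\<^sup>2"
      using 1 sum_squares_bound[of "-u" v] by (simp add: abs_le_iff)
  qed (use assms in auto)
  finally have 5: "2 * (u * v) * q\<^sub>2 \<le> P * u\<^sup>2 + P * v\<^sup>2" by (simp add: algebra_simps)
  have 6: "0 \<le> P * u\<^sup>2" "0 \<le> P * \<gamma>\<^sup>2" "0 \<le> u\<^sup>2" "0 \<le> \<gamma>\<^sup>2" using P by auto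
  have "2 * u * v + 2 * v * (q\<^sub>3 * v + q\<^sub>2 * u + g) = 2 * u * v + 2 * (q\<^sub>3 * v\<^sup>2) + 2 * (u * v) * q\<^sub>2 + 2 * v * g"
    by (simp add: algebra_simps power2_eq_square)
  also have "\<dots> \<le> 3 * (P * u\<^sup>2) + 3 * (P * v\<^sup>2) + 3 * (P * \<gamma>\<^sup>2) + 2 * u\<^sup>2 + 2 * v\<^sup>2 + 2 * \<gamma>\<^sup>2"
    using 1 2 3 4 5 6 by linarith
  also have "\<dots> = (3 * P + 2) * (u\<^sup>2 + v\<^sup>2 + \<gamma>\<^sup>2)" by (simp add: algebra_simps)
  finally show ?thesis .
qed

text \<open>By \<open>energy_derivative_bound\<close> the weighted energy \<open>F\<close> has
  nonpositive derivative, so it never exceeds its initial value, which is at most 3 \<gamma>^2.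
  Undoing the exponential weight produces the constant 3 exp (3 P + 2), and the square root returns
  from the energy to |u| and |v|.\<close>

lemma gronwall_second_order:
  fixes u v g p\<^sub>2 p\<^sub>3 :: "real \<Rightarrow> real"
  assumes u: "\<And>s. s \<in> {0..1} \<Longrightarrow> (u has_real_derivative v s) (at s within {0..1})"
    and v: "\<And>s. s \<in> {0..1} \<Longrightarrow> (v has_real_derivative p\<^sub>3 s * v s + p\<^sub>2 s * u s + g s) (at s within {0..1})"
    and p: "\<And>s. s \<in> {0..1} \<Longrightarrow> \<bar>p\<^sub>2 s\<bar> \<le> P \<and> \<bar>p\<^sub>3 s\<bar> \<le> P"
    and g: "\<And>s. s \<in> {0..1} \<Longrightarrow> \<bar>g s\<bar> \<le> \<gamma>" and init: "\<bar>u 0\<bar> \<le> \<gamma>" "\<bar>v 0\<bar> \<le> \<gamma>"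
    and s: "s \<in> {0..1}"
  shows "\<bar>u s\<bar> \<le> sqrt (3 * exp (3 * P + 2)) * \<gamma>" "\<bar>v s\<bar> \<le> sqrt (3 * exp (3 * P + 2)) * \<gamma>"
proof -
  define A where "A = 3 * P + 2"
  have P: "0 \<le> P" using p[of 0] by auto
  have \<gamma>: "0 \<le> \<gamma>" using init by linarith
  define F where "F = (\<lambda>s. ((u s)\<^sup>2 + (v s)\<^sup>2 + \<gamma>\<^sup>2) * exp (- A * s))"
  define F' where "F' = (\<lambda>s. (2 * u s * v s + 2 * v s * (p\<^sub>3 s * v s + p\<^sub>2 s * u s + g s)
    - A * ((u s)\<^sup>2 + (v s)\<^sup>2 + \<gamma>\<^sup>2)) * exp (- A * s))"
  have "(F has_real_derivative F' t) (at t within {0..1})" if "t \<in> {0..1}" for t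
    unfolding F_def F'_def
    by (rule derivative_eq_intros u[OF that] v[OF that] refl | simp)+ (simp add: algebra_simps)
  then have "(F has_derivative (\<lambda>h. F' t * h)) (at t within {0..s})" if "0 \<le> t" "t \<le> s" for t
    using that s unfolding has_field_derivative_def
    by (intro has_derivative_subset[of F "(*) (F' t)" t "{0..1}" "{0..s}"]) auto
  then obtain t where t: "t \<in> {0..s}" "F s - F 0 = F' t * (s - 0)"
    using mvt_very_simple[of 0 s F "\<lambda>t h. F' t * h"] s by auto
  have "F' t \<le> 0"
    unfolding F'_def A_def using t s p[of t] g[of t] energy_derivative_bound[of "p\<^sub>2 t" P "p\<^sub>3 t" "g t" \<gamma> "u t" "v t"]
    by (intro mult_nonpos_nonneg) auto
  then have "F s \<le> F 0" using t s mult_nonpos_nonneg[of "F' t" s] by simp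
  also have "F 0 \<le> 3 * \<gamma>\<^sup>2"
    using init \<gamma> abs_le_square_iff[of "u 0" \<gamma>] abs_le_square_iff[of "v 0" \<gamma>] by (simp add: F_def)
  finally have "((u s)\<^sup>2 + (v s)\<^sup>2 + \<gamma>\<^sup>2) * exp (- A * s) * exp (A * s) \<le> 3 * \<gamma>\<^sup>2 * exp (A * s)"
    unfolding F_def by (intro mult_right_mono) auto
  then have "(u s)\<^sup>2 + (v s)\<^sup>2 + \<gamma>\<^sup>2 \<le> 3 * \<gamma>\<^sup>2 * exp (A * s)"
    by (simp add: mult.assoc mult_exp_exp)
  also have "\<dots> \<le> 3 * \<gamma>\<^sup>2 * exp A"
    using s P by (intro mult_left_mono) (auto simp: A_def mult_left_le)
  finally have E: "(u s)\<^sup>2 + (v s)\<^sup>2 + \<gamma>\<^sup>2 \<le> (sqrt (3 * exp A) * \<gamma>)\<^sup>2"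
    by (simp add: power_mult_distrib mult_ac)
  have nonneg: "0 \<le> sqrt (3 * exp A) * \<gamma>" using \<gamma> by simp
  have "(u s)\<^sup>2 \<le> (sqrt (3 * exp A) * \<gamma>)\<^sup>2" "(v s)\<^sup>2 \<le> (sqrt (3 * exp A) * \<gamma>)\<^sup>2"
    using E zero_le_power2[of "u s"] zero_le_power2[of "v s"] zero_le_power2[of \<gamma>] by linarith+
  then show "\<bar>u s\<bar> \<le> sqrt (3 * exp (3 * P + 2)) * \<gamma>" "\<bar>v s\<bar> \<le> sqrt (3 * exp (3 * P + 2)) * \<gamma>"
    using nonneg abs_le_square_iff[of _ "sqrt (3 * exp A) * \<gamma>"] unfolding A_def by auto
qed

text \<open>Subtracting a multiple of the solution \<open>e\<close> with \<open>e 0 = 0\<close>, \<open>e 1 = 1\<close> turns the boundary value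
  problem into an initial value problem with vanishing initial slope.\<close>

lemma solvable_imp_stable:
  assumes cont: "continuous_on {0..1} p\<^sub>2" "continuous_on {0..1} p\<^sub>3" and "solvable p\<^sub>2 p\<^sub>3"
  obtains M where "stable p\<^sub>2 p\<^sub>3 M"
proof -
  obtain e e' where "is_sol p\<^sub>2 p\<^sub>3 0 1 (\<lambda>_. 0) e e'"
    using assms(3)[unfolded solvable_def, rule_format, of "\<lambda>_. 0" 0 1] by auto
  then have e: "e 0 = 0" "e 1 = 1" "\<And>s. s \<in> {0..1} \<Longrightarrow> (e has_real_derivative e' s) (at s within {0..1})"
    "\<And>s. s \<in> {0..1} \<Longrightarrow> (e' has_real_derivative p\<^sub>3 s * e' s + p\<^sub>2 s * e s + 0) (at s within {0..1})"
    and e_sol: "is_sol p\<^sub>2 p\<^sub>3 0 1 (\<lambda>_. 0) e e'"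
    by (simp_all add: is_sol_def)
  obtain P2 P3 where P': "\<forall>s\<in>{0..1}. \<bar>p\<^sub>2 s\<bar> \<le> P2" "\<forall>s\<in>{0..1}. \<bar>p\<^sub>3 s\<bar> \<le> P3"
    using bounded_on_compact[OF cont(1) compact_Icc] bounded_on_compact[OF cont(2) compact_Icc] by auto
  define P where "P = max P2 P3"
  have P: "\<bar>p\<^sub>2 s\<bar> \<le> P \<and> \<bar>p\<^sub>3 s\<bar> \<le> P" if "s \<in> {0..1}" for s
    using P' that by (auto simp: P_def le_max_iff_disj)
  define C where "C = sqrt (3 * exp (3 * P + 2))"
  have C: "0 \<le> C" by (simp add: C_def)
  have e'0: "e' 0 \<noteq> 0"
  proof
    assume "e' 0 = 0"
    then have "\<bar>e 1\<bar> \<le> C * 0"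
      unfolding C_def using e by (intro gronwall_second_order(1)[OF e(3,4) P]) auto
    then show False using e by simp
  qed
  define K where "K = \<bar>e' 0\<bar>"
  have eK: "\<bar>e s\<bar> \<le> C * K" "\<bar>e' s\<bar> \<le> C * K" if "s \<in> {0..1}" for s
    using gronwall_second_order[OF e(3,4) P _ _ _ that, of K] e by (auto simp: C_def K_def)
  \<comment> \<open>The terms come from u = w + c e with |w| at most C \<gamma>, |c| at most (1 + C)
    \<gamma> and |e| at most C K; the extra 1 secures M >= 1.\<close>
  define M where "M = 1 + C + (1 + C) * (C * K)"
  have M: "1 \<le> M" using C by (simp add: M_def K_def)
  have "\<bar>u s\<bar> \<le> M * \<gamma> \<and> \<bar>v s\<bar> \<le> M * \<gamma>"
    if sol: "is_sol p\<^sub>2 p\<^sub>3 h\<^sub>0 h\<^sub>1 g u v" and h: "\<bar>h\<^sub>0\<bar> \<le> \<gamma>" "\<bar>h\<^sub>1\<bar> \<le> \<gamma>" and g: "\<forall>s\<in>{0..1}. \<bar>g s\<bar> \<le> \<gamma>" and s: "s \<in> {0..1}"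
    for h\<^sub>0 h\<^sub>1 g u v \<gamma> s
  proof -
    define c where "c = v 0 / e' 0"
    define w where "w = (\<lambda>s. - c * e s + u s)"
    define w' where "w' = (\<lambda>s. - c * e' s + v s)"
    have w_sol: "is_sol p\<^sub>2 p\<^sub>3 (- c * 0 + h\<^sub>0) (- c * 1 + h\<^sub>1) (\<lambda>s. - c * 0 + g s) w w'"
      unfolding w_def w'_def by (rule is_sol_linear_combination[OF e_sol sol])
    have w0: "w 0 = h\<^sub>0" "w' 0 = 0" "w 1 = h\<^sub>1 - c" using w_sol e'0 by (auto simp: is_sol_def w'_def c_def)
    have \<gamma>: "0 \<le> \<gamma>" using h by linarith
    have w: "\<bar>w s\<bar> \<le> C * \<gamma>" "\<bar>w' s\<bar> \<le> C * \<gamma>" if "s \<in> {0..1}" for s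
      using gronwall_second_order[of w w' p\<^sub>3 p\<^sub>2 g P \<gamma> s] w_sol P g h w0 \<gamma> that by (auto simp: is_sol_def C_def)
    \<comment> \<open>The initial slope of \<open>u\<close> is unknown, so \<open>c\<close> is
      controlled from the other end: e 1 = 1 gives c = \<open>h\<^sub>1\<close> - w 1.\<close>
    have c: "\<bar>c\<bar> \<le> (1 + C) * \<gamma>" using w(1)[of 1] w0 h by (simp add: algebra_simps)
    have CK: "0 \<le> C * K" using C by (simp add: K_def)
    have "\<bar>c * e s\<bar> \<le> (1 + C) * \<gamma> * (C * K)" "\<bar>c * e' s\<bar> \<le> (1 + C) * \<gamma> * (C * K)"
      unfolding abs_mult using c eK[OF s] C \<gamma> by (auto intro!: mult_mono)
    moreover have "u s = w s + c * e s" "v s = w' s + c * e' s" by (simp_all add: w_def w'_def)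
    ultimately have "\<bar>u s\<bar> \<le> C * \<gamma> + (1 + C) * \<gamma> * (C * K)" "\<bar>v s\<bar> \<le> C * \<gamma> + (1 + C) * \<gamma> * (C * K)"
      using w[OF s] by linarith+
    moreover have "C * \<gamma> + (1 + C) * \<gamma> * (C * K) \<le> M * \<gamma>" using \<gamma> by (simp add: M_def algebra_simps)
    ultimately show ?thesis by linarith
  qed
  then have "stable p\<^sub>2 p\<^sub>3 M" using M unfolding stable_def by blast
  then show ?thesis by (rule that)
qed

text \<open>At a point where max |u| |v| attains its maximum m, the solution-dependent part of the
  source contributes at most M * m / (2 * M) = m/2. Moving this to the left side costs the factor
  2.\<close>

lemma stable_absorb:
  assumes st: "stable p\<^sub>2 p\<^sub>3 M" and sol: "is_sol p\<^sub>2 p\<^sub>3 h\<^sub>0 h\<^sub>1 g u v" and h: "\<bar>h\<^sub>0\<bar> \<le> \<gamma>" "\<bar>h\<^sub>1\<bar> \<le> \<gamma>"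
    and g: "\<And>s. s \<in> {0..1} \<Longrightarrow> \<bar>g s\<bar> \<le> \<gamma> + max \<bar>u s\<bar> \<bar>v s\<bar> / (2 * M)"
    and s: "s \<in> {0..1}"
  shows "\<bar>u s\<bar> \<le> 2 * M * \<gamma>" "\<bar>v s\<bar> \<le> 2 * M * \<gamma>"
proof -
  have M: "1 \<le> M" using st by (simp add: stable_def)
  have "continuous_on {0..1} (\<lambda>s. max \<bar>u s\<bar> \<bar>v s\<bar>)"
    using is_sol_continuous[OF sol] by (intro continuous_intros)
  then obtain t where t: "t \<in> {0..1}" "\<And>s. s \<in> {0..1} \<Longrightarrow> max \<bar>u s\<bar> \<bar>v s\<bar> \<le> max \<bar>u t\<bar> \<bar>v t\<bar>"
    using continuous_attains_sup[of "{0..1::real}" "\<lambda>s. max \<bar>u s\<bar> \<bar>v s\<bar>"] by auto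
  define m where "m = max \<bar>u t\<bar> \<bar>v t\<bar>"
  have m0: "0 \<le> m" by (simp add: m_def)
  have gb: "\<bar>g s\<bar> \<le> \<gamma> + m / (2 * M)" if "s \<in> {0..1}" for s
  proof -
    have "max \<bar>u s\<bar> \<bar>v s\<bar> / (2 * M) \<le> m / (2 * M)"
      using t(2)[OF that] M unfolding m_def by (intro divide_right_mono) auto
    then show ?thesis using g[OF that] by linarith
  qed
  have hb: "\<bar>h\<^sub>0\<bar> \<le> \<gamma> + m / (2 * M)" "\<bar>h\<^sub>1\<bar> \<le> \<gamma> + m / (2 * M)"
    using h m0 M by (auto intro!: add_increasing2)
  have "m \<le> M * (\<gamma> + m / (2 * M))"
    unfolding m_def using stableD[OF st sol hb gb t(1)] unfolding m_def by simp
  also have "\<dots> = M * \<gamma> + m / 2" using M by (simp add: field_simps)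
  finally have "m \<le> 2 * M * \<gamma>" by simp
  then show "\<bar>u s\<bar> \<le> 2 * M * \<gamma>" "\<bar>v s\<bar> \<le> 2 * M * \<gamma>" using t(2)[OF s] unfolding m_def by linarith+
qed

text \<open>The contraction acts on the source f: solve the linear problem with source f, then
  insert the solution into \<open>N\<close>. The linear step has bound M and \<open>N\<close> has
  Lipschitz constant 1/(2 M), which gives the factor 1/2. Working with sources keeps the boundary
  conditions satisfied exactly at every stage.\<close>

lemma perturbed_problem:
  assumes st: "stable p\<^sub>2 p\<^sub>3 M" and solv: "solvable p\<^sub>2 p\<^sub>3"
    and ref: "is_sol p\<^sub>2 p\<^sub>3 k\<^sub>0 k\<^sub>1 g\<^sub>0 c d" and g\<^sub>0: "continuous_on {0..1} g\<^sub>0" and \<delta>: "0 < \<delta>"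
    and N_cont: "\<And>u v. continuous_on {0..1} u \<Longrightarrow> continuous_on {0..1} v \<Longrightarrow>
      (\<forall>s\<in>{0..1}. \<bar>u s - c s\<bar> \<le> 4 * M * \<delta> \<and> \<bar>v s - d s\<bar> \<le> 4 * M * \<delta>) \<Longrightarrow>
      continuous_on {0..1} (\<lambda>s. N s (u s) (v s))"
    and N_lip: "\<And>s a b a' b'. s \<in> {0..1} \<Longrightarrow> \<bar>a - c s\<bar> \<le> 4 * M * \<delta> \<Longrightarrow> \<bar>b - d s\<bar> \<le> 4 * M * \<delta> \<Longrightarrow>
      \<bar>a' - c s\<bar> \<le> 4 * M * \<delta> \<Longrightarrow> \<bar>b' - d s\<bar> \<le> 4 * M * \<delta> \<Longrightarrow>
      \<bar>N s a b - N s a' b'\<bar> \<le> max \<bar>a - a'\<bar> \<bar>b - b'\<bar> / (2 * M)"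
    and N_ref: "\<And>s. s \<in> {0..1} \<Longrightarrow> \<bar>N s (c s) (d s) - g\<^sub>0 s\<bar> \<le> \<delta>"
    and h: "\<bar>h\<^sub>0 - k\<^sub>0\<bar> \<le> \<delta>" "\<bar>h\<^sub>1 - k\<^sub>1\<bar> \<le> \<delta>"
  obtains u v where "is_sol p\<^sub>2 p\<^sub>3 h\<^sub>0 h\<^sub>1 (\<lambda>s. N s (u s) (v s)) u v"
    "\<And>s. s \<in> {0..1} \<Longrightarrow> \<bar>u s - c s\<bar> \<le> 4 * M * \<delta> \<and> \<bar>v s - d s\<bar> \<le> 4 * M * \<delta>"
proof -
  have M: "1 \<le> M" using st by (simp add: stable_def)
  \<comment> \<open>Bounded continuous functions live on the whole line; composing with the
    projection onto the interval embeds functions on the interval without changing their sup norm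
    there.\<close>
  define cl where "cl = (\<lambda>s::real. max 0 (min 1 s))"
  have cl: "cl s \<in> {0..1}" "s \<in> {0..1} \<Longrightarrow> cl s = s" for s by (auto simp: cl_def)
  have cl_cont: "continuous_on UNIV cl" unfolding cl_def by (intro continuous_intros)
  have bc: "(\<lambda>s. f (cl s)) \<in> bcontfun" if f: "continuous_on {0..1} f" for f :: "real \<Rightarrow> real"
  proof -
    obtain C where C: "\<forall>s\<in>{0..1}. \<bar>f s\<bar> \<le> C" using bounded_on_compact[OF f compact_Icc] by auto
    show ?thesis
    proof (rule bcontfun_normI)
      show "continuous_on UNIV (\<lambda>s. f (cl s))"
        using cl(1) by (intro continuous_on_compose2[OF f cl_cont]) auto
      show "norm (f (cl s)) \<le> C" for s using C cl(1) by simp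
    qed
  qed
  define G where "G = Bcontfun (\<lambda>s. g\<^sub>0 (cl s))"
  have G: "apply_bcontfun G s = g\<^sub>0 (cl s)" for s
    unfolding G_def using Bcontfun_inverse[OF bc[OF g\<^sub>0]] by simp
  \<comment> \<open>A source in this ball has its solution within 4 M \<delta> of (c, d). Inserting
    it into \<open>N\<close> errs by \<delta> at the reference and by at most 4 M \<delta> / (2 M) =
    2 \<delta> from the displacement, so the ball is mapped into itself.\<close>
  define S where "S = cball G (4 * \<delta>)"
  have "\<forall>f :: real \<Rightarrow>\<^sub>C real. \<exists>p. is_sol p\<^sub>2 p\<^sub>3 h\<^sub>0 h\<^sub>1 (apply_bcontfun f) (fst p) (snd p)"
  proof
    fix f :: "real \<Rightarrow>\<^sub>C real"
    have "continuous_on {0..1} (apply_bcontfun f)" using continuous_on_apply_bcontfun continuous_on_subset by blast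
    then obtain u v where "is_sol p\<^sub>2 p\<^sub>3 h\<^sub>0 h\<^sub>1 (apply_bcontfun f) u v" using solv unfolding solvable_def by blast
    then show "\<exists>p. is_sol p\<^sub>2 p\<^sub>3 h\<^sub>0 h\<^sub>1 (apply_bcontfun f) (fst p) (snd p)" by (intro exI[of _ "(u, v)"]) simp
  qed
  from choice[OF this] obtain U where U: "\<And>f. is_sol p\<^sub>2 p\<^sub>3 h\<^sub>0 h\<^sub>1 (apply_bcontfun f) (fst (U f)) (snd (U f))" by blast
  define u where "u = (\<lambda>f. fst (U f))"
  define v where "v = (\<lambda>f. snd (U f))"
  have sol: "is_sol p\<^sub>2 p\<^sub>3 h\<^sub>0 h\<^sub>1 (apply_bcontfun f) (u f) (v f)" for f using U by (simp add: u_def v_def)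
  have tube: "\<bar>u f s - c s\<bar> \<le> 4 * M * \<delta>" "\<bar>v f s - d s\<bar> \<le> 4 * M * \<delta>" if f: "f \<in> S" and s: "s \<in> {0..1}" for f s
  proof -
    have b: "\<bar>apply_bcontfun f s - g\<^sub>0 s\<bar> \<le> 4 * \<delta>" if "s \<in> {0..1}" for s
      using dist_bounded[of f s G] f that cl by (simp add: S_def G dist_commute dist_real_def)
    have "\<bar>h\<^sub>0 - k\<^sub>0\<bar> \<le> 4 * \<delta>" "\<bar>h\<^sub>1 - k\<^sub>1\<bar> \<le> 4 * \<delta>" using h \<delta> by linarith+
    from stableD[OF st is_sol_diff[OF sol ref] this b s]
    show "\<bar>u f s - c s\<bar> \<le> 4 * M * \<delta>" "\<bar>v f s - d s\<bar> \<le> 4 * M * \<delta>" by (simp_all add: mult_ac)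
  qed
  define T where "T = (\<lambda>f. Bcontfun (\<lambda>s. N (cl s) (u f (cl s)) (v f (cl s))))"
  have T: "apply_bcontfun (T f) s = N (cl s) (u f (cl s)) (v f (cl s))" if "f \<in> S" for f s
  proof -
    have "continuous_on {0..1} (\<lambda>s. N s (u f s) (v f s))"
      using tube[OF that] is_sol_continuous[OF sol] by (intro N_cont) auto
    from Bcontfun_inverse[OF bc[OF this]] show ?thesis by (simp add: T_def)
  qed
  have "\<exists>!f\<in>S. T f = f"
  proof (rule Banach_fix)
    show "complete S" by (simp add: S_def complete_eq_closed)
    show "S \<noteq> {}" using \<delta> by (simp add: S_def)
    show "(0::real) \<le> 1/2" "(1/2::real) < 1" by simp_all
    show "T ` S \<subseteq> S"
    proof
      fix f' assume "f' \<in> T ` S"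
      then obtain f where f: "f \<in> S" "f' = T f" by blast
      have "dist (T f) G \<le> 4 * \<delta>"
      proof (rule dist_bound)
        fix s
        have "\<bar>N (cl s) (u f (cl s)) (v f (cl s)) - N (cl s) (c (cl s)) (d (cl s))\<bar>
            \<le> max \<bar>u f (cl s) - c (cl s)\<bar> \<bar>v f (cl s) - d (cl s)\<bar> / (2 * M)"
          using tube[OF f(1) cl(1)] M \<delta> by (intro N_lip[OF cl(1)]) auto
        also have "\<dots> \<le> (4 * M * \<delta>) / (2 * M)"
          using tube[OF f(1) cl(1)] M by (intro divide_right_mono) auto
        also have "\<dots> = 2 * \<delta>" using M by simp
        finally show "dist (apply_bcontfun (T f) s) (apply_bcontfun G s) \<le> 4 * \<delta>"
          using N_ref[OF cl(1)[of s]] \<delta> unfolding T[OF f(1)] G dist_real_def by linarith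
      qed
      then show "f' \<in> S" using f by (simp add: S_def dist_commute)
    qed
    fix f f' assume f: "f \<in> S" "f' \<in> S"
    show "dist (T f) (T f') \<le> 1/2 * dist f f'"
    proof (rule dist_bound)
      fix s
      have b: "\<bar>apply_bcontfun f s - apply_bcontfun f' s\<bar> \<le> dist f f'" for s
        using dist_bounded[of f s f'] by (simp add: dist_real_def)
      have m: "\<bar>u f (cl s) - u f' (cl s)\<bar> \<le> M * dist f f'" "\<bar>v f (cl s) - v f' (cl s)\<bar> \<le> M * dist f f'"
        using stableD[OF st is_sol_diff[OF sol sol] _ _ b cl(1)] by simp_all
      have "\<bar>N (cl s) (u f (cl s)) (v f (cl s)) - N (cl s) (u f' (cl s)) (v f' (cl s))\<bar>
          \<le> max \<bar>u f (cl s) - u f' (cl s)\<bar> \<bar>v f (cl s) - v f' (cl s)\<bar> / (2 * M)"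
        using tube[OF f(1) cl(1)] tube[OF f(2) cl(1)] by (intro N_lip[OF cl(1)]) auto
      also have "\<dots> \<le> (M * dist f f') / (2 * M)" using m M by (intro divide_right_mono) auto
      also have "\<dots> = 1/2 * dist f f'" using M by simp
      finally show "dist (apply_bcontfun (T f) s) (apply_bcontfun (T f') s) \<le> 1/2 * dist f f'"
        by (simp add: T[OF f(1)] T[OF f(2)] dist_real_def)
    qed
  qed
  then obtain f where f: "f \<in> S" "T f = f" by blast
  have "apply_bcontfun f s = N s (u f s) (v f s)" if "s \<in> {0..1}" for s
    using T[OF f(1), of s] f(2) cl(2)[OF that] by simp
  then have "is_sol p\<^sub>2 p\<^sub>3 h\<^sub>0 h\<^sub>1 (\<lambda>s. N s (u f s) (v f s)) (u f) (v f)"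
    by (intro is_sol_change[OF sol]) simp
  then show ?thesis using that tube[OF f(1)] by blast
qed

text \<open>The change of coefficients is moved to the source. Its two terms have factors 1/(4 M)
  each and together just meet the hypothesis of \<open>stable_absorb\<close>.\<close>

lemma perturbed_stable:
  assumes st: "stable p\<^sub>2 p\<^sub>3 M"
    and \<kappa>: "\<And>s. s \<in> {0..1} \<Longrightarrow> \<bar>q\<^sub>2 s - p\<^sub>2 s\<bar> \<le> 1 / (4 * M) \<and> \<bar>q\<^sub>3 s - p\<^sub>3 s\<bar> \<le> 1 / (4 * M)"
  shows "stable q\<^sub>2 q\<^sub>3 (2 * M)"
  unfolding stable_def
proof (intro conjI allI impI ballI)
  have M: "1 \<le> M" using st by (simp add: stable_def)
  then show "1 \<le> 2 * M" by simp
  fix h\<^sub>0 h\<^sub>1 g u v \<gamma>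
  assume sol: "is_sol q\<^sub>2 q\<^sub>3 h\<^sub>0 h\<^sub>1 g u v" and h: "\<bar>h\<^sub>0\<bar> \<le> \<gamma>" "\<bar>h\<^sub>1\<bar> \<le> \<gamma>" and g: "\<forall>s\<in>{0..1}. \<bar>g s\<bar> \<le> \<gamma>"
  let ?g = "\<lambda>s. g s + (q\<^sub>3 s - p\<^sub>3 s) * v s + (q\<^sub>2 s - p\<^sub>2 s) * u s"
  have sol': "is_sol p\<^sub>2 p\<^sub>3 h\<^sub>0 h\<^sub>1 ?g u v"
    by (rule is_sol_change[OF sol]) (simp add: algebra_simps)
  have gb: "\<bar>?g s\<bar> \<le> \<gamma> + max \<bar>u s\<bar> \<bar>v s\<bar> / (2 * M)" if s: "s \<in> {0..1}" for s
  proof -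
    have "\<bar>(q\<^sub>3 s - p\<^sub>3 s) * v s\<bar> \<le> 1 / (4 * M) * max \<bar>u s\<bar> \<bar>v s\<bar>"
      unfolding abs_mult using \<kappa>[OF s] M by (intro mult_mono) auto
    moreover have "\<bar>(q\<^sub>2 s - p\<^sub>2 s) * u s\<bar> \<le> 1 / (4 * M) * max \<bar>u s\<bar> \<bar>v s\<bar>"
      unfolding abs_mult using \<kappa>[OF s] M by (intro mult_mono) auto
    moreover have "max \<bar>u s\<bar> \<bar>v s\<bar> / (2 * M) = 1 / (4 * M) * max \<bar>u s\<bar> \<bar>v s\<bar> + 1 / (4 * M) * max \<bar>u s\<bar> \<bar>v s\<bar>"
      using M by (simp add: field_simps)
    moreover have "\<bar>g s\<bar> \<le> \<gamma>" using g s by blast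
    ultimately show ?thesis by linarith
  qed
  fix s :: real assume s: "s \<in> {0..1}"
  from stable_absorb[OF st sol' h gb s] show "\<bar>u s\<bar> \<le> 2 * M * \<gamma>" "\<bar>v s\<bar> \<le> 2 * M * \<gamma>" by simp_all
qed

text \<open>An instance of \<open>perturbed_problem\<close> with the zero solution as reference.
  Here \<open>N\<close> is affine with the required Lipschitz constant everywhere, so \<delta> may
  be as large as the data demand.\<close>

lemma perturbed_solvable:
  assumes st: "stable p\<^sub>2 p\<^sub>3 M" and solv: "solvable p\<^sub>2 p\<^sub>3"
    and cont: "continuous_on {0..1} p\<^sub>2" "continuous_on {0..1} p\<^sub>3" "continuous_on {0..1} q\<^sub>2" "continuous_on {0..1} q\<^sub>3"
    and \<kappa>: "\<And>s. s \<in> {0..1} \<Longrightarrow> \<bar>q\<^sub>2 s - p\<^sub>2 s\<bar> \<le> 1 / (4 * M) \<and> \<bar>q\<^sub>3 s - p\<^sub>3 s\<bar> \<le> 1 / (4 * M)"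
  shows "solvable q\<^sub>2 q\<^sub>3"
  unfolding solvable_def
proof (intro allI impI)
  fix h\<^sub>0 h\<^sub>1 and g :: "real \<Rightarrow> real" assume g: "continuous_on {0..1} g"
  have M: "1 \<le> M" using st by (simp add: stable_def)
  obtain C where C: "\<forall>s\<in>{0..1}. \<bar>g s\<bar> \<le> C" using bounded_on_compact[OF g compact_Icc] by auto
  define \<delta> where "\<delta> = max 1 (max C (max \<bar>h\<^sub>0\<bar> \<bar>h\<^sub>1\<bar>))"
  have \<delta>: "0 < \<delta>" "C \<le> \<delta>" "\<bar>h\<^sub>0\<bar> \<le> \<delta>" "\<bar>h\<^sub>1\<bar> \<le> \<delta>" by (auto simp: \<delta>_def le_max_iff_disj)
  define N where "N = (\<lambda>s a b. g s + (q\<^sub>3 s - p\<^sub>3 s) * b + (q\<^sub>2 s - p\<^sub>2 s) * a)"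
  obtain u v where uv: "is_sol p\<^sub>2 p\<^sub>3 h\<^sub>0 h\<^sub>1 (\<lambda>s. N s (u s) (v s)) u v"
  proof (rule perturbed_problem[OF st solv _ _ \<delta>(1), of 0 0 "\<lambda>_. 0" "\<lambda>_. 0" "\<lambda>_. 0" N h\<^sub>0 h\<^sub>1])
    show "is_sol p\<^sub>2 p\<^sub>3 0 0 (\<lambda>_. 0) (\<lambda>_. 0) (\<lambda>_. 0)" by (simp add: is_sol_def)
    show "continuous_on {0..1} (\<lambda>s. N s (u s) (v s))" if "continuous_on {0..1} u" "continuous_on {0..1} v" for u v
      unfolding N_def using that cont g by (intro continuous_intros)
    show "\<bar>N s a b - N s a' b'\<bar> \<le> max \<bar>a - a'\<bar> \<bar>b - b'\<bar> / (2 * M)" if s: "s \<in> {0..1}" for s a b a' b'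
    proof -
      have "N s a b - N s a' b' = (q\<^sub>3 s - p\<^sub>3 s) * (b - b') + (q\<^sub>2 s - p\<^sub>2 s) * (a - a')"
        by (simp add: N_def algebra_simps)
      moreover have "\<bar>(q\<^sub>3 s - p\<^sub>3 s) * (b - b')\<bar> \<le> 1 / (4 * M) * max \<bar>a - a'\<bar> \<bar>b - b'\<bar>"
        unfolding abs_mult using \<kappa>[OF s] M by (intro mult_mono) auto
      moreover have "\<bar>(q\<^sub>2 s - p\<^sub>2 s) * (a - a')\<bar> \<le> 1 / (4 * M) * max \<bar>a - a'\<bar> \<bar>b - b'\<bar>"
        unfolding abs_mult using \<kappa>[OF s] M by (intro mult_mono) auto
      moreover have "max \<bar>a - a'\<bar> \<bar>b - b'\<bar> / (2 * M) = 1 / (4 * M) * max \<bar>a - a'\<bar> \<bar>b - b'\<bar> + 1 / (4 * M) * max \<bar>a - a'\<bar> \<bar>b - b'\<bar>"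
        using M by (simp add: field_simps)
      ultimately show ?thesis by linarith
    qed
    show "\<bar>N s 0 0 - 0\<bar> \<le> \<delta>" if "s \<in> {0..1}" for s using C \<delta> that by (force simp: N_def)
  qed (use \<delta> in auto)
  then have "is_sol q\<^sub>2 q\<^sub>3 h\<^sub>0 h\<^sub>1 g u v"
    by (intro is_sol_change[OF uv]) (simp add: N_def algebra_simps)
  then show "\<exists>u v. is_sol q\<^sub>2 q\<^sub>3 h\<^sub>0 h\<^sub>1 g u v" by blast
qed

text \<open>Regularity is stated with right-hand sides v'' for v in \<open>F0\<close>. Integrating
  twice and subtracting the linear function s * G2 1 shows that these are all continuous
  functions.\<close>

lemma second_antiderivative:
  assumes g: "continuous_on {0..1} g"
  obtains v where "v \<in> F0" "\<And>s. s \<in> {0..1} \<Longrightarrow> ideriv 2 v s = g s"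
proof -
  define G1 where "G1 = (\<lambda>s. integral {0..s} g)"
  define G2 where "G2 = (\<lambda>s. integral {0..s} G1)"
  have G1: "(G1 has_real_derivative g s) (at s within {0..1})" if "s \<in> {0..1}" for s
    unfolding G1_def by (rule integral_has_real_derivative[OF g that])
  then have G1c: "continuous_on {0..1} G1"
    unfolding continuous_on_eq_continuous_within by (meson DERIV_continuous)
  have G2: "(G2 has_real_derivative G1 s) (at s within {0..1})" if "s \<in> {0..1}" for s
    unfolding G2_def by (rule integral_has_real_derivative[OF G1c that])
  define D where "D = (\<lambda>k::nat. if k = 0 then (\<lambda>s. G2 s - s * G2 1) else if k = 1 then (\<lambda>s. G1 s - G2 1) else g)"
  define v where "v = (\<lambda>s. if s \<in> {0..1} then G2 s - s * G2 1 else 0)"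
  have 1: "v s = 0" if "s \<notin> {0..1}" for s using that by (auto simp: v_def)
  have 2: "D 0 s = v s" if "s \<in> {0..1}" for s using that by (simp add: v_def D_def)
  have 3: "(D k has_real_derivative D (Suc k) s) (at s within {0..1})" if k: "enat k < 2" and s: "s \<in> {0..1}" for k s
  proof -
    have "k = 0 \<or> k = 1" using k by (cases k) (auto simp: numeral_eq_enat)
    then show ?thesis
      using G1[OF s] G2[OF s] unfolding D_def by (auto intro!: derivative_eq_intros)
  qed
  have 4: "continuous_on {0..1} (D k)" if "enat k \<le> 2" for k
  proof -
    have "continuous_on {0..1} G2"
      unfolding continuous_on_eq_continuous_within using G2 by (meson DERIV_continuous)
    then show ?thesis unfolding D_def using G1c g by (auto intro!: continuous_intros)
  qed
  have "v \<in> CI 2" by (rule CI_memI(1)[OF 1 2 3 4])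
  moreover have "v 0 = 0" "v 1 = 0" by (simp_all add: v_def G2_def)
  moreover have "ideriv 2 v s = g s" if "s \<in> {0..1}" for s
  proof -
    have "ideriv 2 v s = D 2 s" by (rule CI_memI(2)[where i = 2 and d = D, OF 1 2 3 4]) (use that in \<open>simp_all add: numeral_eq_enat\<close>)
    then show ?thesis by (simp add: D_def)
  qed
  ultimately show ?thesis using that by (simp add: F0_def)
qed

lemma CI_2_deriv:
  assumes "u \<in> CI 2" "s \<in> {0..1}"
  shows "(u has_real_derivative ideriv 1 u s) (at s within {0..1})"
    "(ideriv 1 u has_real_derivative ideriv 2 u s) (at s within {0..1})"
proof -
  have k: "enat 0 < 2" "enat 1 < 2"
    unfolding zero_enat_def[symmetric] one_enat_def[symmetric] by simp_all
  show "(u has_real_derivative ideriv 1 u s) (at s within {0..1})"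
    using CI_deriv[OF assms(1) k(1) assms(2)] by simp
  show "(ideriv 1 u has_real_derivative ideriv 2 u s) (at s within {0..1})"
    using CI_deriv[OF assms(1) k(2) assms(2)] by (simp add: numeral_2_eq_2)
qed

text \<open>The linear interpolation of the boundary values is split off. Its second derivative
  vanishes, so it changes the source only by its lower-order terms, and the rest satisfies zero
  boundary conditions.\<close>

lemma solvable_if_dirichlet:
  assumes cont: "continuous_on {0..1} p\<^sub>2" "continuous_on {0..1} p\<^sub>3"
    and ex: "\<forall>v\<in>F0. \<exists>u\<in>F0. \<forall>s\<in>{0..1}. ideriv 2 u s - p\<^sub>3 s * ideriv 1 u s - p\<^sub>2 s * u s = ideriv 2 v s"
  shows "solvable p\<^sub>2 p\<^sub>3"
  unfolding solvable_def
proof (intro allI impI)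
  fix h\<^sub>0 h\<^sub>1 and g :: "real \<Rightarrow> real" assume g: "continuous_on {0..1} g"
  have "continuous_on {0..1} (\<lambda>s. g s + p\<^sub>3 s * (h\<^sub>1 - h\<^sub>0) + p\<^sub>2 s * (h\<^sub>0 + (h\<^sub>1 - h\<^sub>0) * s))"
    using cont g by (intro continuous_intros)
  then obtain v where v: "v \<in> F0"
    "\<And>s. s \<in> {0..1} \<Longrightarrow> ideriv 2 v s = g s + p\<^sub>3 s * (h\<^sub>1 - h\<^sub>0) + p\<^sub>2 s * (h\<^sub>0 + (h\<^sub>1 - h\<^sub>0) * s)"
    by (rule second_antiderivative) (rule that)
  then obtain w where w: "w \<in> F0"
    "\<And>s. s \<in> {0..1} \<Longrightarrow> ideriv 2 w s - p\<^sub>3 s * ideriv 1 w s - p\<^sub>2 s * w s = ideriv 2 v s" using ex by blast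
  have w': "w \<in> CI 2" "w 0 = 0" "w 1 = 0" using w(1) by (simp_all add: F0_def)
  have "is_sol p\<^sub>2 p\<^sub>3 h\<^sub>0 h\<^sub>1 g (\<lambda>s. h\<^sub>0 + (h\<^sub>1 - h\<^sub>0) * s + w s) (\<lambda>s. (h\<^sub>1 - h\<^sub>0) + ideriv 1 w s)"
    unfolding is_sol_def
  proof (intro conjI ballI)
    fix s :: real assume s: "s \<in> {0..1}"
    show "((\<lambda>s. h\<^sub>0 + (h\<^sub>1 - h\<^sub>0) * s + w s) has_real_derivative (h\<^sub>1 - h\<^sub>0) + ideriv 1 w s) (at s within {0..1})"
      using CI_2_deriv(1)[OF w'(1) s] by (auto intro!: derivative_eq_intros)
    have "((\<lambda>s. (h\<^sub>1 - h\<^sub>0) + ideriv 1 w s) has_real_derivative ideriv 2 w s) (at s within {0..1})"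
      using CI_2_deriv(2)[OF w'(1) s] by (auto intro!: derivative_eq_intros)
    moreover have "ideriv 2 w s = p\<^sub>3 s * ((h\<^sub>1 - h\<^sub>0) + ideriv 1 w s) + p\<^sub>2 s * (h\<^sub>0 + (h\<^sub>1 - h\<^sub>0) * s + w s) + g s"
      using v(2)[OF s] w(2)[OF s] by (simp add: algebra_simps)
    ultimately show "((\<lambda>s. (h\<^sub>1 - h\<^sub>0) + ideriv 1 w s) has_real_derivative
      p\<^sub>3 s * ((h\<^sub>1 - h\<^sub>0) + ideriv 1 w s) + p\<^sub>2 s * (h\<^sub>0 + (h\<^sub>1 - h\<^sub>0) * s + w s) + g s) (at s within {0..1})"
      by (simp only:)
  qed (simp_all add: w')
  then show "\<exists>u v. is_sol p\<^sub>2 p\<^sub>3 h\<^sub>0 h\<^sub>1 g u v" by blast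
qed

subsection \<open>Uniform convergence on the interval along a filter\<close>

text \<open>The comparison family \<open>b\<close> may vary with the index: later the limit is taken
  while the directions, on which both sides depend, range over a bounded set.\<close>

definition unif_lim :: "('i \<Rightarrow> real \<Rightarrow> real) \<Rightarrow> ('i \<Rightarrow> real \<Rightarrow> real) \<Rightarrow> 'i filter \<Rightarrow> bool" where
  "unif_lim a b F \<longleftrightarrow> (\<forall>\<epsilon>>0. \<forall>\<^sub>F i in F. \<forall>s\<in>{0..1}. \<bar>a i s - b i s\<bar> < \<epsilon>)"

definition unif_bdd :: "('i \<Rightarrow> real \<Rightarrow> real) \<Rightarrow> 'i filter \<Rightarrow> bool" where
  "unif_bdd a F \<longleftrightarrow> (\<exists>C. \<forall>\<^sub>F i in F. \<forall>s\<in>{0..1}. \<bar>a i s\<bar> \<le> C)"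

lemma unif_limD: "unif_lim a b F \<Longrightarrow> 0 < \<epsilon> \<Longrightarrow> \<forall>\<^sub>F i in F. \<forall>s\<in>{0..1}. \<bar>a i s - b i s\<bar> < \<epsilon>"
  by (simp add: unif_lim_def)

lemma unif_bddD:
  assumes "unif_bdd a F" shows "\<exists>C>0. \<forall>\<^sub>F i in F. \<forall>s\<in>{0..1}. \<bar>a i s\<bar> \<le> C"
proof -
  obtain C where C: "\<forall>\<^sub>F i in F. \<forall>s\<in>{0..1}. \<bar>a i s\<bar> \<le> C" using assms by (auto simp: unif_bdd_def)
  have "\<forall>\<^sub>F i in F. \<forall>s\<in>{0..1}. \<bar>a i s\<bar> \<le> max 1 C"
    using C by eventually_elim (auto simp: le_max_iff_disj)
  then show ?thesis by (intro exI[of _ "max 1 C"]) simp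
qed

lemma unif_lim_refl: "unif_lim a a F"
  by (simp add: unif_lim_def)

lemma unif_lim_cong:
  assumes "unif_lim a b F" "\<forall>\<^sub>F i in F. \<forall>s\<in>{0..1}. a' i s - b' i s = a i s - b i s"
  shows "unif_lim a' b' F"
  unfolding unif_lim_def
proof (intro allI impI)
  fix \<epsilon> :: real assume "0 < \<epsilon>"
  from unif_limD[OF assms(1) this] assms(2) show "\<forall>\<^sub>F i in F. \<forall>s\<in>{0..1}. \<bar>a' i s - b' i s\<bar> < \<epsilon>"
    by eventually_elim simp
qed

lemma unif_bdd_continuous: "continuous_on {0..1} f \<Longrightarrow> unif_bdd (\<lambda>_. f) F"
proof -
  assume "continuous_on {0..1} f"
  from bounded_on_compact[OF this compact_Icc] obtain C where "\<forall>s\<in>{0..1}. \<bar>f s\<bar> \<le> C" ..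
  then show ?thesis unfolding unif_bdd_def by (intro exI[of _ C]) simp
qed

lemma unif_lim_bdd:
  assumes "unif_lim a b F" "unif_bdd b F" shows "unif_bdd a F"
proof -
  obtain C where C: "\<forall>\<^sub>F i in F. \<forall>s\<in>{0..1}. \<bar>b i s\<bar> \<le> C" using assms by (auto simp: unif_bdd_def)
  have "\<forall>\<^sub>F i in F. \<forall>s\<in>{0..1}. \<bar>a i s - b i s\<bar> < 1" using unif_limD[OF assms(1)] by simp
  with C have "\<forall>\<^sub>F i in F. \<forall>s\<in>{0..1}. \<bar>a i s\<bar> \<le> C + 1"
  proof eventually_elim
    case (elim i)
    show ?case
    proof
      fix s :: real assume "s \<in> {0..1}"
      then have "\<bar>b i s\<bar> \<le> C" "\<bar>a i s - b i s\<bar> < 1" using elim by blast+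
      then show "\<bar>a i s\<bar> \<le> C + 1" by linarith
    qed
  qed
  then show ?thesis by (auto simp: unif_bdd_def)
qed

lemma unif_bdd_add:
  assumes "unif_bdd a F" "unif_bdd b F" shows "unif_bdd (\<lambda>i s. a i s + b i s) F"
proof -
  obtain A where A: "\<forall>\<^sub>F i in F. \<forall>s\<in>{0..1}. \<bar>a i s\<bar> \<le> A" using unif_bddD[OF assms(1)] by blast
  obtain B where B: "\<forall>\<^sub>F i in F. \<forall>s\<in>{0..1}. \<bar>b i s\<bar> \<le> B" using unif_bddD[OF assms(2)] by blast
  from A B have "\<forall>\<^sub>F i in F. \<forall>s\<in>{0..1}. \<bar>a i s + b i s\<bar> \<le> A + B"
    by eventually_elim (meson abs_triangle_ineq add_mono order_trans)
  then show ?thesis by (auto simp: unif_bdd_def)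
qed

lemma unif_bdd_mult:
  assumes "unif_bdd a F" "unif_bdd b F" shows "unif_bdd (\<lambda>i s. a i s * b i s) F"
proof -
  obtain A where A: "0 < A" "\<forall>\<^sub>F i in F. \<forall>s\<in>{0..1}. \<bar>a i s\<bar> \<le> A" using unif_bddD[OF assms(1)] by blast
  obtain B where B: "0 < B" "\<forall>\<^sub>F i in F. \<forall>s\<in>{0..1}. \<bar>b i s\<bar> \<le> B" using unif_bddD[OF assms(2)] by blast
  from A(2) B(2) have "\<forall>\<^sub>F i in F. \<forall>s\<in>{0..1}. \<bar>a i s * b i s\<bar> \<le> A * B"
    by eventually_elim (use A(1) in \<open>auto simp: abs_mult intro!: mult_mono\<close>)
  then show ?thesis by (auto simp: unif_bdd_def)
qed

lemma unif_lim_add: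
  assumes "unif_lim a a' F" "unif_lim b b' F"
  shows "unif_lim (\<lambda>i s. a i s + b i s) (\<lambda>i s. a' i s + b' i s) F"
  unfolding unif_lim_def
proof (intro allI impI)
  fix \<epsilon> :: real assume e: "0 < \<epsilon>"
  have "\<forall>\<^sub>F i in F. \<forall>s\<in>{0..1}. \<bar>a i s - a' i s\<bar> < \<epsilon>/2" "\<forall>\<^sub>F i in F. \<forall>s\<in>{0..1}. \<bar>b i s - b' i s\<bar> < \<epsilon>/2"
    using unif_limD[OF assms(1), of "\<epsilon>/2"] unif_limD[OF assms(2), of "\<epsilon>/2"] e by simp_all
  then show "\<forall>\<^sub>F i in F. \<forall>s\<in>{0..1}. \<bar>a i s + b i s - (a' i s + b' i s)\<bar> < \<epsilon>"
  proof eventually_elim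
    case (elim i)
    show ?case
    proof
      fix s :: real assume "s \<in> {0..1}"
      then have "\<bar>a i s - a' i s\<bar> < \<epsilon>/2" "\<bar>b i s - b' i s\<bar> < \<epsilon>/2" using elim by blast+
      then show "\<bar>a i s + b i s - (a' i s + b' i s)\<bar> < \<epsilon>" by linarith
    qed
  qed
qed

lemma unif_lim_zero_mult:
  assumes "unif_lim a (\<lambda>_ _. 0) F" "unif_bdd b F"
  shows "unif_lim (\<lambda>i s. a i s * b i s) (\<lambda>_ _. 0) F"
  unfolding unif_lim_def
proof (intro allI impI)
  fix \<epsilon> :: real assume e: "0 < \<epsilon>"
  obtain B where B: "0 < B" "\<forall>\<^sub>F i in F. \<forall>s\<in>{0..1}. \<bar>b i s\<bar> \<le> B" using unif_bddD[OF assms(2)] by blast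
  have "\<forall>\<^sub>F i in F. \<forall>s\<in>{0..1}. \<bar>a i s - 0\<bar> < \<epsilon> / B" using unif_limD[OF assms(1)] e B(1) by simp
  with B(2) show "\<forall>\<^sub>F i in F. \<forall>s\<in>{0..1}. \<bar>a i s * b i s - 0\<bar> < \<epsilon>"
  proof eventually_elim
    case (elim i)
    show ?case
    proof
      fix s :: real assume "s \<in> {0..1}"
      then have 1: "\<bar>b i s\<bar> \<le> B" "\<bar>a i s\<bar> < \<epsilon> / B" using elim by auto
      have "\<bar>a i s * b i s\<bar> \<le> \<bar>a i s\<bar> * B" unfolding abs_mult using 1 by (intro mult_left_mono) auto
      also have "\<dots> < \<epsilon>" using 1(2) B(1) by (simp add: pos_less_divide_eq)
      finally show "\<bar>a i s * b i s - 0\<bar> < \<epsilon>" by simp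
    qed
  qed
qed

lemma unif_lim_iff_diff: "unif_lim a b F \<longleftrightarrow> unif_lim (\<lambda>i s. a i s - b i s) (\<lambda>_ _. 0) F"
  by (simp add: unif_lim_def)

lemma unif_lim_mult:
  assumes "unif_lim a a' F" "unif_lim b b' F" "unif_bdd a' F" "unif_bdd b' F"
  shows "unif_lim (\<lambda>i s. a i s * b i s) (\<lambda>i s. a' i s * b' i s) F"
proof -
  have "unif_lim (\<lambda>i s. (a i s - a' i s) * b i s + (b i s - b' i s) * a' i s) (\<lambda>i s. 0 + 0) F"
    using assms unif_lim_bdd[OF assms(2,4)]
    by (intro unif_lim_add unif_lim_zero_mult) (simp_all add: unif_lim_iff_diff[symmetric])
  then show ?thesis by (rule unif_lim_cong) (simp add: algebra_simps)
qed

text \<open>Written with the coefficients \<open>P\<^sub>2\<close>, \<open>P\<^sub>3\<close>, the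
  difference of the two solutions has a source made of g' - g and the coefficient differences times
  (u, v). Boundedness of (u, v) makes this tend to zero, and the common constant M transfers it to
  the solutions.\<close>

lemma unif_lim_solution:
  assumes st: "\<forall>\<^sub>F i in F. stable (P\<^sub>2 i) (P\<^sub>3 i) M"
    and sol': "\<forall>\<^sub>F i in F. is_sol (P\<^sub>2 i) (P\<^sub>3 i) (h\<^sub>0' i) (h\<^sub>1' i) (g' i) (u' i) (v' i)"
    and sol: "\<forall>\<^sub>F i in F. is_sol (Q\<^sub>2 i) (Q\<^sub>3 i) (h\<^sub>0 i) (h\<^sub>1 i) (g i) (u i) (v i)"
    and P: "unif_lim P\<^sub>2 Q\<^sub>2 F" "unif_lim P\<^sub>3 Q\<^sub>3 F" and g: "unif_lim g' g F"
    and h: "unif_lim (\<lambda>i _. h\<^sub>0' i) (\<lambda>i _. h\<^sub>0 i) F" "unif_lim (\<lambda>i _. h\<^sub>1' i) (\<lambda>i _. h\<^sub>1 i) F"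
    and bdd: "unif_bdd u F" "unif_bdd v F"
  shows "unif_lim u' u F" "unif_lim v' v F"
proof -
  let ?G = "\<lambda>i s. (g' i s - g i s) + ((P\<^sub>3 i s - Q\<^sub>3 i s) * v i s + (P\<^sub>2 i s - Q\<^sub>2 i s) * u i s)"
  have "unif_lim ?G (\<lambda>_ _. 0 + (0 + 0)) F"
    using P g bdd by (intro unif_lim_add unif_lim_zero_mult) (simp_all add: unif_lim_iff_diff[symmetric])
  then have G: "unif_lim ?G (\<lambda>_ _. 0) F" by simp
  have "\<forall>\<^sub>F i in F. \<forall>s\<in>{0..1}. \<bar>u' i s - u i s\<bar> < \<epsilon> \<and> \<bar>v' i s - v i s\<bar> < \<epsilon>" if e: "0 < \<epsilon>" for \<epsilon>
  proof (cases "F = bot")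
    case False
    have M: "1 \<le> M"
      using eventually_happens'[OF False st] by (auto simp: stable_def)
    define \<eta> where "\<eta> = \<epsilon> / (2 * M)"
    have \<eta>: "0 < \<eta>" "M * \<eta> < \<epsilon>" using e M by (auto simp: \<eta>_def)
    from st sol' sol unif_limD[OF G \<eta>(1)] unif_limD[OF h(1) \<eta>(1)] unif_limD[OF h(2) \<eta>(1)]
    show ?thesis
    proof eventually_elim
      case (elim i)
      have "is_sol (P\<^sub>2 i) (P\<^sub>3 i) (h\<^sub>0 i) (h\<^sub>1 i)
          (\<lambda>s. g i s - ((P\<^sub>3 i s - Q\<^sub>3 i s) * v i s + (P\<^sub>2 i s - Q\<^sub>2 i s) * u i s)) (u i) (v i)"
        by (rule is_sol_change[OF elim(3)]) (simp add: algebra_simps)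
      from is_sol_diff[OF elim(2) this]
      have d: "is_sol (P\<^sub>2 i) (P\<^sub>3 i) (h\<^sub>0' i - h\<^sub>0 i) (h\<^sub>1' i - h\<^sub>1 i) (?G i)
          (\<lambda>s. u' i s - u i s) (\<lambda>s. v' i s - v i s)"
        by (rule is_sol_change) simp
      have b: "\<bar>h\<^sub>0' i - h\<^sub>0 i\<bar> \<le> \<eta>" "\<bar>h\<^sub>1' i - h\<^sub>1 i\<bar> \<le> \<eta>" "\<And>s. s \<in> {0..1} \<Longrightarrow> \<bar>?G i s\<bar> \<le> \<eta>"
        using elim(4-6) by (auto simp: less_imp_le)
      show ?case
      proof
        fix s :: real assume s: "s \<in> {0..1}"
        show "\<bar>u' i s - u i s\<bar> < \<epsilon> \<and> \<bar>v' i s - v i s\<bar> < \<epsilon>"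
          using stableD[OF elim(1) d b s] \<eta>(2) by linarith
      qed
    qed
  qed simp
  then have *: "\<forall>\<^sub>F i in F. \<forall>s\<in>{0..1}. \<bar>u' i s - u i s\<bar> < \<epsilon> \<and> \<bar>v' i s - v i s\<bar> < \<epsilon>" if "0 < \<epsilon>" for \<epsilon>
    using that by blast
  show "unif_lim u' u F" "unif_lim v' v F"
    unfolding unif_lim_def by (intro allI impI, rule eventually_mono[OF *]; blast)+
qed

lemma unif_bdd_solution:
  assumes sol: "\<forall>\<^sub>F i in F. stable (Q\<^sub>2 i) (Q\<^sub>3 i) M \<and> is_sol (Q\<^sub>2 i) (Q\<^sub>3 i) (h\<^sub>0 i) (h\<^sub>1 i) (g i) (u i) (v i)"
    and bdd: "unif_bdd g F" "unif_bdd (\<lambda>i _. h\<^sub>0 i) F" "unif_bdd (\<lambda>i _. h\<^sub>1 i) F"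
  shows "unif_bdd u F" "unif_bdd v F"
proof -
  obtain A where A: "\<forall>\<^sub>F i in F. \<forall>s\<in>{0..1}. \<bar>g i s\<bar> \<le> A" using unif_bddD[OF bdd(1)] by blast
  obtain B where B: "\<forall>\<^sub>F i in F. \<forall>s\<in>{0..1::real}. \<bar>h\<^sub>0 i\<bar> \<le> B" using unif_bddD[OF bdd(2)] by blast
  obtain C where C: "\<forall>\<^sub>F i in F. \<forall>s\<in>{0..1::real}. \<bar>h\<^sub>1 i\<bar> \<le> C" using unif_bddD[OF bdd(3)] by blast
  define \<gamma> where "\<gamma> = max A (max B C)"
  have \<gamma>: "A \<le> \<gamma>" "B \<le> \<gamma>" "C \<le> \<gamma>" by (auto simp: \<gamma>_def)
  from sol A B C have "\<forall>\<^sub>F i in F. \<forall>s\<in>{0..1}. \<bar>u i s\<bar> \<le> M * \<gamma> \<and> \<bar>v i s\<bar> \<le> M * \<gamma>"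
  proof eventually_elim
    case (elim i)
    have st: "stable (Q\<^sub>2 i) (Q\<^sub>3 i) M" and so: "is_sol (Q\<^sub>2 i) (Q\<^sub>3 i) (h\<^sub>0 i) (h\<^sub>1 i) (g i) (u i) (v i)"
      using elim(1) by auto
    have "\<bar>h\<^sub>0 i\<bar> \<le> B" "\<bar>h\<^sub>1 i\<bar> \<le> C" using elim(3,4) by (auto dest: bspec[of _ _ 0])
    then have b: "\<bar>h\<^sub>0 i\<bar> \<le> \<gamma>" "\<bar>h\<^sub>1 i\<bar> \<le> \<gamma>" using \<gamma> by linarith+
    have b': "\<bar>g i s\<bar> \<le> \<gamma>" if "s \<in> {0..1}" for s using elim(2) that \<gamma> by force
    show ?case using stableD[OF st so b b'] by blast
  qed
  then show "unif_bdd u F" "unif_bdd v F"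
    unfolding unif_bdd_def by (intro exI[of _ "M * \<gamma>"], elim eventually_mono, blast)+
qed

subsection \<open>A chart of the solution set\<close>

locale tube = rel_open +
  fixes c d :: "real \<Rightarrow> real" and r :: real
  assumes cd: "continuous_on {0..1} c" "continuous_on {0..1} d"
    and tube: "\<And>s a b. s \<in> {0..1} \<Longrightarrow> \<bar>a - c s\<bar> \<le> r \<Longrightarrow> \<bar>b - d s\<bar> \<le> r \<Longrightarrow> (s, a, b) \<in> \<Omega>"
begin

definition K :: "real3 set" where
  "K = {(s, a, b). s \<in> {0..1} \<and> \<bar>a - c s\<bar> \<le> r \<and> \<bar>b - d s\<bar> \<le> r}"

abbreviation ph :: "bvp_data \<Rightarrow> real3 \<Rightarrow> real" where "ph x \<equiv> snd (snd x)"

definition E :: "bvp_data set" where "E = {x. ph x \<in> CO \<Omega>}"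

text \<open>
  The seminorms behind \<open>B N\<close> involve only the fixed compact set \<open>K\<close>; in the definition of
  \<open>C\<^sup>\<infinity>\<^sub>\<pi>\<close> this allows the neighbourhood \<open>U\<close> of directions to be chosen independently of \<open>\<epsilon>\<close>.
\<close>

definition B :: "nat \<Rightarrow> real \<Rightarrow> bvp_data set" where
  "B N \<delta> = {v \<in> E. \<bar>fst v\<bar> < \<delta> \<and> \<bar>fst (snd v)\<bar> < \<delta> \<and>
     (\<forall>ns. length ns \<le> N \<longrightarrow> (\<forall>z\<in>K. \<bar>pd ns (ph v) z\<bar> < \<delta>))}"

lemma K_I: "s \<in> {0..1} \<Longrightarrow> \<bar>a - c s\<bar> \<le> r \<Longrightarrow> \<bar>b - d s\<bar> \<le> r \<Longrightarrow> (s, a, b) \<in> K"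
  by (simp add: K_def)

lemma K_subset: "K \<subseteq> \<Omega>"
  using tube by (auto simp: K_def)

lemma compact_K: "compact K"
proof -
  have "continuous_on ({0..1} \<times> {-r..r} \<times> {-r..r}) (\<lambda>(s, p, q). (s, c s + p, d s + q))"
    unfolding case_prod_unfold
    by (intro continuous_intros continuous_on_compose2[OF cd(1)] continuous_on_compose2[OF cd(2)]) auto
  then have "compact ((\<lambda>(s, p, q). (s, c s + p, d s + q)) ` ({0..1} \<times> {-r..r} \<times> {-r..r}))"
    by (intro compact_continuous_image compact_Times compact_Icc)
  moreover have "(\<lambda>(s, p, q). (s, c s + p, d s + q)) ` ({0..1} \<times> {-r..r} \<times> {-r..r}) = K"
  proof (intro set_eqI iffI)
    fix z assume "z \<in> K"
    then obtain s a b where z: "z = (s, a, b)" "s \<in> {0..1}" "\<bar>a - c s\<bar> \<le> r" "\<bar>b - d s\<bar> \<le> r" by (auto simp: K_def)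
    then show "z \<in> (\<lambda>(s, p, q). (s, c s + p, d s + q)) ` ({0..1} \<times> {-r..r} \<times> {-r..r})"
      by (intro image_eqI[of _ _ "(s, a - c s, b - d s)"]) (auto simp: abs_le_iff)
  qed (auto simp: K_def abs_le_iff)
  ultimately show ?thesis by simp
qed

lemma E_linear: "x \<in> E \<Longrightarrow> x' \<in> E \<Longrightarrow> k *\<^sub>R x + x' \<in> E"
  by (simp add: E_def CO_linear_combination(1))

lemma E_add: "x \<in> E \<Longrightarrow> x' \<in> E \<Longrightarrow> x + x' \<in> E"
  using E_linear[of x x' 1] by simp

lemma E_zero: "0 \<in> E"
  using zero_in_CO by (simp add: E_def zero_prod_def)

lemma E_scaleR: "x \<in> E \<Longrightarrow> k *\<^sub>R x \<in> E"
  using E_linear[OF _ E_zero, of x k] by simp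

lemma E_diff: "x \<in> E \<Longrightarrow> x' \<in> E \<Longrightarrow> x - x' \<in> E"
  using E_linear[of x' x "-1"] by simp

lemma B_subset: "B N \<delta> \<subseteq> E"
  by (auto simp: B_def)

lemma B_mono: "N' \<le> N \<Longrightarrow> \<delta> \<le> \<delta>' \<Longrightarrow> B N \<delta> \<subseteq> B N' \<delta>'"
  unfolding B_def by (auto intro: less_le_trans) (meson le_trans less_le_trans)

lemma B_fst: "v \<in> B N \<delta> \<Longrightarrow> \<bar>fst v\<bar> < \<delta>" "v \<in> B N \<delta> \<Longrightarrow> \<bar>fst (snd v)\<bar> < \<delta>"
  by (simp_all add: B_def)

lemma B_pd: "v \<in> B N \<delta> \<Longrightarrow> length ns \<le> N \<Longrightarrow> z \<in> K \<Longrightarrow> \<bar>pd ns (ph v) z\<bar> < \<delta>"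
  by (simp add: B_def)

lemma B_zero: "0 < \<delta> \<Longrightarrow> 0 \<in> B N \<delta>"
  using E_zero pd_zero K_subset by (auto simp: B_def zero_prod_def)

lemma pd_bounded:
  assumes \<phi>: "\<phi> \<in> CO \<Omega>"
  obtains C where "0 < C" "\<And>ns z. length ns \<le> N \<Longrightarrow> z \<in> K \<Longrightarrow> \<bar>pd ns \<phi> z\<bar> < C"
proof -
  \<comment> \<open>There are infinitely many index lists of length at most \<open>N\<close>, but
    their direction vectors form this finite set, so a single constant bounds all of them.\<close>
  define L where "L = {bs. set bs \<subseteq> (Basis :: real3 set) \<and> length bs \<le> N}"
  have L: "finite L" unfolding L_def by (rule finite_lists_length_le) simp
  have "\<forall>bs\<in>L. \<exists>C. \<forall>z\<in>K. \<bar>ext_partial \<Omega> bs \<phi> z\<bar> \<le> C"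
  proof
    fix bs assume "bs \<in> L"
    then have "bs \<in> lists Basis" by (auto simp: L_def)
    then show "\<exists>C. \<forall>z\<in>K. \<bar>ext_partial \<Omega> bs \<phi> z\<bar> \<le> C"
      by (intro bounded_on_compact[OF _ compact_K] continuous_on_subset[OF ext_partial(1)[OF \<phi>] K_subset])
  qed
  from bchoice[OF this] obtain f where f: "\<forall>bs\<in>L. \<forall>z\<in>K. \<bar>ext_partial \<Omega> bs \<phi> z\<bar> \<le> f bs" ..
  define C where "C = 1 + (\<Sum>bs\<in>L. \<bar>f bs\<bar>)"
  have "\<bar>pd ns \<phi> z\<bar> < C" if "length ns \<le> N" "z \<in> K" for ns z
  proof -
    have mem: "map dirvec ns \<in> L" using that(1) by (auto simp: L_def)
    then have "\<bar>pd ns \<phi> z\<bar> \<le> f (map dirvec ns)" using f that(2) by (simp add: pd_def)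
    also have "\<dots> \<le> \<bar>f (map dirvec ns)\<bar>" by simp
    also have "\<dots> \<le> (\<Sum>bs\<in>L. \<bar>f bs\<bar>)" by (rule member_le_sum[OF mem _ L]) simp
    finally show ?thesis by (simp add: C_def)
  qed
  moreover have "0 < C" by (simp add: C_def add_pos_nonneg sum_nonneg)
  ultimately show ?thesis using that by blast
qed

lemma B_absorbs:
  assumes "v \<in> E" obtains R where "0 < R" "v \<in> B N R"
proof -
  obtain C where C: "0 < C" "\<And>ns z. length ns \<le> N \<Longrightarrow> z \<in> K \<Longrightarrow> \<bar>pd ns (ph v) z\<bar> < C"
    using pd_bounded[of "ph v" N] assms unfolding E_def by blast
  define R where "R = C + \<bar>fst v\<bar> + \<bar>fst (snd v)\<bar>"
  have R: "0 < R" "C \<le> R" "\<bar>fst v\<bar> < R" "\<bar>fst (snd v)\<bar> < R" using C(1) by (auto simp: R_def)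
  have "v \<in> B N R"
    unfolding B_def using assms R(3,4) less_le_trans[OF C(2) R(2)] by simp
  then show ?thesis using that R(1) by blast
qed

lemma B_scaleR:
  assumes "v \<in> B N R" "t \<noteq> 0" shows "t *\<^sub>R v \<in> B N (\<bar>t\<bar> * R)"
proof -
  have v: "v \<in> E" using assms B_subset by auto
  then have "\<bar>pd ns (ph (t *\<^sub>R v)) z\<bar> < \<bar>t\<bar> * R" if "length ns \<le> N" "z \<in> K" for ns z
    using B_pd[OF assms(1) that] that K_subset assms(2) pd_scaleR[of "ph v" z ns t]
    by (auto simp: E_def abs_mult)
  then show ?thesis
    using assms v by (simp add: B_def E_scaleR abs_mult)
qed

section \<open>Mean value and Taylor estimates on the fibres of the tube\<close>

lemma segment_in_K:
  assumes "(s, a, b) \<in> K" "(s, a', b') \<in> K" "t \<in> {0..1}"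
  shows "(s, a + t * (a' - a), b + t * (b' - b)) \<in> K"
proof -
  have *: "\<bar>u + t * (u' - u) - w\<bar> \<le> r" if "\<bar>u - w\<bar> \<le> r" "\<bar>u' - w\<bar> \<le> r" for u u' w
  proof -
    have "u + t * (u' - u) - w = (1 - t) * (u - w) + t * (u' - w)" by (simp add: algebra_simps)
    also have "\<bar>\<dots>\<bar> \<le> (1 - t) * \<bar>u - w\<bar> + t * \<bar>u' - w\<bar>"
      using assms(3) abs_triangle_ineq[of "(1 - t) * (u - w)" "t * (u' - w)"] by (simp add: abs_mult)
    also have "\<dots> \<le> (1 - t) * r + t * r" using assms(3) that by (intro add_mono mult_left_mono) auto
    finally show ?thesis by (simp add: algebra_simps)
  qed
  show ?thesis using assms * by (simp add: K_def)
qed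

lemma K_mvt:
  assumes \<phi>: "\<phi> \<in> CO \<Omega>" and z: "(s, a, b) \<in> K" "(s, a', b') \<in> K"
  shows "\<exists>t\<in>{0..1}. pd ns \<phi> (s, a', b') - pd ns \<phi> (s, a, b) =
      (a' - a) * pd (ns @ [1]) \<phi> (s, a + t * (a' - a), b + t * (b' - b)) +
      (b' - b) * pd (ns @ [2]) \<phi> (s, a + t * (a' - a), b + t * (b' - b))"
proof (rule pd_mvt[OF \<phi>, of s a a' b b' ns])
  show "(s, a + t * (a' - a), b + t * (b' - b)) \<in> \<Omega>" if "t \<in> {0..1}" for t
    using segment_in_K[OF z that] K_subset by blast
qed (rule bexI)

lemma K_lipschitz:
  assumes \<phi>: "\<phi> \<in> CO \<Omega>" and C: "\<And>z. z \<in> K \<Longrightarrow> \<bar>pd (ns @ [1]) \<phi> z\<bar> \<le> C" "\<And>z. z \<in> K \<Longrightarrow> \<bar>pd (ns @ [2]) \<phi> z\<bar> \<le> C"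
    and z: "(s, a, b) \<in> K" "(s, a', b') \<in> K" and m: "\<bar>a' - a\<bar> \<le> m" "\<bar>b' - b\<bar> \<le> m"
  shows "\<bar>pd ns \<phi> (s, a', b') - pd ns \<phi> (s, a, b)\<bar> \<le> 2 * C * m"
proof -
  obtain t where t: "t \<in> {0..1}" "pd ns \<phi> (s, a', b') - pd ns \<phi> (s, a, b) =
      (a' - a) * pd (ns @ [1]) \<phi> (s, a + t * (a' - a), b + t * (b' - b)) +
      (b' - b) * pd (ns @ [2]) \<phi> (s, a + t * (a' - a), b + t * (b' - b))"
    using K_mvt[OF \<phi> z, of ns] by (elim bexE)
  have "\<bar>(a' - a) * pd (ns @ [1]) \<phi> (s, a + t * (a' - a), b + t * (b' - b))\<bar> \<le> m * C"
    unfolding abs_mult using m C segment_in_K[OF z t(1)] by (intro mult_mono) auto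
  moreover have "\<bar>(b' - b) * pd (ns @ [2]) \<phi> (s, a + t * (a' - a), b + t * (b' - b))\<bar> \<le> m * C"
    unfolding abs_mult using m C segment_in_K[OF z t(1)] by (intro mult_mono) auto
  moreover have "m * C + m * C = 2 * C * m" by simp
  ultimately show ?thesis unfolding t(2) by linarith
qed

text \<open>\<open>K_lipschitz\<close> for the next partial derivatives compares the intermediate
  point of the mean value theorem with the base point. The constant comes from derivatives two
  orders higher on the compact set \<open>K\<close> and is therefore uniform in
  \<open>s\<close>.\<close>

lemma K_taylor:
  assumes \<phi>: "\<phi> \<in> CO \<Omega>"
  obtains C where "0 \<le> C"
    "\<And>s a b a' b' m. (s, a, b) \<in> K \<Longrightarrow> (s, a', b') \<in> K \<Longrightarrow> \<bar>a' - a\<bar> \<le> m \<Longrightarrow> \<bar>b' - b\<bar> \<le> m \<Longrightarrow>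
      \<bar>pd ns \<phi> (s, a', b') - pd ns \<phi> (s, a, b) -
        ((a' - a) * pd (ns @ [1]) \<phi> (s, a, b) + (b' - b) * pd (ns @ [2]) \<phi> (s, a, b))\<bar> \<le> C * m\<^sup>2"
proof -
  obtain C where C: "0 < C" "\<And>ms z. length ms \<le> length ns + 2 \<Longrightarrow> z \<in> K \<Longrightarrow> \<bar>pd ms \<phi> z\<bar> < C"
    using pd_bounded[OF \<phi>] by blast
  have "\<bar>pd ns \<phi> (s, a', b') - pd ns \<phi> (s, a, b) -
        ((a' - a) * pd (ns @ [1]) \<phi> (s, a, b) + (b' - b) * pd (ns @ [2]) \<phi> (s, a, b))\<bar> \<le> 4 * C * m\<^sup>2"
    if z: "(s, a, b) \<in> K" "(s, a', b') \<in> K" and m: "\<bar>a' - a\<bar> \<le> m" "\<bar>b' - b\<bar> \<le> m" for s a b a' b' m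
  proof -
    obtain t where t: "t \<in> {0..1}" "pd ns \<phi> (s, a', b') - pd ns \<phi> (s, a, b) =
      (a' - a) * pd (ns @ [1]) \<phi> (s, a + t * (a' - a), b + t * (b' - b)) +
      (b' - b) * pd (ns @ [2]) \<phi> (s, a + t * (a' - a), b + t * (b' - b))"
      using K_mvt[OF \<phi> z, of ns] by (elim bexE)
    let ?z = "(s, a + t * (a' - a), b + t * (b' - b))"
    have m0: "0 \<le> m" using m by linarith
    have tm: "\<bar>t * w\<bar> \<le> m" if "\<bar>w\<bar> \<le> m" for w
      using t(1) that mult_mono[of "\<bar>t\<bar>" 1 "\<bar>w\<bar>" m] by (simp add: abs_mult)
    have near: "\<bar>pd (ns @ [n]) \<phi> ?z - pd (ns @ [n]) \<phi> (s, a, b)\<bar> \<le> 2 * C * m" for n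
    proof (rule K_lipschitz[OF \<phi> _ _ z(1) segment_in_K[OF z t(1)]])
      show "\<bar>pd ((ns @ [n]) @ [1]) \<phi> w\<bar> \<le> C" "\<bar>pd ((ns @ [n]) @ [2]) \<phi> w\<bar> \<le> C" if "w \<in> K" for w
        using C(2)[of "(ns @ [n]) @ [1]" w] C(2)[of "(ns @ [n]) @ [2]" w] that by simp_all
      show "\<bar>a + t * (a' - a) - a\<bar> \<le> m" "\<bar>b + t * (b' - b) - b\<bar> \<le> m"
        using tm[OF m(1)] tm[OF m(2)] by simp_all
    qed
    have "\<bar>(a' - a) * (pd (ns @ [1]) \<phi> ?z - pd (ns @ [1]) \<phi> (s, a, b))\<bar> \<le> m * (2 * C * m)"
      unfolding abs_mult using m near m0 by (intro mult_mono) auto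
    moreover have "\<bar>(b' - b) * (pd (ns @ [2]) \<phi> ?z - pd (ns @ [2]) \<phi> (s, a, b))\<bar> \<le> m * (2 * C * m)"
      unfolding abs_mult using m near m0 by (intro mult_mono) auto
    moreover have "m * (2 * C * m) + m * (2 * C * m) = 4 * C * m\<^sup>2" by (simp add: power2_eq_square)
    moreover have "pd ns \<phi> (s, a', b') - pd ns \<phi> (s, a, b) -
        ((a' - a) * pd (ns @ [1]) \<phi> (s, a, b) + (b' - b) * pd (ns @ [2]) \<phi> (s, a, b)) =
        (a' - a) * (pd (ns @ [1]) \<phi> ?z - pd (ns @ [1]) \<phi> (s, a, b)) +
        (b' - b) * (pd (ns @ [2]) \<phi> ?z - pd (ns @ [2]) \<phi> (s, a, b))"
      unfolding t(2) by (simp only: right_diff_distrib)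
    ultimately show ?thesis by linarith
  qed
  then show ?thesis using that[of "4 * C"] C(1) by simp
qed

end

subsection \<open>Formal expressions for the iterated derivatives\<close>

text \<open>
  \<open>Pos\<close> and \<open>Vel\<close> stand for \<open>y\<close> and \<open>y'\<close>, and \<open>Der ns k\<close> for the partial derivative \<open>ns\<close>, evaluated along the
  curve, of \<open>\<phi>\<close> (\<open>k = None\<close>) or of the function component of the direction number \<open>i\<close> (\<open>k = Some i\<close>).
  \<open>Lin k e\<close> is the solution of the linearized problem with right-hand side \<open>e\<close> and with the boundary
  values of direction \<open>i\<close> if \<open>k = Some i\<close>, zero otherwise; \<open>LinVel k e\<close> is its derivative.
\<close>

datatype bexp = Pos | Vel | Der "nat list" "nat option" | Add bexp bexp | Mul bexp bexp
  | Lin "nat option" bexp | LinVel "nat option" bexp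

text \<open>The differential equations keep derivatives inside the language: y'' is replaced by
  \<open>Der [] None\<close> in the chain rule along (s, y, y'), and the derivative of
  \<open>LinVel\<close> is read off the linearized equation. Smoothness of solutions in
  \<open>s\<close> thus comes for free.\<close>

fun time_deriv :: "bexp \<Rightarrow> bexp" where
  "time_deriv Pos = Vel"
| "time_deriv Vel = Der [] None"
| "time_deriv (Der ns k) = Add (Der (ns @ [0]) k) (Add (Mul Vel (Der (ns @ [1]) k)) (Mul (Der [] None) (Der (ns @ [2]) k)))"
| "time_deriv (Add a b) = Add (time_deriv a) (time_deriv b)"
| "time_deriv (Mul a b) = Add (Mul (time_deriv a) b) (Mul (time_deriv b) a)"
| "time_deriv (Lin k e) = LinVel k e"
| "time_deriv (LinVel k e) = Add (Add (Mul (Der [2] None) (LinVel k e)) (Mul (Der [1] None) (Lin k e))) e"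

text \<open>Differentiating the equation for y in direction j gives the linearized problem. Its
  source is the function component of the direction along the curve, and its boundary values are
  those of the direction.\<close>

definition pos_deriv :: "nat \<Rightarrow> bexp" where "pos_deriv j = Lin (Some j) (Der [] (Some j))"
definition vel_deriv :: "nat \<Rightarrow> bexp" where "vel_deriv j = LinVel (Some j) (Der [] (Some j))"

text \<open>The common part is the motion of the curve. For \<open>None\<close> the function \<phi>
  moves as well, which adds a derivative of direction j; the functions of the directions are
  constant in the base point.\<close>

definition der_deriv :: "nat \<Rightarrow> nat list \<Rightarrow> nat option \<Rightarrow> bexp" where
  "der_deriv j ns k =
     (let e = Add (Mul (Der (ns @ [1]) k) (pos_deriv j)) (Mul (Der (ns @ [2]) k) (vel_deriv j))
      in case k of None \<Rightarrow> Add e (Der ns (Some j)) | Some _ \<Rightarrow> e)"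

text \<open>
  The right-hand side of the equation obtained by differentiating
  \<open>u'' = p\<^sub>3 u' + p\<^sub>2 u + e\<close> in a direction.
\<close>

definition lin_source :: "nat \<Rightarrow> nat option \<Rightarrow> bexp \<Rightarrow> bexp \<Rightarrow> bexp" where
  "lin_source j k e e' = Add e' (Add (Mul (der_deriv j [2] None) (LinVel k e)) (Mul (der_deriv j [1] None) (Lin k e)))"

text \<open>The boundary values of \<open>Lin k e\<close> depend on a direction but not on the base
  point. Their derivative is zero, hence the \<open>None\<close> on the right-hand sides.\<close>

fun dir_deriv_exp :: "nat \<Rightarrow> bexp \<Rightarrow> bexp" where
  "dir_deriv_exp j Pos = pos_deriv j"
| "dir_deriv_exp j Vel = vel_deriv j"
| "dir_deriv_exp j (Der ns k) = der_deriv j ns k"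
| "dir_deriv_exp j (Add a b) = Add (dir_deriv_exp j a) (dir_deriv_exp j b)"
| "dir_deriv_exp j (Mul a b) = Add (Mul (dir_deriv_exp j a) b) (Mul (dir_deriv_exp j b) a)"
| "dir_deriv_exp j (Lin k e) = Lin None (lin_source j k e (dir_deriv_exp j e))"
| "dir_deriv_exp j (LinVel k e) = LinVel None (lin_source j k e (dir_deriv_exp j e))"

text \<open>\<open>multideg e J\<close>: as a function of the directions, \<open>e\<close> is linear in those in \<open>J\<close> and independent of the others.\<close>

fun multideg :: "bexp \<Rightarrow> nat set \<Rightarrow> bool" where
  "multideg Pos J \<longleftrightarrow> J = {}"
| "multideg Vel J \<longleftrightarrow> J = {}"
| "multideg (Der ns k) J \<longleftrightarrow> J = set_option k"
| "multideg (Add a b) J \<longleftrightarrow> multideg a J \<and> multideg b J"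
| "multideg (Mul a b) J \<longleftrightarrow> (\<exists>A B. multideg a A \<and> multideg b B \<and> A \<inter> B = {} \<and> J = A \<union> B)"
| "multideg (Lin k e) J \<longleftrightarrow> multideg e J \<and> (k = None \<or> J = set_option k)"
| "multideg (LinVel k e) J \<longleftrightarrow> multideg e J \<and> (k = None \<or> J = set_option k)"

lemma multideg_Mul: "multideg a A \<Longrightarrow> multideg b B \<Longrightarrow> A \<inter> B = {} \<Longrightarrow> J = A \<union> B \<Longrightarrow> multideg (Mul a b) J"
  by auto

declare multideg.simps(5) [simp del]

lemma multideg_pos_deriv: "multideg (pos_deriv j) {j}" "multideg (vel_deriv j) {j}"
  by (auto simp: pos_deriv_def vel_deriv_def)

lemma multideg_der_deriv: "j \<notin> set_option k \<Longrightarrow> multideg (der_deriv j ns k) (insert j (set_option k))"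
  by (auto simp: der_deriv_def Let_def split: option.splits
      intro!: multideg_Mul[OF _ multideg_pos_deriv(1)] multideg_Mul[OF _ multideg_pos_deriv(2)])

lemma multideg_lin_source:
  assumes "multideg e J" "multideg e' (insert j J)" "j \<notin> J" "k = None \<or> J = set_option k"
  shows "multideg (lin_source j k e e') (insert j J)"
  unfolding lin_source_def using assms multideg_der_deriv[of j None]
  by (auto intro!: multideg_Mul[of _ "{j}" _ J])

text \<open>The derivative of a product puts the new direction into exactly one factor of each
  summand, so a fresh j keeps the direction sets of the factors disjoint and the whole expression
  multilinear.\<close>

lemma multideg_dir_deriv: "multideg e J \<Longrightarrow> j \<notin> J \<Longrightarrow> multideg (dir_deriv_exp j e) (insert j J)"
proof (induction e arbitrary: J)
  case (Mul a b)
  then obtain A B where AB: "multideg a A" "multideg b B" "A \<inter> B = {}" "J = A \<union> B"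
    by (auto simp: multideg.simps(5))
  then have "multideg (Mul (dir_deriv_exp j a) b) (insert j J)" "multideg (Mul (dir_deriv_exp j b) a) (insert j J)"
    using Mul.IH(1)[OF AB(1)] Mul.IH(2)[OF AB(2)] Mul.prems
    by - (rule multideg_Mul[of _ "insert j A" _ B], auto, rule multideg_Mul[of _ "insert j B" _ A], auto)
  then show ?case by simp
qed (auto simp: multideg_pos_deriv multideg_der_deriv multideg_lin_source)

text \<open>The interface between the existence theory and the differential calculus: a family of
  solutions over \<open>Dm\<close> with curves in \<open>K\<close>, one stability constant for all
  linearizations, and a Lipschitz bound by seminorms of order at most one.\<close>

locale chart = tube +
  fixes Dm :: "bvp_data set" and y y' :: "bvp_data \<Rightarrow> real \<Rightarrow> real" and M :: real
  assumes Dm_E: "Dm \<subseteq> E"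
    and Dm_open: "\<And>x. x \<in> Dm \<Longrightarrow> \<exists>\<delta>>0. \<forall>v\<in>B 1 \<delta>. x + v \<in> Dm"
    and y_K: "\<And>x s. x \<in> Dm \<Longrightarrow> s \<in> {0..1} \<Longrightarrow> (s, y x s, y' x s) \<in> K"
    and y_deriv: "\<And>x s. x \<in> Dm \<Longrightarrow> s \<in> {0..1} \<Longrightarrow> (y x has_real_derivative y' x s) (at s within {0..1})"
    and y'_deriv: "\<And>x s. x \<in> Dm \<Longrightarrow> s \<in> {0..1} \<Longrightarrow>
      (y' x has_real_derivative pd [] (ph x) (s, y x s, y' x s)) (at s within {0..1})"
    and y_bc: "\<And>x. x \<in> Dm \<Longrightarrow> y x 0 = fst x" "\<And>x. x \<in> Dm \<Longrightarrow> y x 1 = fst (snd x)"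
    and lin_stable: "\<And>x. x \<in> Dm \<Longrightarrow>
      stable (\<lambda>s. pd [1] (ph x) (s, y x s, y' x s)) (\<lambda>s. pd [2] (ph x) (s, y x s, y' x s)) M"
    and lin_solvable: "\<And>x. x \<in> Dm \<Longrightarrow>
      solvable (\<lambda>s. pd [1] (ph x) (s, y x s, y' x s)) (\<lambda>s. pd [2] (ph x) (s, y x s, y' x s))"
    and y_lipschitz: "\<And>x x' \<delta> s. x \<in> Dm \<Longrightarrow> x' \<in> Dm \<Longrightarrow> x' - x \<in> B 1 \<delta> \<Longrightarrow> s \<in> {0..1} \<Longrightarrow>
      \<bar>y x' s - y x s\<bar> \<le> M * \<delta> \<and> \<bar>y' x' s - y' x s\<bar> \<le> M * \<delta>"
begin

definition pt :: "bvp_data \<Rightarrow> real \<Rightarrow> real3" where "pt x s = (s, y x s, y' x s)"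
definition p\<^sub>2 :: "bvp_data \<Rightarrow> real \<Rightarrow> real" where "p\<^sub>2 x = (\<lambda>s. pd [1] (ph x) (pt x s))"
definition p\<^sub>3 :: "bvp_data \<Rightarrow> real \<Rightarrow> real" where "p\<^sub>3 x = (\<lambda>s. pd [2] (ph x) (pt x s))"

definition datum :: "bvp_data \<Rightarrow> (nat \<Rightarrow> bvp_data) \<Rightarrow> nat option \<Rightarrow> bvp_data" where
  "datum x us k = (case k of None \<Rightarrow> x | Some i \<Rightarrow> us i)"

text \<open>In contrast to \<open>datum\<close>, where \<open>None\<close> selects the base point,
  \<open>None\<close> stands here for zero boundary values.\<close>

definition bc :: "(nat \<Rightarrow> bvp_data) \<Rightarrow> nat option \<Rightarrow> bvp_data" where
  "bc us k = (case k of None \<Rightarrow> 0 | Some i \<Rightarrow> us i)"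

abbreviation lin_sol where
  "lin_sol x v g p \<equiv> is_sol (p\<^sub>2 x) (p\<^sub>3 x) (fst v) (fst (snd v)) g (fst p) (snd p)"

text \<open>A solution of the linearized problem; arbitrary if there is none, that is, only for irrelevant \<open>g\<close>.\<close>

definition lin :: "bvp_data \<Rightarrow> bvp_data \<Rightarrow> (real \<Rightarrow> real) \<Rightarrow> (real \<Rightarrow> real) \<times> (real \<Rightarrow> real)" where
  "lin x v g = (SOME p. lin_sol x v g p)"

primrec ev :: "bvp_data \<Rightarrow> (nat \<Rightarrow> bvp_data) \<Rightarrow> bexp \<Rightarrow> real \<Rightarrow> real" where
  "ev x us Pos = y x"
| "ev x us Vel = y' x"
| "ev x us (Der ns k) = (\<lambda>s. pd ns (ph (datum x us k)) (pt x s))"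
| "ev x us (Add a b) = (\<lambda>s. ev x us a s + ev x us b s)"
| "ev x us (Mul a b) = (\<lambda>s. ev x us a s * ev x us b s)"
| "ev x us (Lin k e) = fst (lin x (bc us k) (ev x us e))"
| "ev x us (LinVel k e) = snd (lin x (bc us k) (ev x us e))"

definition Es :: "(nat \<Rightarrow> bvp_data) set" where "Es = {us. \<forall>k. us k \<in> E}"

lemma pt_K: "x \<in> Dm \<Longrightarrow> s \<in> {0..1} \<Longrightarrow> pt x s \<in> K"
  by (simp add: pt_def y_K)

lemma pt_Omega: "x \<in> Dm \<Longrightarrow> s \<in> {0..1} \<Longrightarrow> pt x s \<in> \<Omega>"
  using pt_K K_subset by blast

lemma ph_CO: "x \<in> E \<Longrightarrow> ph x \<in> CO \<Omega>"
  by (simp add: E_def)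

lemma datum_E: "x \<in> Dm \<Longrightarrow> us \<in> Es \<Longrightarrow> datum x us k \<in> E"
  using Dm_E by (auto simp: datum_def Es_def split: option.splits)

lemma datum_CO: "x \<in> Dm \<Longrightarrow> us \<in> Es \<Longrightarrow> ph (datum x us k) \<in> CO \<Omega>"
  using datum_E ph_CO by blast

lemma Dm_CO: "x \<in> Dm \<Longrightarrow> ph x \<in> CO \<Omega>"
  using Dm_E ph_CO by blast

lemma curve_deriv:
  assumes "\<phi> \<in> CO \<Omega>" "x \<in> Dm" "s \<in> {0..1}"
  shows "((\<lambda>s. pd ns \<phi> (pt x s)) has_real_derivative
    pd (ns @ [0]) \<phi> (pt x s) + (y' x s * pd (ns @ [1]) \<phi> (pt x s) + pd [] (ph x) (pt x s) * pd (ns @ [2]) \<phi> (pt x s)))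
    (at s within {0..1})"
proof -
  have "((\<lambda>\<tau>. pd ns \<phi> (\<tau>, y x \<tau>, y' x \<tau>)) has_real_derivative 1 * pd (ns @ [0]) \<phi> (s, y x s, y' x s) +
      y' x s * pd (ns @ [1]) \<phi> (s, y x s, y' x s) + pd [] (ph x) (s, y x s, y' x s) * pd (ns @ [2]) \<phi> (s, y x s, y' x s))
      (at s within {0..1})"
    using pt_Omega[OF assms(2)] unfolding pt_def
    by (intro pd_curve[OF assms(1) _ y_deriv[OF assms(2,3)] y'_deriv[OF assms(2,3)] assms(3)]) auto
  then show ?thesis by (simp add: pt_def add.assoc)
qed

lemma curve_continuous: "\<phi> \<in> CO \<Omega> \<Longrightarrow> x \<in> Dm \<Longrightarrow> continuous_on {0..1} (\<lambda>s. pd ns \<phi> (pt x s))"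
  unfolding continuous_on_eq_continuous_within using DERIV_continuous[OF curve_deriv] by blast

lemma stable_p: "x \<in> Dm \<Longrightarrow> stable (p\<^sub>2 x) (p\<^sub>3 x) M"
  using lin_stable by (simp add: p\<^sub>2_def p\<^sub>3_def pt_def)

lemma lin_sol_lin:
  assumes "x \<in> Dm" "continuous_on {0..1} g"
  shows "lin_sol x v g (lin x v g)"
proof -
  have "solvable (p\<^sub>2 x) (p\<^sub>3 x)" using lin_solvable[OF assms(1)] by (simp add: p\<^sub>2_def p\<^sub>3_def pt_def)
  then obtain u w where "is_sol (p\<^sub>2 x) (p\<^sub>3 x) (fst v) (fst (snd v)) g u w"
    using assms(2) unfolding solvable_def by blast
  then have "lin_sol x v g (u, w)" by simp
  then show ?thesis unfolding lin_def by (rule someI)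
qed

text \<open>For \<open>Lin\<close> and \<open>LinVel\<close> the induction hypothesis has a second
  task: it makes the source continuous, so that the pair chosen by \<open>lin\<close> is a genuine
  solution.\<close>

lemma ev_deriv:
  assumes "x \<in> Dm" "us \<in> Es" "s \<in> {0..1}"
  shows "(ev x us e has_real_derivative ev x us (time_deriv e) s) (at s within {0..1})"
  using assms(3)
proof (induction e arbitrary: s)
  case Pos
  then show ?case using y_deriv[OF assms(1)] by simp
next
  case Vel
  then show ?case using y'_deriv[OF assms(1)] by (simp add: datum_def pt_def)
next
  case (Der ns k)
  then show ?case using curve_deriv[OF datum_CO[OF assms(1,2)] assms(1)] by (simp add: datum_def[of x us None])
next
  case (Add a b)
  then show ?case by (auto intro!: derivative_eq_intros)
next
  case (Mul a b)
  then show ?case using DERIV_mult[OF Mul.IH] by simp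
next
  case (Lin k e)
  then have "continuous_on {0..1} (ev x us e)"
    unfolding continuous_on_eq_continuous_within using DERIV_continuous[OF Lin.IH] by blast
  from lin_sol_lin[OF assms(1) this, of "bc us k"] Lin.prems show ?case by (simp add: is_sol_def)
next
  case (LinVel k e)
  then have "continuous_on {0..1} (ev x us e)"
    unfolding continuous_on_eq_continuous_within using DERIV_continuous[OF LinVel.IH] by blast
  from lin_sol_lin[OF assms(1) this, of "bc us k"] LinVel.prems show ?case
    by (simp add: is_sol_def p\<^sub>2_def p\<^sub>3_def datum_def)
qed

lemma ev_continuous: "x \<in> Dm \<Longrightarrow> us \<in> Es \<Longrightarrow> continuous_on {0..1} (ev x us e)"
  unfolding continuous_on_eq_continuous_within using DERIV_continuous[OF ev_deriv] by blast

lemma lin_sol_ev: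
  "x \<in> Dm \<Longrightarrow> us \<in> Es \<Longrightarrow> is_sol (p\<^sub>2 x) (p\<^sub>3 x) (fst (bc us k)) (fst (snd (bc us k))) (ev x us e)
    (ev x us (Lin k e)) (ev x us (LinVel k e))"
  using lin_sol_lin[OF _ ev_continuous] by simp

lemma sol_unique:
  assumes "x \<in> Dm" "is_sol (p\<^sub>2 x) (p\<^sub>3 x) h\<^sub>0 h\<^sub>1 g u v" "is_sol (p\<^sub>2 x) (p\<^sub>3 x) h\<^sub>0 h\<^sub>1 g' u' v'"
    "\<And>s. s \<in> {0..1} \<Longrightarrow> g s = g' s" "s \<in> {0..1}"
  shows "u s = u' s \<and> v s = v' s"
  using stableD[OF stable_p[OF assms(1)] is_sol_diff[OF assms(2,3)], of 0 s] assms(4,5) by simp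

text \<open>The sources agree only on the interval, so the choice in \<open>lin\<close> may return
  different pairs; uniqueness for the linear problem forces them to coincide on the
  interval.\<close>

lemma ev_cong:
  assumes "multideg e J" "\<And>k. k \<in> J \<Longrightarrow> vs k = us k" "x \<in> Dm" "us \<in> Es" "vs \<in> Es" "s \<in> {0..1}"
  shows "ev x vs e s = ev x us e s"
  using assms(1,2,6)
proof (induction e arbitrary: J s)
  case (Der ns k)
  then show ?case by (auto simp: datum_def split: option.splits)
next
  case (Add a b)
  then show ?case by (metis ev.simps(4) multideg.simps(4))
next
  case (Mul a b)
  then obtain A B where AB: "multideg a A" "multideg b B" "J = A \<union> B" by (auto simp: multideg.simps(5))
  then have "ev x vs a s = ev x us a s" "ev x vs b s = ev x us b s"
    using Mul.IH(1)[OF AB(1)] Mul.IH(2)[OF AB(2)] Mul.prems by blast+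
  then show ?case by simp
next
  case (Lin k e)
  have bc: "bc vs k = bc us k" using Lin.prems by (auto simp: bc_def split: option.splits)
  have e: "ev x vs e s = ev x us e s" if "s \<in> {0..1}" for s
    using Lin.prems(1,2) that by (intro Lin.IH[of J]) simp_all
  show ?case
    using sol_unique[OF assms(3) lin_sol_ev[OF assms(3,5)] lin_sol_ev[OF assms(3,4), where k = k, folded bc] e Lin.prems(3)]
    by blast
next
  case (LinVel k e)
  have bc: "bc vs k = bc us k" using LinVel.prems by (auto simp: bc_def split: option.splits)
  have e: "ev x vs e s = ev x us e s" if "s \<in> {0..1}" for s
    using LinVel.prems(1,2) that by (intro LinVel.IH[of J]) simp_all
  show ?case
    using sol_unique[OF assms(3) lin_sol_ev[OF assms(3,5)] lin_sol_ev[OF assms(3,4), where k = k, folded bc] e LinVel.prems(3)]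
    by blast
qed auto

text \<open>In a product only one factor contains direction i, and \<open>ev_cong\<close> makes the
  other factor the same for all three families. For \<open>Lin\<close> and \<open>LinVel\<close> the
  argument is superposition, in the boundary values as well as in the source, followed by
  uniqueness.\<close>

lemma ev_linear:
  assumes "multideg e J" "i \<in> J" "x \<in> Dm" "us \<in> Es" "vs \<in> Es" "ws \<in> Es" "s \<in> {0..1}"
    and ws: "ws i = t *\<^sub>R us i + vs i" "\<And>k. k \<noteq> i \<Longrightarrow> ws k = us k" "\<And>k. k \<noteq> i \<Longrightarrow> vs k = us k"
  shows "ev x ws e s = t * ev x us e s + ev x vs e s"
proof -
  have lin_step: "ev x ws (Lin k e) s = t * ev x us (Lin k e) s + ev x vs (Lin k e) s \<and>
      ev x ws (LinVel k e) s = t * ev x us (LinVel k e) s + ev x vs (LinVel k e) s"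
    if IH: "\<And>s. s \<in> {0..1} \<Longrightarrow> ev x ws e s = t * ev x us e s + ev x vs e s"
      and k: "k = None \<or> J = set_option k" and i: "i \<in> J" and s: "s \<in> {0..1}" for k e J s
  proof (rule sol_unique[OF assms(3) lin_sol_ev[OF assms(3,6)] _ IH s])
    have "bc ws k = t *\<^sub>R bc us k + bc vs k"
      using k i ws(1) by (auto simp: bc_def split: option.splits)
    then show "is_sol (p\<^sub>2 x) (p\<^sub>3 x) (fst (bc ws k)) (fst (snd (bc ws k)))
        (\<lambda>s. t * ev x us e s + ev x vs e s) (\<lambda>s. t * ev x us (Lin k e) s + ev x vs (Lin k e) s)
        (\<lambda>s. t * ev x us (LinVel k e) s + ev x vs (LinVel k e) s)"
      using is_sol_linear_combination[OF lin_sol_ev[OF assms(3,4), where k = k and e = e] lin_sol_ev[OF assms(3,5), where k = k and e = e], of t]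
      by simp
  qed
  show ?thesis
    using assms(1,2,7)
  proof (induction e arbitrary: J s)
    case (Der ns k)
    then have "k = Some i" by auto
    moreover have "us i \<in> E" "vs i \<in> E" using assms(4,5) by (auto simp: Es_def)
    ultimately show ?case
      using pd_linear[OF ph_CO ph_CO pt_Omega[OF assms(3) Der.prems(3)], of "us i" "vs i" ns t] ws(1)
      by (simp add: datum_def)
  next
    case (Add e f)
    then have "ev x ws e s = t * ev x us e s + ev x vs e s" "ev x ws f s = t * ev x us f s + ev x vs f s" by auto
    then show ?case by (simp add: algebra_simps)
  next
    case (Mul e f)
    then obtain A B where AB: "multideg e A" "multideg f B" "A \<inter> B = {}" "J = A \<union> B"
      by (auto simp: multideg.simps(5))
    consider "i \<in> A" "i \<notin> B" | "i \<notin> A" "i \<in> B" using AB Mul.prems by blast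
    then show ?case
    proof cases
      case 1
      then have "ws k = us k" "vs k = us k" if "k \<in> B" for k using ws that by metis+
      then have "ev x ws f s = ev x us f s" "ev x vs f s = ev x us f s"
        using ev_cong[OF AB(2) _ assms(3,4) _ Mul.prems(3)] assms(5,6) by blast+
      then show ?thesis using Mul.IH(1)[OF AB(1) 1(1) Mul.prems(3)] by (simp add: algebra_simps)
    next
      case 2
      then have "ws k = us k" "vs k = us k" if "k \<in> A" for k using ws that by metis+
      then have "ev x ws e s = ev x us e s" "ev x vs e s = ev x us e s"
        using ev_cong[OF AB(1) _ assms(3,4) _ Mul.prems(3)] assms(5,6) by blast+
      then show ?thesis using Mul.IH(2)[OF AB(2) 2(2) Mul.prems(3)] by (simp add: algebra_simps)
    qed
  next
    case (Lin k e)
    then show ?case using lin_step[of e k J s] by (metis multideg.simps(6))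
  next
    case (LinVel k e)
    then show ?case using lin_step[of e k J s] by (metis multideg.simps(7))
  qed auto
qed

end

subsection \<open>Continuity and directional derivatives of expressions\<close>

context chart
begin

lemma M_ge_1: "x \<in> Dm \<Longrightarrow> 1 \<le> M"
  using stable_p by (auto simp: stable_def)

text \<open>
  Convergence along this filter with \<open>us\<close> ranging over a bounded set gives at once the joint
  continuity in the directions and the uniformity required by \<open>C\<^sup>\<infinity>\<^sub>\<pi>\<close>.
\<close>

definition near :: "bvp_data \<Rightarrow> nat \<Rightarrow> real \<Rightarrow> (bvp_data \<times> (nat \<Rightarrow> bvp_data) \<times> (nat \<Rightarrow> bvp_data)) filter" where
  "near x N R = (INF \<delta>\<in>{0<..}. principal {(x', vs, us). x' \<in> Dm \<and> x' - x \<in> B N \<delta> \<and>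
     vs \<in> Es \<and> (\<forall>k. us k \<in> B N R \<and> vs k - us k \<in> B N \<delta>)})"

lemma eventually_near:
  "eventually P (near x N R) \<longleftrightarrow> (\<exists>\<delta>>0. \<forall>x' vs us. x' \<in> Dm \<longrightarrow> x' - x \<in> B N \<delta> \<longrightarrow> vs \<in> Es \<longrightarrow>
     (\<forall>k. us k \<in> B N R \<and> vs k - us k \<in> B N \<delta>) \<longrightarrow> P (x', vs, us))"
proof -
  let ?S = "\<lambda>\<delta>. {(x', vs, us). x' \<in> Dm \<and> x' - x \<in> B N \<delta> \<and> vs \<in> Es \<and> (\<forall>k. us k \<in> B N R \<and> vs k - us k \<in> B N \<delta>)}"
  have mono: "?S (min \<delta> \<delta>') \<subseteq> ?S \<delta> \<inter> ?S \<delta>'" for \<delta> \<delta>'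
    using B_mono[OF order_refl, of "min \<delta> \<delta>'" \<delta> N] B_mono[OF order_refl, of "min \<delta> \<delta>'" \<delta>' N] by auto
  have "eventually P (near x N R) \<longleftrightarrow> (\<exists>\<delta>\<in>{0<..}. eventually P (principal (?S \<delta>)))"
    unfolding near_def
  proof (rule eventually_INF_base)
    show "{0<..} \<noteq> ({} :: real set)" by (auto intro: gt_ex)
    fix \<delta> \<delta>' :: real assume "\<delta> \<in> {0<..}" "\<delta>' \<in> {0<..}"
    then show "\<exists>\<eta>\<in>{0<..}. principal (?S \<eta>) \<le> inf (principal (?S \<delta>)) (principal (?S \<delta>'))"
      using mono by (intro bexI[of _ "min \<delta> \<delta>'"]) (auto simp: inf_principal)
  qed
  then show ?thesis by (simp add: eventually_principal) blast
qed

lemma near_Dm: "eventually (\<lambda>i. fst i \<in> Dm \<and> fst (snd i) \<in> Es \<and> snd (snd i) \<in> Es) (near x N R)"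
  unfolding eventually_near Es_def using B_subset by (intro exI[of _ 1]) fastforce

lemma B_less: "w \<in> B N \<delta> \<Longrightarrow> 0 < \<delta>"
  using B_fst(1)[of w N \<delta>] by linarith

definition ev_near :: "bvp_data \<Rightarrow> nat \<Rightarrow> real \<Rightarrow> bexp \<Rightarrow> bool" where
  "ev_near x N R e \<longleftrightarrow>
     unif_lim (\<lambda>i. ev (fst i) (fst (snd i)) e) (\<lambda>i. ev x (snd (snd i)) e) (near x N R) \<and>
     unif_bdd (\<lambda>i. ev x (snd (snd i)) e) (near x N R)"

lemma ev_near_Pos_Vel:
  assumes x: "x \<in> Dm" and N: "1 \<le> N"
  shows "ev_near x N R Pos" "ev_near x N R Vel"
proof -
  have "\<forall>\<^sub>F i in near x N R. \<forall>s\<in>{0..1}. \<bar>y (fst i) s - y x s\<bar> < \<epsilon> \<and> \<bar>y' (fst i) s - y' x s\<bar> < \<epsilon>" if e: "0 < \<epsilon>" for \<epsilon>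
    unfolding eventually_near
  proof (intro exI conjI allI impI ballI)
    have M: "1 \<le> M" using M_ge_1[OF x] .
    show "0 < \<epsilon> / (2 * M)" using M e by simp
    fix x' and us vs :: "nat \<Rightarrow> bvp_data" and s :: real
    assume x': "x' \<in> Dm" "x' - x \<in> B N (\<epsilon> / (2 * M))" and s: "s \<in> {0..1}"
    have "x' - x \<in> B 1 (\<epsilon> / (2 * M))" using x'(2) B_mono[OF N order_refl] by auto
    from y_lipschitz[OF x x'(1) this s]
    have "\<bar>y x' s - y x s\<bar> \<le> \<epsilon> / 2 \<and> \<bar>y' x' s - y' x s\<bar> \<le> \<epsilon> / 2" using M by simp
    then show "\<bar>y (fst (x', us, vs)) s - y x s\<bar> < \<epsilon>" "\<bar>y' (fst (x', us, vs)) s - y' x s\<bar> < \<epsilon>" using e by auto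
  qed
  then have *: "\<forall>\<^sub>F i in near x N R. \<forall>s\<in>{0..1}. \<bar>y (fst i) s - y x s\<bar> < \<epsilon> \<and> \<bar>y' (fst i) s - y' x s\<bar> < \<epsilon>" if "0 < \<epsilon>" for \<epsilon>
    using that by blast
  have "continuous_on {0..1} (y x)" "continuous_on {0..1} (y' x)"
    unfolding continuous_on_eq_continuous_within
    using DERIV_continuous[OF y_deriv[OF x]] DERIV_continuous[OF y'_deriv[OF x]] by blast+
  then show "ev_near x N R Pos" "ev_near x N R Vel"
    unfolding ev_near_def unif_lim_def
    by (auto intro!: unif_bdd_continuous elim!: eventually_mono[OF *])
qed

text \<open>The change splits into a change of the function at a fixed point and a change of the
  point for a fixed function. The second is estimated by the mean value theorem and costs one
  derivative more, hence length ns + 1.\<close>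

lemma ev_near_Der:
  assumes x: "x \<in> Dm" and N: "length ns + 1 \<le> N" and R: "0 < R"
  shows "ev_near x N R (Der ns k)"
proof -
  have M: "1 \<le> M" using M_ge_1[OF x] .
  obtain C0 where C0: "0 < C0" "\<And>ms z. length ms \<le> N \<Longrightarrow> z \<in> K \<Longrightarrow> \<bar>pd ms (ph x) z\<bar> < C0"
    using pd_bounded[OF Dm_CO[OF x]] by blast
  define C where "C = max C0 R"
  have C: "0 < C" "C0 \<le> C" "R \<le> C" using C0 by (auto simp: C_def)
  have bd: "\<bar>pd ms (ph (datum x us k)) z\<bar> \<le> C" if us: "\<And>k. us k \<in> B N R" and m: "length ms \<le> N" "z \<in> K" for us ms z
  proof (cases k)
    case None
    then show ?thesis using C0(2)[OF m] C by (simp add: datum_def)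
  next
    case (Some i)
    then show ?thesis using B_pd[OF us m, of i] C by (simp add: datum_def)
  qed
  have "unif_bdd (\<lambda>i s. pd ns (ph (datum x (snd (snd i)) k)) (pt x s)) (near x N R)"
    unfolding unif_bdd_def eventually_near
    using bd N pt_K[OF x] by (intro exI[of _ C] exI[of _ 1]) auto
  moreover have "\<forall>\<^sub>F i in near x N R. \<forall>s\<in>{0..1}. \<bar>pd ns (ph (datum (fst i) (fst (snd i)) k)) (pt (fst i) s) -
      pd ns (ph (datum x (snd (snd i)) k)) (pt x s)\<bar> < \<epsilon>" if e: "0 < \<epsilon>" for \<epsilon>
    unfolding eventually_near
  proof (intro exI conjI allI impI ballI)
    \<comment> \<open>The change of the function contributes \<delta> and the change of the point 2
      C M \<delta>; together they make up \<epsilon>/2.\<close>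
    define \<delta> where "\<delta> = \<epsilon> / (2 * (1 + 2 * C * M))"
    have pos: "0 < 1 + 2 * C * M" using C M by (simp add: add_pos_nonneg)
    then show d: "0 < \<delta>" using e by (simp add: \<delta>_def)
    fix x' and vs us :: "nat \<Rightarrow> bvp_data" and s :: real
    assume x': "x' \<in> Dm" "x' - x \<in> B N \<delta>" and vs: "vs \<in> Es" and us: "\<forall>k. us k \<in> B N R \<and> vs k - us k \<in> B N \<delta>"
      and s: "s \<in> {0..1}"
    have usE: "us \<in> Es" using us B_subset by (auto simp: Es_def)
    have diff: "datum x' vs k - datum x us k \<in> B N \<delta>"
      using x'(2) us by (cases k) (simp_all add: datum_def)
    have "pd ns (ph (datum x' vs k - datum x us k)) (pt x' s) = pd ns (ph (datum x' vs k)) (pt x' s) - pd ns (ph (datum x us k)) (pt x' s)"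
      using pd_diff[OF datum_CO[OF x'(1) vs] datum_CO[OF x usE] pt_Omega[OF x'(1) s]] by simp
    then have 1: "\<bar>pd ns (ph (datum x' vs k)) (pt x' s) - pd ns (ph (datum x us k)) (pt x' s)\<bar> < \<delta>"
      using B_pd[OF diff _ pt_K[OF x'(1) s], of ns] N by simp
    have "x' - x \<in> B 1 \<delta>" using x'(2) B_mono[of 1 N \<delta> \<delta>] N by auto
    note lip = y_lipschitz[OF x x'(1) this s]
    have "\<bar>pd ns (ph (datum x us k)) (s, y x' s, y' x' s) - pd ns (ph (datum x us k)) (s, y x s, y' x s)\<bar> \<le> 2 * C * (M * \<delta>)"
      using lip us N
      by (intro K_lipschitz[OF datum_CO[OF x usE] bd bd y_K[OF x s] y_K[OF x'(1) s]]) auto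
    then have 2: "\<bar>pd ns (ph (datum x us k)) (pt x' s) - pd ns (ph (datum x us k)) (pt x s)\<bar> \<le> 2 * C * (M * \<delta>)"
      by (simp add: pt_def)
    have "\<delta> + 2 * C * (M * \<delta>) = (1 + 2 * C * M) * \<delta>" by (simp add: algebra_simps)
    also have "\<dots> = \<epsilon> / 2" using pos by (simp add: \<delta>_def field_simps)
    finally have "\<delta> + 2 * C * (M * \<delta>) < \<epsilon>" using e by simp
    then show "\<bar>pd ns (ph (datum (fst (x', vs, us)) (fst (snd (x', vs, us))) k)) (pt (fst (x', vs, us)) s) -
      pd ns (ph (datum x (snd (snd (x', vs, us))) k)) (pt x s)\<bar> < \<epsilon>"
      using 1 2 unfolding fst_conv snd_conv by linarith
  qed
  ultimately show ?thesis
    unfolding ev_near_def unif_lim_def by auto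
qed

lemma bc_near:
  assumes "0 < R"
  shows "unif_lim (\<lambda>i _. fst (bc (fst (snd i)) k)) (\<lambda>i _. fst (bc (snd (snd i)) k)) (near x N R)"
    "unif_lim (\<lambda>i _. fst (snd (bc (fst (snd i)) k))) (\<lambda>i _. fst (snd (bc (snd (snd i)) k))) (near x N R)"
    "unif_bdd (\<lambda>i _. fst (bc (snd (snd i)) k)) (near x N R)"
    "unif_bdd (\<lambda>i _. fst (snd (bc (snd (snd i)) k))) (near x N R)"
proof -
  have 0: "bc us k \<in> B N R" if "\<And>k. us k \<in> B N R" for us
    using that B_zero[OF assms] by (auto simp: bc_def split: option.splits)
  have 1: "bc vs k - bc us k \<in> B N \<delta>" if "\<forall>k. us k \<in> B N R \<and> vs k - us k \<in> B N \<delta>" for us vs \<delta>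
  proof -
    have "0 < \<delta>" using that B_less by blast
    then show ?thesis using that B_zero by (cases k) (simp_all add: bc_def)
  qed
  have 2: "\<bar>fst (bc vs k) - fst (bc us k)\<bar> < \<delta>" "\<bar>fst (snd (bc vs k)) - fst (snd (bc us k))\<bar> < \<delta>"
    if "\<forall>k. us k \<in> B N R \<and> vs k - us k \<in> B N \<delta>" for us vs \<delta>
    using B_fst[OF 1[OF that]] by simp_all
  show "unif_lim (\<lambda>i _. fst (bc (fst (snd i)) k)) (\<lambda>i _. fst (bc (snd (snd i)) k)) (near x N R)"
    unfolding unif_lim_def eventually_near fst_conv snd_conv
  proof (intro allI impI)
    fix \<epsilon> :: real assume "0 < \<epsilon>"
    then show "\<exists>\<delta>>0. \<forall>x' vs us. x' \<in> Dm \<longrightarrow> x' - x \<in> B N \<delta> \<longrightarrow> vs \<in> Es \<longrightarrow>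
        (\<forall>k. us k \<in> B N R \<and> vs k - us k \<in> B N \<delta>) \<longrightarrow>
        (\<forall>s\<in>{0..1::real}. \<bar>fst (bc vs k) - fst (bc us k)\<bar> < \<epsilon>)"
      by (intro exI[of _ \<epsilon>] conjI allI impI ballI 2(1)) blast+
  qed
  show "unif_lim (\<lambda>i _. fst (snd (bc (fst (snd i)) k))) (\<lambda>i _. fst (snd (bc (snd (snd i)) k))) (near x N R)"
    unfolding unif_lim_def eventually_near fst_conv snd_conv
  proof (intro allI impI)
    fix \<epsilon> :: real assume "0 < \<epsilon>"
    then show "\<exists>\<delta>>0. \<forall>x' vs us. x' \<in> Dm \<longrightarrow> x' - x \<in> B N \<delta> \<longrightarrow> vs \<in> Es \<longrightarrow>
        (\<forall>k. us k \<in> B N R \<and> vs k - us k \<in> B N \<delta>) \<longrightarrow>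
        (\<forall>s\<in>{0..1::real}. \<bar>fst (snd (bc vs k)) - fst (snd (bc us k))\<bar> < \<epsilon>)"
      by (intro exI[of _ \<epsilon>] conjI allI impI ballI 2(2)) blast+
  qed
  have 3: "\<bar>fst (bc us k)\<bar> \<le> R" "\<bar>fst (snd (bc us k))\<bar> \<le> R" if "\<And>k. us k \<in> B N R" for us
  proof -
    have "bc us k \<in> B N R" using 0 that by blast
    then show "\<bar>fst (bc us k)\<bar> \<le> R" "\<bar>fst (snd (bc us k))\<bar> \<le> R"
      using B_fst by (simp_all add: less_imp_le)
  qed
  show "unif_bdd (\<lambda>i _. fst (bc (snd (snd i)) k)) (near x N R)"
    "unif_bdd (\<lambda>i _. fst (snd (bc (snd (snd i)) k))) (near x N R)"
    unfolding unif_bdd_def eventually_near fst_conv snd_conv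
    by (intro exI[of _ R] exI[of _ "1::real"] conjI allI impI ballI 3 zero_less_one; blast)+
qed

text \<open>The coefficients of the linearized problem are first partial derivatives, so their
  convergence along the filter already asks for order 2. The rest is
  \<open>unif_lim_solution\<close> with the stability constant of the chart.\<close>

lemma ev_near_Lin:
  assumes x: "x \<in> Dm" and N: "2 \<le> N" and R: "0 < R" and e: "ev_near x N R e"
  shows "ev_near x N R (Lin k e)" "ev_near x N R (LinVel k e)"
proof -
  let ?F = "near x N R"
  have st': "\<forall>\<^sub>F i in ?F. stable (p\<^sub>2 (fst i)) (p\<^sub>3 (fst i)) M"
    using near_Dm by eventually_elim (simp add: stable_p)
  have sol': "\<forall>\<^sub>F i in ?F. is_sol (p\<^sub>2 (fst i)) (p\<^sub>3 (fst i)) (fst (bc (fst (snd i)) k)) (fst (snd (bc (fst (snd i)) k)))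
      (ev (fst i) (fst (snd i)) e) (ev (fst i) (fst (snd i)) (Lin k e)) (ev (fst i) (fst (snd i)) (LinVel k e))"
    using near_Dm by eventually_elim (intro lin_sol_ev, auto)
  have sol: "\<forall>\<^sub>F i in ?F. is_sol (p\<^sub>2 x) (p\<^sub>3 x) (fst (bc (snd (snd i)) k)) (fst (snd (bc (snd (snd i)) k)))
      (ev x (snd (snd i)) e) (ev x (snd (snd i)) (Lin k e)) (ev x (snd (snd i)) (LinVel k e))"
    using near_Dm by eventually_elim (intro lin_sol_ev[OF x], auto)
  have P: "unif_lim (\<lambda>i. p\<^sub>2 (fst i)) (\<lambda>_. p\<^sub>2 x) ?F" "unif_lim (\<lambda>i. p\<^sub>3 (fst i)) (\<lambda>_. p\<^sub>3 x) ?F"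
    using ev_near_Der[OF x _ R, of "[1]" N None] ev_near_Der[OF x _ R, of "[2]" N None] N
    by (simp_all add: ev_near_def datum_def p\<^sub>2_def p\<^sub>3_def)
  have bdd: "unif_bdd (\<lambda>i. ev x (snd (snd i)) (Lin k e)) ?F" "unif_bdd (\<lambda>i. ev x (snd (snd i)) (LinVel k e)) ?F"
    using unif_bdd_solution[OF _ _ bc_near(3,4)[OF R],
        where Q\<^sub>2 = "\<lambda>_. p\<^sub>2 x" and Q\<^sub>3 = "\<lambda>_. p\<^sub>3 x" and M = M and g = "\<lambda>i. ev x (snd (snd i)) e"] sol e stable_p[OF x]
    by (simp_all add: ev_near_def eventually_conj_iff)
  show "ev_near x N R (Lin k e)" "ev_near x N R (LinVel k e)"
    using unif_lim_solution[OF st' sol' sol P _ bc_near(1,2)[OF R] bdd] e bdd unfolding ev_near_def by blast+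
qed

text \<open>Every larger order works too, so subexpressions are combined at the maximum of their
  orders. N must precede R: when continuity in the directions is shown, the radius that contains the
  given directions is found only after N.\<close>

lemma ev_near_all:
  assumes x: "x \<in> Dm"
  shows "\<exists>N. \<forall>N'\<ge>N. \<forall>R>0. ev_near x N' R e"
proof (induction e)
  case (Add a b)
  then obtain N1 N2 where N: "\<forall>N'\<ge>N1. \<forall>R>0. ev_near x N' R a" "\<forall>N'\<ge>N2. \<forall>R>0. ev_near x N' R b" by blast
  have "ev_near x N' R (Add a b)" if "max N1 N2 \<le> N'" "0 < R" for N' R
  proof -
    have "ev_near x N' R a" "ev_near x N' R b" using N that by auto
    then show ?thesis by (auto simp: ev_near_def intro!: unif_lim_add unif_bdd_add)
  qed
  then show ?case by blast
next
  case (Mul a b)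
  then obtain N1 N2 where N: "\<forall>N'\<ge>N1. \<forall>R>0. ev_near x N' R a" "\<forall>N'\<ge>N2. \<forall>R>0. ev_near x N' R b" by blast
  have "ev_near x N' R (Mul a b)" if "max N1 N2 \<le> N'" "0 < R" for N' R
  proof -
    have "ev_near x N' R a" "ev_near x N' R b" using N that by auto
    then show ?thesis by (auto simp: ev_near_def intro!: unif_lim_mult unif_bdd_mult)
  qed
  then show ?case by blast
next
  case (Lin k e)
  then obtain N where N: "\<forall>N'\<ge>N. \<forall>R>0. ev_near x N' R e" by blast
  then have "ev_near x N' R (Lin k e)" if "max N 2 \<le> N'" "0 < R" for N' R
    using that by (intro ev_near_Lin x) auto
  then show ?case by blast
next
  case (LinVel k e)
  then obtain N where N: "\<forall>N'\<ge>N. \<forall>R>0. ev_near x N' R e" by blast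
  then have "ev_near x N' R (LinVel k e)" if "max N 2 \<le> N'" "0 < R" for N' R
    using that by (intro ev_near_Lin x) auto
  then show ?case by blast
qed (use ev_near_Pos_Vel[OF x] ev_near_Der[OF x] in blast)+

lemma unif_lim_linear:
  assumes "\<forall>\<^sub>F t in at (0::real). \<forall>s\<in>{0..1}. \<bar>a t s - b t s\<bar> \<le> C * \<bar>t\<bar>"
  shows "unif_lim a b (at 0)"
  unfolding unif_lim_def
proof (intro allI impI)
  fix \<epsilon> :: real assume e: "0 < \<epsilon>"
  have "((\<lambda>t. C * \<bar>t\<bar>) \<longlongrightarrow> C * \<bar>0\<bar>) (at 0)" by (intro tendsto_intros)
  then have "\<forall>\<^sub>F t in at 0. C * \<bar>t\<bar> < \<epsilon>" using e by (intro order_tendstoD(2)) auto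
  with assms show "\<forall>\<^sub>F t in at 0. \<forall>s\<in>{0..1}. \<bar>a t s - b t s\<bar> < \<epsilon>"
    by eventually_elim force
qed

text \<open>Differentiability implies continuity, here for uniform convergence: the quotient is
  bounded near t = 0 and is multiplied by t.\<close>

lemma unif_lim_of_quotient:
  assumes "unif_lim (\<lambda>t s. (a t s - b s) / t) (\<lambda>_. l) (at 0)" "continuous_on {0..1} l"
  shows "unif_lim a (\<lambda>_. b) (at 0)"
proof -
  have "unif_lim (\<lambda>t _. t) (\<lambda>_ _. 0) (at 0)" by (rule unif_lim_linear[of _ _ 1]) simp
  then have "unif_lim (\<lambda>t s. t * ((a t s - b s) / t)) (\<lambda>_ _. 0) (at 0)"
    using unif_lim_bdd[OF assms(1) unif_bdd_continuous[OF assms(2)]] by (rule unif_lim_zero_mult)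
  then show ?thesis
    by (rule unif_lim_cong) (simp add: eventually_at_filter)
qed

lemma unif_lim_zero_solution:
  assumes "x \<in> Dm" "\<forall>\<^sub>F t in F. is_sol (p\<^sub>2 x) (p\<^sub>3 x) 0 0 (g t) (u t) (v t)" "unif_lim g (\<lambda>_ _. 0) F"
  shows "unif_lim u (\<lambda>_ _. 0) F" "unif_lim v (\<lambda>_ _. 0) F"
proof -
  have z: "\<forall>\<^sub>F t in F. is_sol (p\<^sub>2 x) (p\<^sub>3 x) 0 0 (\<lambda>_. 0) (\<lambda>_. 0) (\<lambda>_. 0)" by (simp add: is_sol_def)
  have b: "unif_bdd (\<lambda>_ _. 0) F" by (rule unif_bdd_continuous) simp
  have st: "\<forall>\<^sub>F t in F. stable (p\<^sub>2 x) (p\<^sub>3 x) M" using stable_p[OF assms(1)] by simp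
  show "unif_lim u (\<lambda>_ _. 0) F" "unif_lim v (\<lambda>_ _. 0) F"
    using unif_lim_solution[OF st assms(2) z unif_lim_refl unif_lim_refl assms(3) unif_lim_refl unif_lim_refl b b] by blast+
qed

end

section \<open>Difference quotients along a line in the data space\<close>

locale line = chart +
  fixes x :: bvp_data and us :: "nat \<Rightarrow> bvp_data" and j :: nat
  assumes x: "x \<in> Dm" and us: "us \<in> Es"
begin

definition X :: "real \<Rightarrow> bvp_data" where "X t = x + t *\<^sub>R us j"

text \<open>\<open>us j\<close> lies in some \<open>B 1 R\<close>, so its multiple lies in the ball
  of radius |t| R, and the chart supplies the Lipschitz constant M R. The value t = 0 is excluded
  because a ball defined by strict inequalities is empty for radius 0.\<close>

lemma X_near:
  obtains L where "0 < L"
    "\<forall>\<^sub>F t in at 0. t \<noteq> 0 \<and> X t \<in> Dm \<and> (\<forall>s\<in>{0..1}. \<bar>y (X t) s - y x s\<bar> \<le> L * \<bar>t\<bar> \<and> \<bar>y' (X t) s - y' x s\<bar> \<le> L * \<bar>t\<bar>)"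
proof -
  obtain R where R: "0 < R" "us j \<in> B 1 R" using B_absorbs[of "us j" 1] us by (auto simp: Es_def)
  obtain \<delta> where \<delta>: "0 < \<delta>" "\<forall>v\<in>B 1 \<delta>. x + v \<in> Dm" using Dm_open[OF x] by blast
  have "t \<noteq> 0 \<and> X t \<in> Dm \<and> (\<forall>s\<in>{0..1}. \<bar>y (X t) s - y x s\<bar> \<le> M * R * \<bar>t\<bar> \<and> \<bar>y' (X t) s - y' x s\<bar> \<le> M * R * \<bar>t\<bar>)"
    if t: "t \<noteq> 0" "\<bar>t\<bar> < \<delta> / R" for t
  proof (intro conjI ballI)
    have tB: "t *\<^sub>R us j \<in> B 1 (\<bar>t\<bar> * R)" by (rule B_scaleR[OF R(2) t(1)])
    moreover have "\<bar>t\<bar> * R \<le> \<delta>" using t R(1) by (simp add: pos_less_divide_eq less_imp_le)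
    ultimately have "t *\<^sub>R us j \<in> B 1 \<delta>" using B_mono by blast
    then show XD: "X t \<in> Dm" using \<delta> by (simp add: X_def)
    have "X t - x \<in> B 1 (\<bar>t\<bar> * R)" using tB by (simp add: X_def)
    from y_lipschitz[OF x XD this]
    show "\<bar>y (X t) s - y x s\<bar> \<le> M * R * \<bar>t\<bar>" "\<bar>y' (X t) s - y' x s\<bar> \<le> M * R * \<bar>t\<bar>" if "s \<in> {0..1}" for s
      using that by (simp_all add: mult_ac)
  qed (use t in simp)
  then have "\<forall>\<^sub>F t in at 0. t \<noteq> 0 \<and> X t \<in> Dm \<and> (\<forall>s\<in>{0..1}. \<bar>y (X t) s - y x s\<bar> \<le> M * R * \<bar>t\<bar> \<and> \<bar>y' (X t) s - y' x s\<bar> \<le> M * R * \<bar>t\<bar>)"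
    unfolding eventually_at using \<delta> R by (intro exI[of _ "\<delta> / R"]) (auto simp: dist_real_def)
  moreover have "0 < M * R" using R M_ge_1[OF x] by simp
  ultimately show ?thesis using that by blast
qed

lemma X_Dm: "\<forall>\<^sub>F t in at 0. t \<noteq> 0 \<and> X t \<in> Dm"
  using X_near by (rule X_near) (auto elim: eventually_mono)

lemma X_taylor:
  assumes \<phi>: "\<phi> \<in> CO \<Omega>"
  shows "\<exists>C. \<forall>\<^sub>F t in at 0. \<forall>s\<in>{0..1}. \<bar>pd ns \<phi> (pt (X t) s) - pd ns \<phi> (pt x s) -
      ((y (X t) s - y x s) * pd (ns @ [1]) \<phi> (pt x s) + (y' (X t) s - y' x s) * pd (ns @ [2]) \<phi> (pt x s))\<bar> \<le> C * t\<^sup>2"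
proof -
  obtain L where L: "0 < L"
    "\<forall>\<^sub>F t in at 0. t \<noteq> 0 \<and> X t \<in> Dm \<and> (\<forall>s\<in>{0..1}. \<bar>y (X t) s - y x s\<bar> \<le> L * \<bar>t\<bar> \<and> \<bar>y' (X t) s - y' x s\<bar> \<le> L * \<bar>t\<bar>)"
    by (rule X_near)
  obtain C where C: "0 \<le> C" "\<And>s a b a' b' m. (s, a, b) \<in> K \<Longrightarrow> (s, a', b') \<in> K \<Longrightarrow> \<bar>a' - a\<bar> \<le> m \<Longrightarrow> \<bar>b' - b\<bar> \<le> m \<Longrightarrow>
      \<bar>pd ns \<phi> (s, a', b') - pd ns \<phi> (s, a, b) -
        ((a' - a) * pd (ns @ [1]) \<phi> (s, a, b) + (b' - b) * pd (ns @ [2]) \<phi> (s, a, b))\<bar> \<le> C * m\<^sup>2"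
    using K_taylor[OF \<phi>, of ns] by blast
  from L(2) have "\<forall>\<^sub>F t in at 0. \<forall>s\<in>{0..1}. \<bar>pd ns \<phi> (pt (X t) s) - pd ns \<phi> (pt x s) -
      ((y (X t) s - y x s) * pd (ns @ [1]) \<phi> (pt x s) + (y' (X t) s - y' x s) * pd (ns @ [2]) \<phi> (pt x s))\<bar> \<le> (C * L\<^sup>2) * t\<^sup>2"
  proof eventually_elim
    case (elim t)
    then have XD: "X t \<in> Dm" by blast
    show ?case
    proof
      fix s :: real assume s: "s \<in> {0..1}"
      have "\<bar>y (X t) s - y x s\<bar> \<le> L * \<bar>t\<bar>" "\<bar>y' (X t) s - y' x s\<bar> \<le> L * \<bar>t\<bar>" using elim s by blast+
      from C(2)[OF y_K[OF x s] y_K[OF XD s] this]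
      show "\<bar>pd ns \<phi> (pt (X t) s) - pd ns \<phi> (pt x s) -
        ((y (X t) s - y x s) * pd (ns @ [1]) \<phi> (pt x s) + (y' (X t) s - y' x s) * pd (ns @ [2]) \<phi> (pt x s))\<bar> \<le> (C * L\<^sup>2) * t\<^sup>2"
        by (simp add: pt_def power_mult_distrib mult.assoc)
    qed
  qed
  then show ?thesis by (rule exI[of _ "C * L\<^sup>2"])
qed

lemma X_remainder:
  assumes \<phi>: "\<phi> \<in> CO \<Omega>"
  shows "unif_lim (\<lambda>t s. (pd ns \<phi> (pt (X t) s) - pd ns \<phi> (pt x s) -
      ((y (X t) s - y x s) * pd (ns @ [1]) \<phi> (pt x s) + (y' (X t) s - y' x s) * pd (ns @ [2]) \<phi> (pt x s))) / t)
    (\<lambda>_ _. 0) (at 0)" (is "unif_lim (\<lambda>t s. ?rem t s / t) _ _")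
proof -
  obtain C where C: "\<forall>\<^sub>F t in at 0. \<forall>s\<in>{0..1}. \<bar>?rem t s\<bar> \<le> C * t\<^sup>2"
    using X_taylor[OF \<phi>, of ns] by (elim exE)
  have "\<forall>\<^sub>F t in at 0. \<forall>s\<in>{0..1}. \<bar>?rem t s / t - 0\<bar> \<le> C * \<bar>t\<bar>"
    using C X_Dm
  proof eventually_elim
    case (elim t)
    show ?case
    proof
      fix s :: real assume "s \<in> {0..1}"
      then have "\<bar>?rem t s\<bar> \<le> C * t\<^sup>2" using elim by blast
      then have "\<bar>?rem t s\<bar> \<le> C * \<bar>t\<bar> * \<bar>t\<bar>" by (simp add: power2_eq_square mult.assoc)
      moreover have "0 < \<bar>t\<bar>" using elim by simp
      ultimately have "\<bar>?rem t s\<bar> / \<bar>t\<bar> \<le> C * \<bar>t\<bar>" by (simp only: pos_divide_le_eq)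
      then show "\<bar>?rem t s / t - 0\<bar> \<le> C * \<bar>t\<bar>" by (simp only: abs_divide diff_zero)
    qed
  qed
  then show ?thesis by (rule unif_lim_linear)
qed

lemma X_curve:
  assumes \<phi>: "\<phi> \<in> CO \<Omega>"
  shows "unif_lim (\<lambda>t s. pd ns \<phi> (pt (X t) s)) (\<lambda>_ s. pd ns \<phi> (pt x s)) (at 0)"
proof -
  obtain L where L: "0 < L"
    "\<forall>\<^sub>F t in at 0. t \<noteq> 0 \<and> X t \<in> Dm \<and> (\<forall>s\<in>{0..1}. \<bar>y (X t) s - y x s\<bar> \<le> L * \<bar>t\<bar> \<and> \<bar>y' (X t) s - y' x s\<bar> \<le> L * \<bar>t\<bar>)"
    by (rule X_near)
  obtain C where C: "0 < C" "\<And>ms z. length ms \<le> length ns + 1 \<Longrightarrow> z \<in> K \<Longrightarrow> \<bar>pd ms \<phi> z\<bar> < C"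
    using pd_bounded[OF \<phi>] by blast
  have C': "\<bar>pd (ns @ [n]) \<phi> z\<bar> \<le> C" if "z \<in> K" for n z using C(2)[OF _ that, of "ns @ [n]"] by simp
  from L(2) have "\<forall>\<^sub>F t in at 0. \<forall>s\<in>{0..1}. \<bar>pd ns \<phi> (pt (X t) s) - pd ns \<phi> (pt x s)\<bar> \<le> (2 * C * L) * \<bar>t\<bar>"
  proof eventually_elim
    case (elim t)
    then have XD: "X t \<in> Dm" by blast
    show ?case
    proof
      fix s :: real assume s: "s \<in> {0..1}"
      have "\<bar>y (X t) s - y x s\<bar> \<le> L * \<bar>t\<bar>" "\<bar>y' (X t) s - y' x s\<bar> \<le> L * \<bar>t\<bar>" using elim s by blast+
      from K_lipschitz[OF \<phi> C' C' y_K[OF x s] y_K[OF XD s] this]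
      show "\<bar>pd ns \<phi> (pt (X t) s) - pd ns \<phi> (pt x s)\<bar> \<le> (2 * C * L) * \<bar>t\<bar>"
        by (simp add: pt_def mult.assoc)
    qed
  qed
  then show ?thesis by (rule unif_lim_linear)
qed

text \<open>The identity is exact: along the line the nonlinearity is affine in t, so the Taylor
  remainder comes only from the motion of the curve.\<close>

lemma pd_X: "X t \<in> Dm \<Longrightarrow> s \<in> {0..1} \<Longrightarrow>
  pd ns (ph (X t)) (pt (X t) s) = pd ns (ph x) (pt (X t) s) + t * pd ns (ph (us j)) (pt (X t) s)"
  using pd_linear[of "ph (us j)" "ph x" "pt (X t) s" ns t] us x ph_CO Dm_CO pt_Omega
  by (simp add: X_def Es_def add.commute)

lemma zero_sol: "is_sol (p\<^sub>2 x) (p\<^sub>3 x) 0 0 (\<lambda>_. 0) (\<lambda>_. 0) (\<lambda>_. 0)"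
  by (simp add: is_sol_def)

text \<open>The quotient minus its candidate limit solves the linear problem at the base point with
  zero boundary values. Its source is the Taylor remainder over t plus the change of the direction's
  function between the two curves. Both tend to zero uniformly, and stability carries this over to
  the quotient.\<close>

lemma X_solution:
  shows "unif_lim (\<lambda>t s. (y (X t) s - y x s) / t) (\<lambda>_. ev x us (pos_deriv j)) (at 0)"
    and "unif_lim (\<lambda>t s. (y' (X t) s - y' x s) / t) (\<lambda>_. ev x us (vel_deriv j)) (at 0)"
proof -
  have CO: "ph x \<in> CO \<Omega>" "ph (us j) \<in> CO \<Omega>" using Dm_CO[OF x] us ph_CO by (auto simp: Es_def)
  define Z where "Z = ev x us (pos_deriv j)"
  define Z' where "Z' = ev x us (vel_deriv j)"
  define rem where "rem = (\<lambda>t s. pd [] (ph x) (pt (X t) s) - pd [] (ph x) (pt x s) -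
      ((y (X t) s - y x s) * pd ([] @ [1]) (ph x) (pt x s) + (y' (X t) s - y' x s) * pd ([] @ [2]) (ph x) (pt x s)))"
  define g where "g = (\<lambda>t s. rem t s / t + (pd [] (ph (us j)) (pt (X t) s) - pd [] (ph (us j)) (pt x s)))"
  have Z: "is_sol (p\<^sub>2 x) (p\<^sub>3 x) (fst (us j)) (fst (snd (us j))) (\<lambda>s. pd [] (ph (us j)) (pt x s)) Z Z'"
    using lin_sol_ev[OF x us, of "Some j" "Der [] (Some j)"]
    by (simp add: Z_def Z'_def pos_deriv_def vel_deriv_def bc_def datum_def)
  have sol: "\<forall>\<^sub>F t in at 0. is_sol (p\<^sub>2 x) (p\<^sub>3 x) 0 0 (g t)
      (\<lambda>s. (y (X t) s - y x s) / t - Z s) (\<lambda>s. (y' (X t) s - y' x s) / t - Z' s)"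
    using X_Dm
  proof eventually_elim
    case (elim t)
    let ?G = "\<lambda>s. rem t s + t * pd [] (ph (us j)) (pt (X t) s)"
    have "is_sol (p\<^sub>2 x) (p\<^sub>3 x) (t * fst (us j)) (t * fst (snd (us j))) ?G
        (\<lambda>s. y (X t) s - y x s) (\<lambda>s. y' (X t) s - y' x s)"
      unfolding is_sol_def
    proof (intro conjI ballI)
      show "y (X t) 0 - y x 0 = t * fst (us j)" "y (X t) 1 - y x 1 = t * fst (snd (us j))"
        using y_bc x elim by (simp_all add: X_def)
      fix s :: real assume s: "s \<in> {0..1}"
      show "((\<lambda>s. y (X t) s - y x s) has_real_derivative y' (X t) s - y' x s) (at s within {0..1})"
        using elim x s by (intro DERIV_diff y_deriv) auto
      have "((\<lambda>s. y' (X t) s - y' x s) has_real_derivative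
          pd [] (ph (X t)) (s, y (X t) s, y' (X t) s) - pd [] (ph x) (s, y x s, y' x s)) (at s within {0..1})"
        using elim x s by (intro DERIV_diff y'_deriv) auto
      then show "((\<lambda>s. y' (X t) s - y' x s) has_real_derivative
          p\<^sub>3 x s * (y' (X t) s - y' x s) + p\<^sub>2 x s * (y (X t) s - y x s) + ?G s) (at s within {0..1})"
        by (rule DERIV_cong)
          (use pd_X[of t s "[]"] elim s in \<open>simp add: pt_def[symmetric] p\<^sub>2_def p\<^sub>3_def rem_def algebra_simps\<close>)
    qed
    from is_sol_diff[OF is_sol_linear_combination[OF this zero_sol, of "1/t"] Z]
    have "is_sol (p\<^sub>2 x) (p\<^sub>3 x) 0 0 (\<lambda>s. 1/t * ?G s - pd [] (ph (us j)) (pt x s))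
        (\<lambda>s. 1/t * (y (X t) s - y x s) - Z s) (\<lambda>s. 1/t * (y' (X t) s - y' x s) - Z' s)"
      using elim by simp
    moreover have "(\<lambda>s. 1/t * ?G s - pd [] (ph (us j)) (pt x s)) = g t"
      using elim by (simp add: g_def fun_eq_iff add_divide_distrib)
    ultimately show ?case by simp
  qed
  have "unif_lim (\<lambda>t s. rem t s / t) (\<lambda>_ _. 0) (at 0)"
    unfolding rem_def by (rule X_remainder[OF CO(1)])
  from unif_lim_add[OF this iffD1[OF unif_lim_iff_diff X_curve[OF CO(2), of "[]"]]]
  have "unif_lim g (\<lambda>_ _. 0) (at 0)" by (simp add: g_def)
  from unif_lim_zero_solution[OF x sol this]
  show "unif_lim (\<lambda>t s. (y (X t) s - y x s) / t) (\<lambda>_. ev x us (pos_deriv j)) (at 0)"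
    and "unif_lim (\<lambda>t s. (y' (X t) s - y' x s) / t) (\<lambda>_. ev x us (vel_deriv j)) (at 0)"
    unfolding Z_def[symmetric] Z'_def[symmetric] by (simp_all add: unif_lim_iff_diff[of _ "\<lambda>_. Z"] unif_lim_iff_diff[of _ "\<lambda>_. Z'"])
qed

lemma X_curve_quotient:
  assumes \<phi>: "\<phi> \<in> CO \<Omega>"
  shows "unif_lim (\<lambda>t s. (pd ns \<phi> (pt (X t) s) - pd ns \<phi> (pt x s)) / t)
    (\<lambda>_ s. pd (ns @ [1]) \<phi> (pt x s) * ev x us (pos_deriv j) s + pd (ns @ [2]) \<phi> (pt x s) * ev x us (vel_deriv j) s) (at 0)"
proof -
  have b: "unif_bdd (\<lambda>_ s. pd ms \<phi> (pt x s)) (at (0::real))" "unif_bdd (\<lambda>_. ev x us e) (at (0::real))" for ms e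
    by (intro unif_bdd_continuous curve_continuous[OF \<phi> x] ev_continuous[OF x us])+
  have "unif_lim (\<lambda>t s. pd (ns @ [1]) \<phi> (pt x s) * ((y (X t) s - y x s) / t) + pd (ns @ [2]) \<phi> (pt x s) * ((y' (X t) s - y' x s) / t))
    (\<lambda>_ s. pd (ns @ [1]) \<phi> (pt x s) * ev x us (pos_deriv j) s + pd (ns @ [2]) \<phi> (pt x s) * ev x us (vel_deriv j) s) (at 0)"
    by (intro unif_lim_add unif_lim_mult unif_lim_refl X_solution b)
  note L = unif_lim_add[OF X_remainder[OF \<phi>, of ns] this]
  have split: "A / t = (A - (d\<^sub>1 * q\<^sub>1 + d\<^sub>2 * q\<^sub>2)) / t + (q\<^sub>1 * (d\<^sub>1 / t) + q\<^sub>2 * (d\<^sub>2 / t))"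
    for A t d\<^sub>1 d\<^sub>2 q\<^sub>1 q\<^sub>2 :: real
    by (cases "t = 0") (simp_all add: field_simps)
  have F: "(\<lambda>t s. (pd ns \<phi> (pt (X t) s) - pd ns \<phi> (pt x s)) / t) =
    (\<lambda>t s. (pd ns \<phi> (pt (X t) s) - pd ns \<phi> (pt x s) -
      ((y (X t) s - y x s) * pd (ns @ [1]) \<phi> (pt x s) + (y' (X t) s - y' x s) * pd (ns @ [2]) \<phi> (pt x s))) / t +
      (pd (ns @ [1]) \<phi> (pt x s) * ((y (X t) s - y x s) / t) + pd (ns @ [2]) \<phi> (pt x s) * ((y' (X t) s - y' x s) / t)))"
    by (intro ext) (rule split)
  show ?thesis unfolding F using L by (simp only: add_0_left)
qed

lemma X_Der:
  "unif_lim (\<lambda>t s. (ev (X t) us (Der ns k) s - ev x us (Der ns k) s) / t) (\<lambda>_. ev x us (der_deriv j ns k)) (at 0)"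
proof (cases k)
  case None
  have CO: "ph x \<in> CO \<Omega>" "ph (us j) \<in> CO \<Omega>" using Dm_CO[OF x] us ph_CO by (auto simp: Es_def)
  show ?thesis
  proof (rule unif_lim_cong[OF unif_lim_add[OF X_curve_quotient[OF CO(1), of ns] X_curve[OF CO(2), of ns]]])
    show "\<forall>\<^sub>F t in at 0. \<forall>s\<in>{0..1}. (ev (X t) us (Der ns k) s - ev x us (Der ns k) s) / t - ev x us (der_deriv j ns k) s =
        (pd ns (ph x) (pt (X t) s) - pd ns (ph x) (pt x s)) / t + pd ns (ph (us j)) (pt (X t) s) -
        (pd (ns @ [1]) (ph x) (pt x s) * ev x us (pos_deriv j) s + pd (ns @ [2]) (ph x) (pt x s) * ev x us (vel_deriv j) s +
         pd ns (ph (us j)) (pt x s))"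
      using X_Dm
    proof eventually_elim
      case (elim t)
      show ?case
      proof
        fix s :: real assume s: "s \<in> {0..1}"
        have "(ev (X t) us (Der ns k) s - ev x us (Der ns k) s) / t =
            (pd ns (ph x) (pt (X t) s) - pd ns (ph x) (pt x s)) / t + pd ns (ph (us j)) (pt (X t) s)"
          using pd_X[OF _ s, of t ns] elim None by (simp add: datum_def field_simps)
        then show "(ev (X t) us (Der ns k) s - ev x us (Der ns k) s) / t - ev x us (der_deriv j ns k) s =
          (pd ns (ph x) (pt (X t) s) - pd ns (ph x) (pt x s)) / t + pd ns (ph (us j)) (pt (X t) s) -
          (pd (ns @ [1]) (ph x) (pt x s) * ev x us (pos_deriv j) s + pd (ns @ [2]) (ph x) (pt x s) * ev x us (vel_deriv j) s +
           pd ns (ph (us j)) (pt x s))"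
          by (simp add: None der_deriv_def datum_def Let_def)
      qed
    qed
  qed
next
  case (Some i)
  have "ph (us i) \<in> CO \<Omega>" using us ph_CO by (simp add: Es_def)
  from X_curve_quotient[OF this, of ns] show ?thesis
    by (simp add: Some der_deriv_def datum_def Let_def)
qed

text \<open>The solution at \<open>X t\<close> is rewritten as a solution with the coefficients at
  \<open>x\<close>, the coefficient differences becoming part of the source. After subtraction and
  division by t the boundary values cancel and the source tends to \<open>lin_source\<close>, so the
  quotient converges by stability.\<close>

lemma X_Lin:
  assumes IH: "unif_lim (\<lambda>t s. (ev (X t) us e s - ev x us e s) / t) (\<lambda>_. ev x us e') (at 0)"
  shows "unif_lim (\<lambda>t s. (ev (X t) us (Lin k e) s - ev x us (Lin k e) s) / t)
      (\<lambda>_. ev x us (Lin None (lin_source j k e e'))) (at 0)"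
    and "unif_lim (\<lambda>t s. (ev (X t) us (LinVel k e) s - ev x us (LinVel k e) s) / t)
      (\<lambda>_. ev x us (LinVel None (lin_source j k e e'))) (at 0)"
proof -
  note ec = ev_continuous[OF x us]
  let ?u = "\<lambda>t. ev (X t) us (Lin k e)" and ?v = "\<lambda>t. ev (X t) us (LinVel k e)"
  have sol': "\<forall>\<^sub>F t in at 0. is_sol (p\<^sub>2 (X t)) (p\<^sub>3 (X t)) (fst (bc us k)) (fst (snd (bc us k))) (ev (X t) us e) (?u t) (?v t)"
    using X_Dm by eventually_elim (intro lin_sol_ev us, auto)
  have sol: "is_sol (p\<^sub>2 x) (p\<^sub>3 x) (fst (bc us k)) (fst (snd (bc us k))) (ev x us e) (ev x us (Lin k e)) (ev x us (LinVel k e))"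
    by (rule lin_sol_ev[OF x us])
  have st: "\<forall>\<^sub>F t in at 0. stable (p\<^sub>2 (X t)) (p\<^sub>3 (X t)) M"
    using X_Dm by eventually_elim (simp add: stable_p)
  have p: "p\<^sub>2 x' = ev x' us (Der [1] None)" "p\<^sub>3 x' = ev x' us (Der [2] None)" for x'
    by (simp_all add: p\<^sub>2_def p\<^sub>3_def datum_def)
  have lim: "unif_lim (\<lambda>t. ev (X t) us f) (\<lambda>_. ev x us f) (at 0)"
    if "unif_lim (\<lambda>t s. (ev (X t) us f s - ev x us f s) / t) (\<lambda>_. ev x us f') (at 0)" for f f'
    using unif_lim_of_quotient[OF that ec] .
  have P: "unif_lim (\<lambda>t. p\<^sub>2 (X t)) (\<lambda>_. p\<^sub>2 x) (at 0)" "unif_lim (\<lambda>t. p\<^sub>3 (X t)) (\<lambda>_. p\<^sub>3 x) (at 0)"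
    unfolding p by (rule lim[OF X_Der])+
  have b: "unif_bdd (\<lambda>_. ev x us f) (at (0::real))" for f by (rule unif_bdd_continuous[OF ec])
  \<comment> \<open>Convergence of the solutions themselves is needed first, since they multiply the
    coefficient quotients in \<open>?g\<close>.\<close>
  have uv: "unif_lim ?u (\<lambda>_. ev x us (Lin k e)) (at 0)" "unif_lim ?v (\<lambda>_. ev x us (LinVel k e)) (at 0)"
    by (rule unif_lim_solution[OF st sol' always_eventually[OF allI[OF sol]] P lim[OF IH] unif_lim_refl unif_lim_refl b b])+
  let ?src = "lin_source j k e e'"
  let ?z = "ev x us (Lin None ?src)" and ?z' = "ev x us (LinVel None ?src)"
  have z: "is_sol (p\<^sub>2 x) (p\<^sub>3 x) 0 0 (ev x us ?src) ?z ?z'"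
    using lin_sol_ev[OF x us, of None ?src] by (simp add: bc_def)
  let ?g = "\<lambda>t s. (ev (X t) us e s - ev x us e s) / t + ((p\<^sub>3 (X t) s - p\<^sub>3 x s) / t * ?v t s + (p\<^sub>2 (X t) s - p\<^sub>2 x s) / t * ?u t s)"
  have g: "unif_lim ?g (\<lambda>_ s. ev x us e' s + (ev x us (der_deriv j [2] None) s * ev x us (LinVel k e) s +
      ev x us (der_deriv j [1] None) s * ev x us (Lin k e) s)) (at 0)"
    unfolding p by (intro unif_lim_add unif_lim_mult IH X_Der uv b)
  then have g: "unif_lim (\<lambda>t s. ?g t s - ev x us ?src s) (\<lambda>_ _. 0) (at 0)"
    unfolding lin_source_def ev.simps(4,5) by (rule iffD1[OF unif_lim_iff_diff])
  have "\<forall>\<^sub>F t in at 0. is_sol (p\<^sub>2 x) (p\<^sub>3 x) 0 0 (\<lambda>s. ?g t s - ev x us ?src s)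
      (\<lambda>s. (?u t s - ev x us (Lin k e) s) / t - ?z s) (\<lambda>s. (?v t s - ev x us (LinVel k e) s) / t - ?z' s)"
    using sol' X_Dm
  proof eventually_elim
    case (elim t)
    have "is_sol (p\<^sub>2 x) (p\<^sub>3 x) (fst (bc us k)) (fst (snd (bc us k)))
        (\<lambda>s. ev (X t) us e s + ((p\<^sub>3 (X t) s - p\<^sub>3 x s) * ?v t s + (p\<^sub>2 (X t) s - p\<^sub>2 x s) * ?u t s)) (?u t) (?v t)"
      by (rule is_sol_change[OF elim(1)]) (simp add: algebra_simps)
    from is_sol_diff[OF is_sol_linear_combination[OF is_sol_diff[OF this sol] zero_sol, of "1/t"] z]
    have s: "is_sol (p\<^sub>2 x) (p\<^sub>3 x) 0 0
        (\<lambda>s. 1/t * (ev (X t) us e s + ((p\<^sub>3 (X t) s - p\<^sub>3 x s) * ?v t s + (p\<^sub>2 (X t) s - p\<^sub>2 x s) * ?u t s) - ev x us e s)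
          - ev x us ?src s)
        (\<lambda>s. 1/t * (?u t s - ev x us (Lin k e) s) - ?z s) (\<lambda>s. 1/t * (?v t s - ev x us (LinVel k e) s) - ?z' s)"
      by (simp del: ev.simps)
    have u: "(\<lambda>s. 1/t * (?u t s - ev x us (Lin k e) s) - ?z s) = (\<lambda>s. (?u t s - ev x us (Lin k e) s) / t - ?z s)"
      "(\<lambda>s. 1/t * (?v t s - ev x us (LinVel k e) s) - ?z' s) = (\<lambda>s. (?v t s - ev x us (LinVel k e) s) / t - ?z' s)"
      by (simp_all del: ev.simps)
    show ?case
      by (rule is_sol_change[OF s[unfolded u]]) (simp del: ev.simps add: add_divide_distrib diff_divide_distrib algebra_simps)
  qed
  from unif_lim_zero_solution[OF x this g]
  show "unif_lim (\<lambda>t s. (?u t s - ev x us (Lin k e) s) / t) (\<lambda>_. ?z) (at 0)"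
    and "unif_lim (\<lambda>t s. (?v t s - ev x us (LinVel k e) s) / t) (\<lambda>_. ?z') (at 0)"
    unfolding unif_lim_iff_diff[of _ "\<lambda>_. ?z"] unif_lim_iff_diff[of _ "\<lambda>_. ?z'"] .
qed

lemma X_quotient:
  "unif_lim (\<lambda>t s. (ev (X t) us e s - ev x us e s) / t) (\<lambda>_. ev x us (dir_deriv_exp j e)) (at 0)"
proof (induction e)
  case Pos
  then show ?case using X_solution(1) by simp
next
  case Vel
  then show ?case using X_solution(2) by simp
next
  case (Der ns k)
  then show ?case using X_Der by simp
next
  case (Add a b)
  from unif_lim_add[OF Add.IH] show ?case
    by (rule unif_lim_cong) (simp add: diff_divide_distrib add_divide_distrib)
next
  case (Mul a b)
  note ec = ev_continuous[OF x us]
  have b: "unif_bdd (\<lambda>_. ev x us f) (at (0::real))" for f by (rule unif_bdd_continuous[OF ec])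
  have "unif_lim (\<lambda>t s. (ev (X t) us a s - ev x us a s) / t * ev (X t) us b s + (ev (X t) us b s - ev x us b s) / t * ev x us a s)
      (\<lambda>_ s. ev x us (dir_deriv_exp j a) s * ev x us b s + ev x us (dir_deriv_exp j b) s * ev x us a s) (at 0)"
    by (intro unif_lim_add unif_lim_mult Mul.IH unif_lim_of_quotient[OF Mul.IH(2) ec] unif_lim_refl b)
  then show ?case
    by (rule unif_lim_cong) (simp add: diff_divide_distrib algebra_simps)
next
  case (Lin k e)
  then show ?case using X_Lin(1) by (simp del: ev.simps)
next
  case (LinVel k e)
  then show ?case using X_Lin(2) by (simp del: ev.simps)
qed

end

subsection \<open>The solution map of a chart is of class \<open>C\<^sup>\<infinity>\<^sub>\<pi>\<close>\<close>

text \<open>With \<open>c\<close> an antiderivative of the limit \<open>b\<close>, the functions q i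
  - c have uniformly small derivatives and hence small increments. In the limit a - c is constant,
  so \<open>a\<close> inherits the derivative of \<open>c\<close>.\<close>

lemma has_real_derivative_uniform_limit:
  fixes a b :: "real \<Rightarrow> real"
  assumes F: "F \<noteq> bot"
    and lim: "unif_lim q (\<lambda>_. a) F" "unif_lim q' (\<lambda>_. b) F" and b: "continuous_on {0..1} b"
    and q: "\<forall>\<^sub>F i in F. \<forall>s\<in>{0..1}. (q i has_real_derivative q' i s) (at s within {0..1})"
    and s: "s \<in> {0..1}"
  shows "(a has_real_derivative b s) (at s within {0..1})"
proof -
  define c where "c = (\<lambda>s. integral {0..s} b)"
  have c: "(c has_real_derivative b s) (at s within {0..1})" if "s \<in> {0..1}" for s
    unfolding c_def by (rule integral_has_real_derivative[OF b that])
  have eq: "a s = c s + (a 0 - c 0)" if s: "s \<in> {0..1}" for s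
  proof -
    have "\<bar>a s - c s - (a 0 - c 0)\<bar> \<le> 0 + \<epsilon>" if e: "0 < \<epsilon>" for \<epsilon>
    proof -
      have "0 < \<epsilon> / 3" using e by simp
      from eventually_happens'[OF F eventually_conj[OF q eventually_conj[OF unif_limD[OF lim(1) this] unif_limD[OF lim(2) this]]]]
      obtain i where i: "\<forall>s\<in>{0..1}. (q i has_real_derivative q' i s) (at s within {0..1})"
        "\<forall>s\<in>{0..1}. \<bar>q i s - a s\<bar> < \<epsilon> / 3" "\<forall>s\<in>{0..1}. \<bar>q' i s - b s\<bar> < \<epsilon> / 3" by blast
      have "norm ((\<lambda>s. q i s - c s) s - (\<lambda>s. q i s - c s) 0) \<le> \<epsilon> / 3 * norm (s - 0)"
      proof (rule field_differentiable_bound[where S = "{0..1}"])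
        show "((\<lambda>s. q i s - c s) has_real_derivative q' i t - b t) (at t within {0..1})" if "t \<in> {0..1}" for t
          using i(1) c that by (intro DERIV_diff) auto
        show "norm (q' i t - b t) \<le> \<epsilon> / 3" if "t \<in> {0..1}" for t
          using i(3) that less_imp_le by fastforce
      qed (use s in auto)
      also have "\<dots> \<le> \<epsilon> / 3" using s e by (simp add: mult_left_le)
      finally have "\<bar>q i s - c s - (q i 0 - c 0)\<bar> \<le> \<epsilon> / 3" by simp
      moreover have "\<bar>q i s - a s\<bar> < \<epsilon> / 3" "\<bar>q i 0 - a 0\<bar> < \<epsilon> / 3" using i(2) s by auto
      ultimately show ?thesis by linarith
    qed
    then have "\<bar>a s - c s - (a 0 - c 0)\<bar> \<le> 0" by (rule field_le_epsilon)
    then show ?thesis by simp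
  qed
  have "((\<lambda>s. c s + (a 0 - c 0)) has_real_derivative b s + 0) (at s within {0..1})"
    by (intro DERIV_add c DERIV_const s)
  from DERIV_transform_on[OF this s eq] show ?thesis by simp
qed

text \<open>
  The two formal derivatives do not commute as expressions. Their values commute, because a uniform
  limit of difference quotients may be differentiated termwise.
\<close>

lemma (in line) time_deriv_dir_deriv:
  assumes "s \<in> {0..1}"
  shows "ev x us (dir_deriv_exp j (time_deriv e)) s = ev x us (time_deriv (dir_deriv_exp j e)) s"
proof -
  have "\<forall>\<^sub>F t in at 0. \<forall>s\<in>{0..1}. ((\<lambda>s. (ev (X t) us e s - ev x us e s) / t) has_real_derivative
      (ev (X t) us (time_deriv e) s - ev x us (time_deriv e) s) / t) (at s within {0..1})"
    using X_Dm
    by eventually_elim (use us x in \<open>auto intro!: DERIV_cdivide DERIV_diff ev_deriv\<close>)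
  from has_real_derivative_uniform_limit[OF _ X_quotient X_quotient ev_continuous[OF x us] this assms]
  have "(ev x us (dir_deriv_exp j e) has_real_derivative ev x us (dir_deriv_exp j (time_deriv e)) s) (at s within {0..1})"
    by simp
  from vector_derivative_unit_interval[OF this assms]
    vector_derivative_unit_interval[OF ev_deriv[OF x us assms, of "dir_deriv_exp j e"] assms]
  show ?thesis by simp
qed

text \<open>The commutation is an equality of values on the whole interval, so it can itself be
  differentiated, which gives the induction step without any identity between expressions.\<close>

lemma (in line) time_derivs_dir_deriv:
  assumes "s \<in> {0..1}"
  shows "ev x us (dir_deriv_exp j ((time_deriv ^^ k) e)) s = ev x us ((time_deriv ^^ k) (dir_deriv_exp j e)) s"
  using assms
proof (induction k arbitrary: s)
  case (Suc k)
  let ?a = "dir_deriv_exp j ((time_deriv ^^ k) e)" and ?b = "(time_deriv ^^ k) (dir_deriv_exp j e)"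
  have "(ev x us ?a has_real_derivative ev x us (time_deriv ?b) s) (at s within {0..1})"
    by (rule DERIV_transform_on[OF ev_deriv[OF x us Suc.prems]]) (use Suc in auto)
  from vector_derivative_unit_interval[OF this Suc.prems]
    vector_derivative_unit_interval[OF ev_deriv[OF x us Suc.prems, of ?a] Suc.prems]
  have "ev x us (time_deriv ?a) s = ev x us (time_deriv ?b) s" by simp
  then show ?case using time_deriv_dir_deriv[OF Suc.prems] by simp
qed simp

lemma CI_combine:
  assumes "f \<in> CI i" "g \<in> CI i"
  shows "c *\<^sub>R (f - g) \<in> CI i"
    and "\<And>k s. enat k \<le> i \<Longrightarrow> s \<in> {0..1} \<Longrightarrow> ideriv k (c *\<^sub>R (f - g)) s = c * (ideriv k f s - ideriv k g s)"
proof -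
  have d: "f - g = (-1) *\<^sub>R g + f" by simp
  have dg: "f - g \<in> CI i" unfolding d by (rule CI_linear_combination(1)[OF assms(2,1)])
  have e: "c *\<^sub>R (f - g) = c *\<^sub>R (f - g) + 0" by simp
  show "c *\<^sub>R (f - g) \<in> CI i" by (subst e) (rule CI_linear_combination(1)[OF dg zero_in_CI])
  fix k s assume k: "enat k \<le> i" and s: "s \<in> {0..1::real}"
  have A: "ideriv k (c *\<^sub>R (f - g)) s = c * ideriv k (f - g) s + ideriv k 0 s"
    by (subst e) (rule CI_linear_combination(2)[OF dg zero_in_CI k s])
  have B: "ideriv k (f - g) s = (-1) * ideriv k g s + ideriv k f s"
    unfolding d by (rule CI_linear_combination(2)[OF assms(2,1) k s])
  show "ideriv k (c *\<^sub>R (f - g)) s = c * (ideriv k f s - ideriv k g s)"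
    by (simp only: A B ideriv_zero[OF s]) (simp add: algebra_simps)
qed

context tube
begin

lemma topspace_data: "topspace (data_topology \<Omega>) = E"
  by (auto simp: data_topology_def CO_topology_def E_def)

text \<open>The index lists of bounded length lead to only finitely many differential operators on
  the single compact set \<open>K\<close>, so the seminorms behind \<open>B N\<close> are controlled
  by one basic neighbourhood of the topology.\<close>

lemma B_translate_nhd:
  assumes w: "w \<in> E" and \<delta>: "0 < \<delta>"
  shows "\<exists>U. openin (data_topology \<Omega>) U \<and> w \<in> U \<and> (\<forall>v\<in>U. v \<in> E \<and> v - w \<in> B N \<delta>)"
proof -
  define L where "L = {bs. set bs \<subseteq> (Basis :: real3 set) \<and> length bs \<le> N}"
  have L: "finite L" unfolding L_def by (rule finite_lists_length_le) simp
  let ?Q = "(\<lambda>bs. (ext_partial \<Omega> bs, K)) ` L"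
  have phw: "ph w \<in> CO \<Omega>" using w by (simp add: E_def)
  have "?Q \<subseteq> {(ext_partial \<Omega> bs, K) |bs K. bs \<in> lists Basis \<and> compact K \<and> K \<subseteq> \<Omega>}"
    using compact_K K_subset by (auto simp: L_def)
  from uniform_open_nhd[OF finite_imageI[OF L] this phw \<delta>]
  obtain U where U: "openin (CO_topology \<Omega>) U" "ph w \<in> U" "U \<subseteq> uniform_nhd (CO \<Omega>) ?Q \<delta> (ph w)"
    unfolding CO_topology_def by blast
  show ?thesis
  proof (intro exI[of _ "ball (fst w) \<delta> \<times> ball (fst (snd w)) \<delta> \<times> U"] conjI ballI)
    show "openin (data_topology \<Omega>) (ball (fst w) \<delta> \<times> ball (fst (snd w)) \<delta> \<times> U)"
      unfolding data_topology_def using U(1) by (simp add: openin_prod_Times_iff)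
    show "w \<in> ball (fst w) \<delta> \<times> ball (fst (snd w)) \<delta> \<times> U"
      using U(2) \<delta> by (cases w) auto
    fix v assume v: "v \<in> ball (fst w) \<delta> \<times> ball (fst (snd w)) \<delta> \<times> U"
    then have phv: "ph v \<in> uniform_nhd (CO \<Omega>) ?Q \<delta> (ph w)" using U(3) by auto
    then have phv': "ph v \<in> CO \<Omega>" by (simp add: uniform_nhd_def)
    then have vE: "v \<in> E" by (simp add: E_def)
    have "\<bar>pd ns (ph (v - w)) z\<bar> < \<delta>" if "length ns \<le> N" "z \<in> K" for ns z
    proof -
      have "map dirvec ns \<in> L" using that by (auto simp: L_def)
      then have "\<bar>pd ns (ph v) z - pd ns (ph w) z\<bar> < \<delta>"
        using phv that(2) by (force simp: uniform_nhd_def pd_def)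
      then show ?thesis using pd_diff[OF phv' phw, of z ns] that K_subset by auto
    qed
    then show "v - w \<in> B N \<delta>"
      using v vE E_diff[OF vE w] by (auto simp: B_def dist_real_def abs_minus_commute)
    show "v \<in> E" by (rule vE)
  qed
qed

lemma zero_nhd_B: "0 < \<delta> \<Longrightarrow> zero_nhd (data_topology \<Omega>) (B N \<delta>)"
proof -
  assume "0 < \<delta>"
  from B_translate_nhd[OF E_zero this, of N] obtain U where
    "openin (data_topology \<Omega>) U" "0 \<in> U" "\<forall>v\<in>U. v \<in> E \<and> v - 0 \<in> B N \<delta>" by blast
  then show ?thesis
    unfolding zero_nhd_def topspace_data using B_subset by (intro conjI exI[of _ U]) auto
qed

end

section \<open>Expressions as partial functions from the data into the smooth functions on the
  interval\<close>

context chart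
begin

definition rep :: "bexp \<Rightarrow> bvp_data \<Rightarrow> (nat \<Rightarrow> bvp_data) \<Rightarrow> real \<Rightarrow> real" where
  "rep e x us = (\<lambda>s. if s \<in> {0..1} then ev x us e s else 0)"

lemma rep_CI:
  assumes "x \<in> Dm" "us \<in> Es"
  shows "rep e x us \<in> CI \<infinity>"
    and "\<And>k s. s \<in> {0..1} \<Longrightarrow> ideriv k (rep e x us) s = ev x us ((time_deriv ^^ k) e) s"
proof -
  have 1: "rep e x us s = 0" if "s \<notin> {0..1}" for s using that by (auto simp: rep_def)
  have 2: "ev x us ((time_deriv ^^ 0) e) s = rep e x us s" if "s \<in> {0..1}" for s using that by (simp add: rep_def)
  have 3: "(ev x us ((time_deriv ^^ k) e) has_real_derivative ev x us ((time_deriv ^^ Suc k) e) s) (at s within {0..1})"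
    if "enat k < \<infinity>" "s \<in> {0..1}" for k s
    using ev_deriv[OF assms that(2)] by simp
  have 4: "continuous_on {0..1} (ev x us ((time_deriv ^^ k) e))" if "enat k \<le> \<infinity>" for k
    by (rule ev_continuous[OF assms])
  show "rep e x us \<in> CI \<infinity>" by (rule CI_memI(1)[where d = "\<lambda>k. ev x us ((time_deriv ^^ k) e)", OF 1 2 3 4])
  show "ideriv k (rep e x us) s = ev x us ((time_deriv ^^ k) e) s" if "s \<in> {0..1}" for k s
    using CI_memI(2)[where d = "\<lambda>k. ev x us ((time_deriv ^^ k) e)" and i = \<infinity>, OF 1 2 3 4] that by simp
qed

lemma rep_Pos: "rep Pos x us = rep Pos x vs"
  by (auto simp: rep_def)

text \<open>With the directions frozen an expression becomes a partial function of the base point,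
  which is the kind of object on which \<open>dir_deriv\<close> acts; iteration then stays within
  such graphs.\<close>

definition graph :: "bexp \<Rightarrow> (nat \<Rightarrow> bvp_data) \<Rightarrow> (bvp_data \<times> (real \<Rightarrow> real)) set" where
  "graph e us = (\<lambda>x. (x, rep e x us)) ` Dm"

lemma fun_val_graph: "x \<in> Dm \<Longrightarrow> fun_val (graph e us) x = rep e x us"
  by (auto simp: fun_val_def graph_def)

lemma Domain_graph: "Domain (graph e us) = Dm"
  by (force simp: graph_def)

text \<open>Convergence in the smooth topology is uniform convergence of each
  \<open>ideriv k\<close>. This is \<open>X_quotient\<close> for the k-th formal derivative of
  \<open>e\<close>, and the commutation of values identifies the limit with the k-th derivative of
  the claimed one. The converse inclusion of graphs rests on uniqueness of limits in a Hausdorff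
  space.\<close>

lemma dir_deriv_graph:
  assumes us: "us \<in> Es"
  shows "dir_deriv (CI_topology \<infinity>) (us j) (graph e us) = graph (dir_deriv_exp j e) us"
proof -
  have lim: "limitin (CI_topology \<infinity>) (\<lambda>t. inverse t *\<^sub>R (fun_val (graph e us) (x + t *\<^sub>R us j) - fun_val (graph e us) x))
      (rep (dir_deriv_exp j e) x us) (at 0)"
    and dom: "\<forall>\<^sub>F t in at 0. x + t *\<^sub>R us j \<in> Dm" if x: "x \<in> Dm" for x
  proof -
    interpret line \<Omega> c d r Dm y y' M x us j by unfold_locales (rule x us)+
    show dom: "\<forall>\<^sub>F t in at 0. x + t *\<^sub>R us j \<in> Dm" using X_Dm by (simp add: X_def eventually_conj_iff)
    let ?h = "\<lambda>t. inverse t *\<^sub>R (fun_val (graph e us) (x + t *\<^sub>R us j) - fun_val (graph e us) x)"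
    have h: "?h t \<in> CI \<infinity> \<and> (\<forall>k. \<forall>s\<in>{0..1}. ideriv k (?h t) s =
        (ev (X t) us ((time_deriv ^^ k) e) s - ev x us ((time_deriv ^^ k) e) s) / t)" if t: "X t \<in> Dm" for t
    proof -
      have e: "?h t = inverse t *\<^sub>R (rep e (X t) us - rep e x us)"
        using t x by (simp add: fun_val_graph X_def)
      show ?thesis
        unfolding e using CI_combine[where c = "inverse t", OF rep_CI(1)[OF t us] rep_CI(1)[OF x us]]
        by (simp add: rep_CI(2)[OF t us] rep_CI(2)[OF x us] divide_inverse mult.commute)
    qed
    show "limitin (CI_topology \<infinity>) ?h (rep (dir_deriv_exp j e) x us) (at 0)"
      unfolding CI_topology_def
    proof (rule limitin_uniform_topologyI)
      show "rep (dir_deriv_exp j e) x us \<in> CI \<infinity>" by (rule rep_CI(1)[OF x us])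
      show "\<forall>\<^sub>F t in at 0. ?h t \<in> CI \<infinity>" using X_Dm by eventually_elim (use h in blast)
      fix D and K' :: "real set" and \<epsilon> :: real
      assume "(D, K') \<in> {(ideriv k, {0..1}) |k. enat k < \<infinity> + 1}" and \<epsilon>: "0 < \<epsilon>"
      then obtain k where DK: "D = ideriv k" "K' = {0..1}" by blast
      from X_Dm unif_limD[OF X_quotient[of "(time_deriv ^^ k) e"] \<epsilon>]
      show "\<forall>\<^sub>F t in at 0. \<forall>z\<in>K'. \<bar>D (?h t) z - D (rep (dir_deriv_exp j e) x us) z\<bar> < \<epsilon>"
      proof eventually_elim
        case (elim t)
        have hk: "ideriv k (?h t) s = (ev (X t) us ((time_deriv ^^ k) e) s - ev x us ((time_deriv ^^ k) e) s) / t"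
          if "s \<in> {0..1}" for s using h[of t] elim(1) that by blast
        show ?case
          unfolding DK using elim(2) hk by (simp add: rep_CI(2)[OF x us] time_derivs_dir_deriv)
      qed
    qed
  qed
  have haus: "Hausdorff_space (CI_topology \<infinity>)" using locally_convex_CI by (simp add: locally_convex_space_def)
  show ?thesis
  proof (intro set_eqI iffI)
    fix p assume "p \<in> dir_deriv (CI_topology \<infinity>) (us j) (graph e us)"
    then obtain x v where p: "p = (x, v)" "x \<in> Dm" "limitin (CI_topology \<infinity>)
        (\<lambda>t. inverse t *\<^sub>R (fun_val (graph e us) (x + t *\<^sub>R us j) - fun_val (graph e us) x)) v (at 0)"
      by (auto simp: dir_deriv_def Domain_graph)
    have "v = rep (dir_deriv_exp j e) x us"
      by (rule limitin_Hausdorff_unique[OF p(3) lim[OF p(2)] _ haus]) simp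
    then show "p \<in> graph (dir_deriv_exp j e) us" using p by (simp add: graph_def)
  next
    fix p assume "p \<in> graph (dir_deriv_exp j e) us"
    then obtain x where "p = (x, rep (dir_deriv_exp j e) x us)" "x \<in> Dm" by (auto simp: graph_def)
    then show "p \<in> dir_deriv (CI_topology \<infinity>) (us j) (graph e us)"
      using lim dom by (simp add: dir_deriv_def Domain_graph)
  qed
qed

definition iter_exp :: "nat \<Rightarrow> bexp" where "iter_exp l = fold dir_deriv_exp [0..<l] Pos"

lemma iter_exp_Suc: "iter_exp (Suc l) = dir_deriv_exp l (iter_exp l)"
  by (simp add: iter_exp_def)

text \<open>Each derivative uses a fresh direction number, which is exactly the side condition of
  \<open>multideg_dir_deriv\<close>; the result is linearity in all l slots separately.\<close>

lemma multideg_iter_exp: "multideg (iter_exp l) {..<l}"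
proof (induction l)
  case (Suc l)
  then show ?case using multideg_dir_deriv[of "iter_exp l" "{..<l}" l] by (simp add: iter_exp_Suc lessThan_Suc)
qed (simp add: iter_exp_def)

text \<open>Elements of an extensional function space have an unspecified value beyond l, whereas
  \<open>Es\<close> asks for members of \<open>E\<close> everywhere; zero is a harmless
  filling.\<close>

definition padded :: "nat \<Rightarrow> (nat \<Rightarrow> bvp_data) \<Rightarrow> nat \<Rightarrow> bvp_data" where
  "padded l us = (\<lambda>k. if k < l then us k else 0)"

lemma padded_Es: "us \<in> {..<l} \<rightarrow>\<^sub>E E \<Longrightarrow> padded l us \<in> Es"
  using E_zero by (auto simp: padded_def Es_def PiE_def Pi_def)

lemma iter_dir_deriv_graph:
  assumes "us \<in> {..<l} \<rightarrow>\<^sub>E E"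
  shows "iter_dir_deriv (CI_topology \<infinity>) l us (graph Pos vs) = graph (iter_exp l) (padded l us)"
proof -
  have *: "fold (dir_deriv (CI_topology \<infinity>)) (map ws [0..<n]) (graph Pos vs) = graph (iter_exp n) ws"
    if "ws \<in> Es" for ws n
  proof (induction n)
    case 0
    then show ?case by (simp add: graph_def iter_exp_def rep_Pos[of _ vs ws])
  next
    case (Suc n)
    then show ?case by (simp add: dir_deriv_graph[OF that] iter_exp_Suc)
  qed
  have m: "map us [0..<l] = map (padded l us) [0..<l]" by (simp add: padded_def)
  show ?thesis unfolding iter_dir_deriv_def m by (rule *[OF padded_Es[OF assms]])
qed

lemma ev_multilinear:
  assumes "multideg e J" "i \<in> J" "x \<in> Dm" "us \<in> Es" "a \<in> E" "b \<in> E" "s \<in> {0..1}"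
  shows "ev x (us(i := a + b)) e s = ev x (us(i := a)) e s + ev x (us(i := b)) e s"
    and "ev x (us(i := t *\<^sub>R a)) e s = t * ev x (us(i := a)) e s"
proof -
  have Es: "us(i := v) \<in> Es" if "v \<in> E" for v using assms(4) that by (simp add: Es_def)
  note lin = ev_linear[OF assms(1-3) Es Es Es assms(7)]
  show "ev x (us(i := a + b)) e s = ev x (us(i := a)) e s + ev x (us(i := b)) e s"
    using lin[of a b "a + b" 1] assms(5,6) E_add by simp
  have "ev x (us(i := 0)) e s = 0" using lin[of 0 0 0 1] E_zero by simp
  then show "ev x (us(i := t *\<^sub>R a)) e s = t * ev x (us(i := a)) e s"
    using lin[of a 0 "t *\<^sub>R a" t] assms(5) E_zero E_scaleR by simp
qed

lemma Cinf_pi_graph: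
  assumes Dm: "openin (data_topology \<Omega>) Dm" and vs: "vs \<in> Es"
  shows "Cinf_pi (data_topology \<Omega>) (CI_topology \<infinity>) (graph Pos vs)"
proof -
  define D where "D = (\<lambda>l x us. rep (iter_exp l) x (padded l us))"
  have D: "fun_val (iter_dir_deriv (CI_topology \<infinity>) l us (graph Pos vs)) x = D l x us"
    if "us \<in> {..<l} \<rightarrow>\<^sub>E E" "x \<in> Dm" for l us x
    using that by (simp add: iter_dir_deriv_graph fun_val_graph D_def)
  have top: "topspace (CI_topology \<infinity>) = CI \<infinity>" by (simp add: CI_topology_def)
  have D_CI: "D l x us \<in> CI \<infinity>" if "us \<in> {..<l} \<rightarrow>\<^sub>E E" "x \<in> Dm" for l us x
    unfolding D_def by (rule rep_CI(1)[OF that(2) padded_Es[OF that(1)]])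
  have near_padded: "padded l vs k - padded l us k \<in> B N \<delta>"
    if "\<And>k. k < l \<Longrightarrow> vs k - us k \<in> B N \<delta>" "0 < \<delta>" for l us vs k N \<delta>
    using that B_zero by (simp add: padded_def)
  have multi: "multilinear_on l E (D l x)" if x: "x \<in> Dm" for l x
    unfolding multilinear_on_def
  proof (intro ballI allI impI)
    fix us i a b and t :: real assume us: "us \<in> {..<l} \<rightarrow>\<^sub>E E" and i: "i < l" and ab: "a \<in> E" "b \<in> E"
    have p: "padded l (us(i := v)) = (padded l us)(i := v)" for v using i by (auto simp: padded_def)
    note lin = ev_multilinear[OF multideg_iter_exp _ x padded_Es[OF us] ab, of i]
    show "D l x (us(i := a + b)) = D l x (us(i := a)) + D l x (us(i := b)) \<and> D l x (us(i := t *\<^sub>R a)) = t *\<^sub>R D l x (us(i := a))"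
      using lin i by (auto simp: D_def rep_def p fun_eq_iff)
  qed
  \<comment> \<open>Here the filter \<open>near\<close> is used with the base point held fixed and
    only the directions moving.\<close>
  have cont: "continuous_map (product_topology (\<lambda>_. data_topology \<Omega>) {..<l}) (CI_topology \<infinity>) (D l x)" if x: "x \<in> Dm" for l x
    unfolding CI_topology_def
  proof (rule continuous_map_uniform_topologyI)
    fix us assume "us \<in> topspace (product_topology (\<lambda>_. data_topology \<Omega>) {..<l})"
    then have us: "us \<in> {..<l} \<rightarrow>\<^sub>E E" by (simp add: topspace_data)
    then show "D l x us \<in> CI \<infinity>" using D_CI x by blast
    fix DD and K' :: "real set" and \<epsilon> :: real
    assume "(DD, K') \<in> {(ideriv k, {0..1}) |k. enat k < \<infinity> + 1}" and \<epsilon>: "0 < \<epsilon>"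
    then obtain k where DK: "DD = ideriv k" "K' = {0..1}" by blast
    let ?e = "(time_deriv ^^ k) (iter_exp l)"
    obtain N where N: "\<forall>N'\<ge>N. \<forall>R>0. ev_near x N' R ?e" using ev_near_all[OF x] by blast
    have "\<forall>i\<in>{..<l}. \<exists>R. 0 < R \<and> us i \<in> B N R"
      using us B_absorbs by (metis PiE_mem)
    from bchoice[OF this] obtain Rf where Rf: "\<forall>i\<in>{..<l}. 0 < Rf i \<and> us i \<in> B N (Rf i)" ..
    \<comment> \<open>One radius for all directions: the sum dominates each \<open>Rf i\<close>, and
      the summand 1 keeps it positive for l = 0.\<close>
    define R where "R = 1 + (\<Sum>i<l. Rf i)"
    have R: "0 < R" unfolding R_def using Rf by (intro add_pos_nonneg sum_nonneg) (auto intro: less_imp_le)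
    have usR: "padded l us i \<in> B N R" for i
    proof (cases "i < l")
      case True
      have "Rf i \<le> (\<Sum>i<l. Rf i)" using Rf True by (intro member_le_sum) (auto intro: less_imp_le)
      then have "B N (Rf i) \<subseteq> B N R" by (intro B_mono) (auto simp: R_def)
      then show ?thesis using Rf True by (auto simp: padded_def)
    qed (simp add: padded_def B_zero R)
    have "unif_lim (\<lambda>i. ev (fst i) (fst (snd i)) ?e) (\<lambda>i. ev x (snd (snd i)) ?e) (near x N R)"
      using N R by (simp add: ev_near_def)
    from unif_limD[OF this \<epsilon>] obtain \<delta> where \<delta>: "0 < \<delta>"
      "\<And>x' vs us. x' \<in> Dm \<Longrightarrow> x' - x \<in> B N \<delta> \<Longrightarrow> vs \<in> Es \<Longrightarrow> (\<forall>k. us k \<in> B N R \<and> vs k - us k \<in> B N \<delta>) \<Longrightarrow>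
        \<forall>s\<in>{0..1}. \<bar>ev x' vs ?e s - ev x us ?e s\<bar> < \<epsilon>"
      unfolding eventually_near fst_conv snd_conv by blast
    have "\<forall>i\<in>{..<l}. \<exists>U. openin (data_topology \<Omega>) U \<and> us i \<in> U \<and> (\<forall>v\<in>U. v \<in> E \<and> v - us i \<in> B N \<delta>)"
    proof
      fix i assume "i \<in> {..<l}"
      then have "us i \<in> E" using us by blast
      from B_translate_nhd[OF this \<delta>(1), of N]
      show "\<exists>U. openin (data_topology \<Omega>) U \<and> us i \<in> U \<and> (\<forall>v\<in>U. v \<in> E \<and> v - us i \<in> B N \<delta>)" .
    qed
    from bchoice[OF this] obtain U where U: "\<forall>i\<in>{..<l}. openin (data_topology \<Omega>) (U i) \<and> us i \<in> U i \<and>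
        (\<forall>v\<in>U i. v \<in> E \<and> v - us i \<in> B N \<delta>)" ..
    show "\<exists>V. openin (product_topology (\<lambda>_. data_topology \<Omega>) {..<l}) V \<and> us \<in> V \<and>
        (\<forall>ws\<in>V. \<forall>z\<in>K'. \<bar>DD (D l x ws) z - DD (D l x us) z\<bar> < \<epsilon>)"
    proof (intro exI[of _ "PiE {..<l} U"] conjI ballI)
      show "openin (product_topology (\<lambda>_. data_topology \<Omega>) {..<l}) (PiE {..<l} U)"
        using U by (subst openin_PiE) auto
      show "us \<in> PiE {..<l} U" using U us by (auto simp: PiE_def)
      fix ws z assume ws: "ws \<in> PiE {..<l} U" and z: "z \<in> K'"
      have wsE: "ws \<in> {..<l} \<rightarrow>\<^sub>E E" using ws U by (auto simp: PiE_def Pi_def)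
      have "ws k - us k \<in> B N \<delta>" if "k < l" for k using ws U that by (auto simp: PiE_def Pi_def)
      then have "\<forall>k. padded l us k \<in> B N R \<and> padded l ws k - padded l us k \<in> B N \<delta>"
        using usR near_padded \<delta>(1) by blast
      from \<delta>(2)[OF x _ padded_Es[OF wsE] this] B_zero[OF \<delta>(1)] z
      show "\<bar>DD (D l x ws) z - DD (D l x us) z\<bar> < \<epsilon>"
        by (simp add: DK D_def rep_CI(2)[OF x padded_Es[OF wsE]] rep_CI(2)[OF x padded_Es[OF us]])
    qed
  qed
  \<comment> \<open>Conversely, the directions now stay fixed in a unit ball and only the base point
    moves. The order \<open>N\<close> is determined by \<open>W\<close> and l alone, so
    \<open>B N 1\<close> is chosen before \<epsilon>.\<close>
  have unif: "\<exists>U. zero_nhd (data_topology \<Omega>) U \<and> (\<forall>\<epsilon>>0. \<exists>V. zero_nhd (data_topology \<Omega>) V \<and>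
      (\<forall>v\<in>V. x + v \<in> Dm \<and> (\<forall>us\<in>{..<l} \<rightarrow>\<^sub>E U. D l (x + v) us - D l x us \<in> (*\<^sub>R) \<epsilon> ` W)))"
    if x: "x \<in> Dm" and W: "zero_nhd (CI_topology \<infinity>) W" for l x W
  proof -
    obtain Q \<epsilon>0 where Q: "finite Q" "Q \<subseteq> {(ideriv k, {0..1}) |k. enat k < \<infinity> + 1}" "0 < \<epsilon>0" "uniform_nhd (CI \<infinity>) Q \<epsilon>0 0 \<subseteq> W"
      by (rule zero_nhd_uniform_topologyD[OF W[unfolded CI_topology_def]]) (rule that)
    have "Q \<subseteq> (\<lambda>k. (ideriv k, {0..1})) ` UNIV" using Q(2) by auto
    from finite_subset_image[OF Q(1) this] obtain C where C: "finite C" "Q = (\<lambda>k. (ideriv k, {0..1})) ` C" by blast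
    let ?e = "\<lambda>k. (time_deriv ^^ k) (iter_exp l)"
    have "\<forall>k. \<exists>N. \<forall>N'\<ge>N. \<forall>R>0. ev_near x N' R (?e k)" using ev_near_all[OF x] by blast
    from choice[OF this] obtain Nf where Nf: "\<forall>k. \<forall>N'\<ge>Nf k. \<forall>R>0. ev_near x N' R (?e k)" ..
    \<comment> \<open>The sum dominates the finitely many orders required; \<open>Suc\<close>
      ensures N >= 1, so that small balls of order \<open>N\<close> keep x + v inside
      \<open>Dm\<close>.\<close>
    define N where "N = Suc (\<Sum>k\<in>C. Nf k)"
    have N: "ev_near x N 1 (?e k)" if "k \<in> C" for k
    proof -
      have "Nf k \<le> (\<Sum>k\<in>C. Nf k)" using C(1) that by (intro member_le_sum) auto
      then show ?thesis using Nf by (simp add: N_def)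
    qed
    obtain \<delta>0 where \<delta>0: "0 < \<delta>0" "\<forall>v\<in>B 1 \<delta>0. x + v \<in> Dm" using Dm_open[OF x] by blast
    have "\<exists>V. zero_nhd (data_topology \<Omega>) V \<and>
      (\<forall>v\<in>V. x + v \<in> Dm \<and> (\<forall>us\<in>{..<l} \<rightarrow>\<^sub>E B N 1. D l (x + v) us - D l x us \<in> (*\<^sub>R) \<epsilon> ` W))" if \<epsilon>: "0 < \<epsilon>" for \<epsilon>
    proof -
      have "\<forall>\<^sub>F i in near x N 1. \<forall>s\<in>{0..1}. \<bar>ev (fst i) (fst (snd i)) (?e k) s - ev x (snd (snd i)) (?e k) s\<bar> < \<epsilon> * \<epsilon>0"
        if "k \<in> C" for k
        using unif_limD[of _ _ "near x N 1" "\<epsilon> * \<epsilon>0"] N[OF that] \<epsilon> Q(3) by (simp add: ev_near_def)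
      then have "\<forall>\<^sub>F i in near x N 1. \<forall>k\<in>C. \<forall>s\<in>{0..1}. \<bar>ev (fst i) (fst (snd i)) (?e k) s - ev x (snd (snd i)) (?e k) s\<bar> < \<epsilon> * \<epsilon>0"
        using C(1) by (intro eventually_ball_finite) auto
      then obtain \<delta> where \<delta>: "0 < \<delta>"
        "\<And>x' vs us. x' \<in> Dm \<Longrightarrow> x' - x \<in> B N \<delta> \<Longrightarrow> vs \<in> Es \<Longrightarrow> (\<forall>k. us k \<in> B N 1 \<and> vs k - us k \<in> B N \<delta>) \<Longrightarrow>
          \<forall>k\<in>C. \<forall>s\<in>{0..1}. \<bar>ev x' vs (?e k) s - ev x us (?e k) s\<bar> < \<epsilon> * \<epsilon>0"
        unfolding eventually_near fst_conv snd_conv by blast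
      define \<eta> where "\<eta> = min \<delta> \<delta>0"
      have \<eta>: "0 < \<eta>" "B N \<eta> \<subseteq> B N \<delta>" "B N \<eta> \<subseteq> B 1 \<delta>0"
        using \<delta>(1) \<delta>0(1) B_mono[of N N \<eta> \<delta>] B_mono[of 1 N \<eta> \<delta>0] by (simp_all add: \<eta>_def N_def)
      have "D l (x + v) us - D l x us \<in> (*\<^sub>R) \<epsilon> ` W" if v: "v \<in> B N \<eta>" and us: "us \<in> {..<l} \<rightarrow>\<^sub>E B N 1" for v us
      proof -
        have xv: "x + v \<in> Dm" using v \<eta> \<delta>0 by blast
        have usE: "us \<in> {..<l} \<rightarrow>\<^sub>E E" using us B_subset by (auto simp: PiE_def Pi_def)
        have "\<forall>k. padded l us k \<in> B N 1 \<and> padded l us k - padded l us k \<in> B N \<delta>"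
          using us B_zero \<delta>(1) by (auto simp: padded_def)
        from \<delta>(2)[OF xv _ padded_Es[OF usE] this]
        have ev: "\<bar>ev (x + v) (padded l us) (?e k) s - ev x (padded l us) (?e k) s\<bar> < \<epsilon> * \<epsilon>0" if "k \<in> C" "s \<in> {0..1}" for k s
          using v \<eta>(2) that by auto
        \<comment> \<open>Membership in the \<epsilon>-multiple of \<open>W\<close> is tested by
          dividing by \<epsilon>, which explains the tolerance \<epsilon> * \<epsilon>0
          above.\<close>
        let ?g = "inverse \<epsilon> *\<^sub>R (D l (x + v) us - D l x us)"
        note g = CI_combine[where c = "inverse \<epsilon>", OF D_CI[OF usE xv] D_CI[OF usE x]]
        have "\<bar>ideriv k ?g s - ideriv k 0 s\<bar> < \<epsilon>0" if "k \<in> C" "s \<in> {0..1}" for k s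
        proof -
          have "ideriv k ?g s = inverse \<epsilon> * (ev (x + v) (padded l us) (?e k) s - ev x (padded l us) (?e k) s)"
            using g(2)[of k s] that(2)
            by (simp add: D_def rep_CI(2)[OF xv padded_Es[OF usE]] rep_CI(2)[OF x padded_Es[OF usE]])
          then have "\<bar>ideriv k ?g s\<bar> = inverse \<epsilon> * \<bar>ev (x + v) (padded l us) (?e k) s - ev x (padded l us) (?e k) s\<bar>"
            using \<epsilon> by (simp add: abs_mult)
          also have "\<dots> < inverse \<epsilon> * (\<epsilon> * \<epsilon>0)" using ev[OF that] \<epsilon> by (intro mult_strict_left_mono) auto
          also have "\<dots> = \<epsilon>0" using \<epsilon> by simp
          finally show ?thesis using ideriv_zero[OF that(2)] by simp
        qed
        then have "?g \<in> uniform_nhd (CI \<infinity>) Q \<epsilon>0 0" using g(1) by (auto simp: uniform_nhd_def C(2))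
        then have "?g \<in> W" using Q(4) by blast
        moreover have "D l (x + v) us - D l x us = \<epsilon> *\<^sub>R ?g" using \<epsilon> by simp
        ultimately show ?thesis by blast
      qed
      then show ?thesis using zero_nhd_B[OF \<eta>(1), of N] \<eta>(3) \<delta>0(2) by (intro exI[of _ "B N \<eta>"]) blast
    qed
    then show ?thesis using zero_nhd_B[of 1 N] by (intro exI[of _ "B N 1"]) simp
  qed
  show ?thesis
    unfolding Cinf_pi_def Let_def topspace_data Domain_graph
  proof (intro conjI allI ballI)
    show "locally_convex_space (data_topology \<Omega>)" by (rule locally_convex_data)
    show "locally_convex_space (CI_topology \<infinity>)" by (rule locally_convex_CI)
    show "single_valued (graph Pos vs)" by (auto simp: single_valued_def graph_def)
    show "Range (graph Pos vs) \<subseteq> topspace (CI_topology \<infinity>)"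
      using rep_CI(1)[OF _ vs] by (auto simp: graph_def top)
    show "openin (data_topology \<Omega>) Dm" by (rule Dm)
    fix l x assume x: "x \<in> Dm"
    let ?D = "\<lambda>us. fun_val (iter_dir_deriv (CI_topology \<infinity>) l us (graph Pos vs)) x"
    show "x \<in> Domain (iter_dir_deriv (CI_topology \<infinity>) l us (graph Pos vs))" if "us \<in> {..<l} \<rightarrow>\<^sub>E E" for us
      using that x by (simp add: iter_dir_deriv_graph Domain_graph)
    have upd: "us(i := v) \<in> {..<l} \<rightarrow>\<^sub>E E" if "us \<in> {..<l} \<rightarrow>\<^sub>E E" "i < l" "v \<in> E" for us i v
      using that by (auto simp: PiE_def Pi_def extensional_def)
    show "multilinear_on l E ?D"
      unfolding multilinear_on_def
    proof (intro ballI allI impI)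
      fix us i a b and t :: real assume *: "us \<in> {..<l} \<rightarrow>\<^sub>E E" "i < l" "a \<in> E" "b \<in> E"
      show "?D (us(i := a + b)) = ?D (us(i := a)) + ?D (us(i := b)) \<and> ?D (us(i := t *\<^sub>R a)) = t *\<^sub>R ?D (us(i := a))"
        using multi[OF x, of l] * by (simp add: D upd E_add E_scaleR x multilinear_on_def del: fun_upd_apply)
    qed
    show "continuous_map (product_topology (\<lambda>_. data_topology \<Omega>) {..<l}) (CI_topology \<infinity>) ?D"
      by (rule continuous_map_eq[OF cont[OF x]]) (use x in \<open>simp add: topspace_data D\<close>)
    show "zero_nhd (CI_topology \<infinity>) W \<longrightarrow> (\<exists>U. zero_nhd (data_topology \<Omega>) U \<and>
        (\<forall>\<epsilon>>0. \<exists>V. zero_nhd (data_topology \<Omega>) V \<and> (\<forall>v\<in>V. x + v \<in> Dm \<and>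
          (\<forall>us\<in>{..<l} \<rightarrow>\<^sub>E U. fun_val (iter_dir_deriv (CI_topology \<infinity>) l us (graph Pos vs)) (x + v) -
            fun_val (iter_dir_deriv (CI_topology \<infinity>) l us (graph Pos vs)) x \<in> (*\<^sub>R) \<epsilon> ` W))))" for W
    proof
      assume "zero_nhd (CI_topology \<infinity>) W"
      from unif[OF x this, of l] obtain U where U: "zero_nhd (data_topology \<Omega>) U" "\<forall>\<epsilon>>0. \<exists>V. zero_nhd (data_topology \<Omega>) V \<and>
        (\<forall>v\<in>V. x + v \<in> Dm \<and> (\<forall>us\<in>{..<l} \<rightarrow>\<^sub>E U. D l (x + v) us - D l x us \<in> (*\<^sub>R) \<epsilon> ` W))" by blast
      have "us \<in> {..<l} \<rightarrow>\<^sub>E E" if "us \<in> {..<l} \<rightarrow>\<^sub>E U" for us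
        using that U(1) by (auto simp: zero_nhd_def topspace_data PiE_def Pi_def)
      then have eq: "fun_val (iter_dir_deriv (CI_topology \<infinity>) l us (graph Pos vs)) z = D l z us"
        if "us \<in> {..<l} \<rightarrow>\<^sub>E U" "z \<in> Dm" for us z
        using D that by blast
      show "\<exists>U. zero_nhd (data_topology \<Omega>) U \<and>
        (\<forall>\<epsilon>>0. \<exists>V. zero_nhd (data_topology \<Omega>) V \<and> (\<forall>v\<in>V. x + v \<in> Dm \<and>
          (\<forall>us\<in>{..<l} \<rightarrow>\<^sub>E U. fun_val (iter_dir_deriv (CI_topology \<infinity>) l us (graph Pos vs)) (x + v) -
            fun_val (iter_dir_deriv (CI_topology \<infinity>) l us (graph Pos vs)) x \<in> (*\<^sub>R) \<epsilon> ` W)))"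
        using U by (intro exI[of _ U]) (simp add: eq x cong: conj_cong)
    qed
  qed
qed

end

subsection \<open>Existence and uniqueness near a regular solution\<close>

lemma (in tube) B_add: "v \<in> B N \<delta> \<Longrightarrow> w \<in> B N \<delta>' \<Longrightarrow> v + w \<in> B N (\<delta> + \<delta>')"
proof -
  assume v: "v \<in> B N \<delta>" and w: "w \<in> B N \<delta>'"
  have E: "v \<in> E" "w \<in> E" using v w B_subset by auto
  have "\<bar>pd ns (ph (v + w)) z\<bar> < \<delta> + \<delta>'" if "length ns \<le> N" "z \<in> K" for ns z
  proof -
    have "pd ns (ph (v + w)) z = pd ns (ph v) z + pd ns (ph w) z"
      using pd_add[of "ph v" "ph w" z ns] E that(2) K_subset by (auto simp: E_def)
    then show ?thesis using B_pd[OF v that] B_pd[OF w that] by linarith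
  qed
  then show ?thesis
    using E_add[OF E] B_fst[OF v] B_fst[OF w] by (auto simp: B_def)
qed

text \<open>\<open>base\<close> rewrites the nonlinear equation of the base curve as a linear
  problem with a nonlinear remainder as source. \<open>close\<close> bounds the Lipschitz constant
  of that remainder on all of \<open>K\<close> by 1/(2 M), and 16 M \<delta> <= r places the
  solutions found in the inner quarter of the tube.\<close>

locale continuation = tube +
  fixes q\<^sub>2 q\<^sub>3 :: "real \<Rightarrow> real" and M \<delta> :: real and x\<^sub>0 :: bvp_data
  assumes stable: "stable q\<^sub>2 q\<^sub>3 M" and solvable: "solvable q\<^sub>2 q\<^sub>3"
    and q_cont: "continuous_on {0..1} q\<^sub>2" "continuous_on {0..1} q\<^sub>3"
    and r_pos: "0 < r" and \<delta>: "0 < \<delta>" "16 * M * \<delta> \<le> r"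
    and x\<^sub>0: "x\<^sub>0 \<in> E"
    and base: "is_sol q\<^sub>2 q\<^sub>3 (fst x\<^sub>0) (fst (snd x\<^sub>0)) (\<lambda>s. pd [] (ph x\<^sub>0) (s, c s, d s) - q\<^sub>3 s * d s - q\<^sub>2 s * c s) c d"
    and close: "\<And>x s a b. x \<in> E \<Longrightarrow> x - x\<^sub>0 \<in> B 1 \<delta> \<Longrightarrow> (s, a, b) \<in> K \<Longrightarrow>
      \<bar>pd [1] (ph x) (s, a, b) - q\<^sub>2 s\<bar> \<le> 1 / (4 * M) \<and> \<bar>pd [2] (ph x) (s, a, b) - q\<^sub>3 s\<bar> \<le> 1 / (4 * M)"
begin

definition near0 :: "bvp_data set" where "near0 = {x \<in> E. x - x\<^sub>0 \<in> B 1 \<delta>}"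

text \<open>The nonlinearity minus its linear part at the base curve: a solution of the linear
  problem with this source solves the original equation.\<close>

definition rhs :: "bvp_data \<Rightarrow> real \<Rightarrow> real \<Rightarrow> real \<Rightarrow> real" where
  "rhs x s a b = pd [] (ph x) (s, a, b) - q\<^sub>3 s * b - q\<^sub>2 s * a"

definition solves :: "bvp_data \<Rightarrow> (real \<Rightarrow> real) \<Rightarrow> (real \<Rightarrow> real) \<Rightarrow> bool" where
  "solves x u v \<longleftrightarrow> is_sol q\<^sub>2 q\<^sub>3 (fst x) (fst (snd x)) (\<lambda>s. rhs x s (u s) (v s)) u v \<and>
     (\<forall>s\<in>{0..1}. (s, u s, v s) \<in> K)"

lemma M_ge_1: "1 \<le> M"
  using stable by (simp add: stable_def)

lemma near0_CO: "x \<in> near0 \<Longrightarrow> ph x \<in> CO \<Omega>"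
  by (simp add: near0_def E_def)

lemma rhs_lipschitz:
  assumes x: "x \<in> near0" and z: "(s, a, b) \<in> K" "(s, a', b') \<in> K"
  shows "\<bar>rhs x s a' b' - rhs x s a b\<bar> \<le> max \<bar>a' - a\<bar> \<bar>b' - b\<bar> / (2 * M)"
proof -
  let ?m = "max \<bar>a' - a\<bar> \<bar>b' - b\<bar>"
  obtain t where t: "t \<in> {0..1}" "pd [] (ph x) (s, a', b') - pd [] (ph x) (s, a, b) =
      (a' - a) * pd ([] @ [1]) (ph x) (s, a + t * (a' - a), b + t * (b' - b)) +
      (b' - b) * pd ([] @ [2]) (ph x) (s, a + t * (a' - a), b + t * (b' - b))"
    using K_mvt[OF near0_CO[OF x] z, of "[]"] by (elim bexE)
  let ?z = "(s, a + t * (a' - a), b + t * (b' - b))"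
  have \<kappa>: "\<bar>pd [1] (ph x) ?z - q\<^sub>2 s\<bar> \<le> 1 / (4 * M)" "\<bar>pd [2] (ph x) ?z - q\<^sub>3 s\<bar> \<le> 1 / (4 * M)"
    using close[OF _ _ segment_in_K[OF z t(1)]] x by (simp_all add: near0_def)
  have "rhs x s a' b' - rhs x s a b = (a' - a) * (pd [1] (ph x) ?z - q\<^sub>2 s) + (b' - b) * (pd [2] (ph x) ?z - q\<^sub>3 s)"
    using t(2) by (simp add: rhs_def algebra_simps)
  moreover have "\<bar>(a' - a) * (pd [1] (ph x) ?z - q\<^sub>2 s)\<bar> \<le> ?m * (1 / (4 * M))"
    unfolding abs_mult using \<kappa> by (intro mult_mono) auto
  moreover have "\<bar>(b' - b) * (pd [2] (ph x) ?z - q\<^sub>3 s)\<bar> \<le> ?m * (1 / (4 * M))"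
    unfolding abs_mult using \<kappa> by (intro mult_mono) auto
  moreover have "?m / (2 * M) = ?m * (1 / (4 * M)) + ?m * (1 / (4 * M))"
    using M_ge_1 by (simp add: field_simps)
  ultimately show ?thesis by linarith
qed

lemma base_curve_K: "s \<in> {0..1} \<Longrightarrow> (s, c s, d s) \<in> K"
  using r_pos by (simp add: K_def)

lemma curve_comp_continuous:
  assumes "\<phi> \<in> CO \<Omega>" "continuous_on {0..1} u" "continuous_on {0..1} v" "\<And>s. s \<in> {0..1} \<Longrightarrow> (s, u s, v s) \<in> K"
  shows "continuous_on {0..1} (\<lambda>s. pd ns \<phi> (s, u s, v s))"
  by (rule continuous_on_compose2[OF pd_continuous[OF assms(1)]])
    (use assms K_subset in \<open>auto intro!: continuous_intros\<close>)

text \<open>\<open>perturbed_problem\<close> applied to the remainder \<open>rhs x\<close>, with the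
  base curve as reference. The radius 4 M \<delta> is at most r/4; this strict margin later puts the
  solution into an open neighbourhood of radius r.\<close>

lemma solution_exists:
  assumes x: "x \<in> near0"
  shows "\<exists>u v. solves x u v \<and> (\<forall>s\<in>{0..1}. \<bar>u s - c s\<bar> \<le> r / 4 \<and> \<bar>v s - d s\<bar> \<le> r / 4)"
proof -
  have M: "1 \<le> M" by (rule M_ge_1)
  have rad: "4 * M * \<delta> \<le> r / 4" using \<delta>(2) by simp
  have in_K: "(s, a, b) \<in> K" if "s \<in> {0..1}" "\<bar>a - c s\<bar> \<le> 4 * M * \<delta>" "\<bar>b - d s\<bar> \<le> 4 * M * \<delta>" for s a b
    using that rad r_pos by (intro K_I) auto
  have dx: "x - x\<^sub>0 \<in> B 1 \<delta>" using x by (simp add: near0_def)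
  have rhs_cont: "continuous_on {0..1} (\<lambda>s. rhs x' s (u s) (v s))"
    if "x' \<in> E" "continuous_on {0..1} u" "continuous_on {0..1} v" "\<And>s. s \<in> {0..1} \<Longrightarrow> (s, u s, v s) \<in> K" for x' u v
    unfolding rhs_def using that q_cont
    by (intro continuous_on_diff continuous_on_mult curve_comp_continuous) (auto simp: E_def)
  obtain u v where uv: "is_sol q\<^sub>2 q\<^sub>3 (fst x) (fst (snd x)) (\<lambda>s. rhs x s (u s) (v s)) u v"
    "\<And>s. s \<in> {0..1} \<Longrightarrow> \<bar>u s - c s\<bar> \<le> 4 * M * \<delta> \<and> \<bar>v s - d s\<bar> \<le> 4 * M * \<delta>"
  proof (rule perturbed_problem[OF stable solvable base _ \<delta>(1), of "rhs x" "fst x" "fst (snd x)"])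
    show "continuous_on {0..1} (\<lambda>s. pd [] (ph x\<^sub>0) (s, c s, d s) - q\<^sub>3 s * d s - q\<^sub>2 s * c s)"
      using rhs_cont[OF x\<^sub>0 cd base_curve_K] by (simp add: rhs_def)
    show "continuous_on {0..1} (\<lambda>s. rhs x s (u s) (v s))"
      if "continuous_on {0..1} u" "continuous_on {0..1} v"
        "\<forall>s\<in>{0..1}. \<bar>u s - c s\<bar> \<le> 4 * M * \<delta> \<and> \<bar>v s - d s\<bar> \<le> 4 * M * \<delta>" for u v
      using that in_K x by (intro rhs_cont) (auto simp: near0_def)
    show "\<bar>rhs x s a b - rhs x s a' b'\<bar> \<le> max \<bar>a - a'\<bar> \<bar>b - b'\<bar> / (2 * M)"
      if "s \<in> {0..1}" "\<bar>a - c s\<bar> \<le> 4 * M * \<delta>" "\<bar>b - d s\<bar> \<le> 4 * M * \<delta>" "\<bar>a' - c s\<bar> \<le> 4 * M * \<delta>" "\<bar>b' - d s\<bar> \<le> 4 * M * \<delta>"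
      for s a b a' b'
      by (rule rhs_lipschitz[OF x in_K in_K]) (fact that)+
    show "\<bar>rhs x s (c s) (d s) - (pd [] (ph x\<^sub>0) (s, c s, d s) - q\<^sub>3 s * d s - q\<^sub>2 s * c s)\<bar> \<le> \<delta>" if s: "s \<in> {0..1}" for s
    proof -
      have "(s, c s, d s) \<in> \<Omega>" using base_curve_K[OF s] K_subset by blast
      then show ?thesis
        using B_pd[OF dx _ base_curve_K[OF s], of "[]"] pd_diff[OF near0_CO[OF x], of "ph x\<^sub>0" _ "[]"] x\<^sub>0
        by (simp add: rhs_def E_def less_imp_le)
    qed
    show "\<bar>fst x - fst x\<^sub>0\<bar> \<le> \<delta>" "\<bar>fst (snd x) - fst (snd x\<^sub>0)\<bar> \<le> \<delta>"
      using B_fst[OF dx] by simp_all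
  qed (rule that)
  have "\<bar>u s - c s\<bar> \<le> r / 4 \<and> \<bar>v s - d s\<bar> \<le> r / 4" if "s \<in> {0..1}" for s
    using uv(2)[OF that] rad by auto
  moreover have "(s, u s, v s) \<in> K" if "s \<in> {0..1}" for s using in_K uv(2) that by blast
  ultimately show ?thesis using uv(1) unfolding solves_def by blast
qed

text \<open>Comparing \<open>rhs x'\<close> with \<open>rhs x\<close> at the same point contributes
  \<gamma>; moving the point under \<open>rhs x'\<close> contributes the small Lipschitz term, which
  \<open>stable_absorb\<close> removes at the cost of the factor 2.\<close>

lemma solution_lipschitz:
  assumes x: "x \<in> near0" "x' \<in> near0" and sol: "solves x u v" "solves x' u' v'"
    and \<gamma>: "\<bar>fst (x' - x)\<bar> \<le> \<gamma>" "\<bar>fst (snd (x' - x))\<bar> \<le> \<gamma>" "\<And>z. z \<in> K \<Longrightarrow> \<bar>pd [] (ph (x' - x)) z\<bar> \<le> \<gamma>"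
    and s: "s \<in> {0..1}"
  shows "\<bar>u' s - u s\<bar> \<le> 2 * M * \<gamma>" "\<bar>v' s - v s\<bar> \<le> 2 * M * \<gamma>"
proof -
  have K: "(s, u s, v s) \<in> K" "(s, u' s, v' s) \<in> K" if "s \<in> {0..1}" for s
    using sol that by (auto simp: solves_def)
  have d: "is_sol q\<^sub>2 q\<^sub>3 (fst x' - fst x) (fst (snd x') - fst (snd x))
      (\<lambda>s. rhs x' s (u' s) (v' s) - rhs x s (u s) (v s)) (\<lambda>s. u' s - u s) (\<lambda>s. v' s - v s)"
    using sol unfolding solves_def by (intro is_sol_diff) auto
  have g: "\<bar>rhs x' s (u' s) (v' s) - rhs x s (u s) (v s)\<bar> \<le> \<gamma> + max \<bar>u' s - u s\<bar> \<bar>v' s - v s\<bar> / (2 * M)"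
    if s: "s \<in> {0..1}" for s
  proof -
    have "(s, u s, v s) \<in> \<Omega>" using K(1)[OF s] K_subset by blast
    then have "rhs x' s (u s) (v s) - rhs x s (u s) (v s) = pd [] (ph (x' - x)) (s, u s, v s)"
      using pd_diff[OF near0_CO[OF x(2)] near0_CO[OF x(1)], of _ "[]"] by (simp add: rhs_def)
    then have "\<bar>rhs x' s (u s) (v s) - rhs x s (u s) (v s)\<bar> \<le> \<gamma>" using \<gamma>(3)[OF K(1)[OF s]] by simp
    then show ?thesis using rhs_lipschitz[OF x(2) K[OF s]] by linarith
  qed
  show "\<bar>u' s - u s\<bar> \<le> 2 * M * \<gamma>" "\<bar>v' s - v s\<bar> \<le> 2 * M * \<gamma>"
    using stable_absorb[OF stable d _ _ g s] \<gamma>(1,2) by simp_all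
qed

text \<open>The case \<gamma> = 0. It covers every solution whose curve lies in \<open>K\<close>,
  not only those in the inner tube where existence was shown.\<close>

lemma solution_unique:
  assumes "x \<in> near0" "solves x u v" "solves x u' v'" "s \<in> {0..1}"
  shows "u' s = u s" "v' s = v s"
proof -
  have z: "\<bar>pd [] (ph (x - x)) z\<bar> \<le> 0" if "z \<in> K" for z
  proof -
    have "pd [] 0 z = 0" using K_subset that by (intro pd_zero) blast
    then show ?thesis by simp
  qed
  show "u' s = u s" "v' s = v s"
    using solution_lipschitz[OF assms(1,1,2,3) _ _ z assms(4)] by simp_all
qed

text \<open>On \<open>K\<close> the linearization at any nearby solution stays within the budget
  1/(4 M) of the base one, so both perturbation results apply. This is why the chart has the
  constant 2 M.\<close>

lemma solution_linearization:
  assumes x: "x \<in> near0" and sol: "solves x u v"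
  shows "stable (\<lambda>s. pd [1] (ph x) (s, u s, v s)) (\<lambda>s. pd [2] (ph x) (s, u s, v s)) (2 * M)"
    and "solvable (\<lambda>s. pd [1] (ph x) (s, u s, v s)) (\<lambda>s. pd [2] (ph x) (s, u s, v s))"
proof -
  have K: "(s, u s, v s) \<in> K" if "s \<in> {0..1}" for s using sol that by (simp add: solves_def)
  have \<kappa>: "\<bar>pd [1] (ph x) (s, u s, v s) - q\<^sub>2 s\<bar> \<le> 1 / (4 * M) \<and> \<bar>pd [2] (ph x) (s, u s, v s) - q\<^sub>3 s\<bar> \<le> 1 / (4 * M)"
    if "s \<in> {0..1}" for s
    using close[OF _ _ K[OF that]] x by (simp add: near0_def)
  show "stable (\<lambda>s. pd [1] (ph x) (s, u s, v s)) (\<lambda>s. pd [2] (ph x) (s, u s, v s)) (2 * M)"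
    by (rule perturbed_stable[OF stable \<kappa>])
  have "continuous_on {0..1} u" "continuous_on {0..1} v"
    using sol is_sol_continuous unfolding solves_def by blast+
  then show "solvable (\<lambda>s. pd [1] (ph x) (s, u s, v s)) (\<lambda>s. pd [2] (ph x) (s, u s, v s))"
    by (intro perturbed_solvable[OF stable solvable q_cont _ _ \<kappa>] curve_comp_continuous near0_CO[OF x] K)
qed

lemma solves_derivs:
  assumes "solves x u v" "s \<in> {0..1}"
  shows "(u has_real_derivative v s) (at s within {0..1})"
    "(v has_real_derivative pd [] (ph x) (s, u s, v s)) (at s within {0..1})"
  using assms by (simp_all add: solves_def is_sol_def rhs_def)

text \<open>The neighbourhood is a product: \<open>U\<close> controls the data by order-one
  seminorms, \<open>V\<close> controls the solution in the C^1 norm. Existence places the solution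
  map in \<open>V\<close>, and uniqueness in \<open>K\<close> excludes every other solution there,
  so the intersection is a graph.\<close>

lemma local_solution_chart:
  assumes y\<^sub>0: "y\<^sub>0 \<in> CI 2" "\<And>s. s \<in> {0..1} \<Longrightarrow> c s = y\<^sub>0 s \<and> d s = ideriv 1 y\<^sub>0 s"
  shows "\<exists>W. openin (prod_topology (data_topology \<Omega>) (CI_topology 2)) W \<and> (x\<^sub>0, y\<^sub>0) \<in> W \<and>
    Cinf_pi (data_topology \<Omega>) (CI_topology \<infinity>) (solution_set \<Omega> \<inter> W)"
proof -
  \<comment> \<open>an arbitrary open neighbourhood would not do: it need not absorb the sets \<open>B 1 \<eta>\<close>\<close>
  define U where "U = {x \<in> E. \<exists>\<delta>'<\<delta>. x - x\<^sub>0 \<in> B 1 \<delta>'}"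
  have U_absorbs: "\<exists>\<eta>>0. \<forall>v. v - x \<in> B 1 \<eta> \<longrightarrow> v \<in> U" if x: "x \<in> U" for x
  proof -
    obtain \<delta>' where \<delta>': "x \<in> E" "\<delta>' < \<delta>" "x - x\<^sub>0 \<in> B 1 \<delta>'" using x by (auto simp: U_def)
    have "v \<in> U" if "v - x \<in> B 1 ((\<delta> - \<delta>') / 2)" for v
    proof -
      have "v - x \<in> E" using that B_subset by blast
      from E_add[OF this \<delta>'(1)] have "v \<in> E" by simp
      moreover have "v - x\<^sub>0 \<in> B 1 ((\<delta> - \<delta>') / 2 + \<delta>')" using B_add[OF that \<delta>'(3)] by simp
      moreover have "(\<delta> - \<delta>') / 2 + \<delta>' < \<delta>" using \<delta>'(2) by (simp add: field_simps)
      ultimately show ?thesis unfolding U_def by blast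
    qed
    then show ?thesis using \<delta>'(2) by (intro exI[of _ "(\<delta> - \<delta>') / 2"]) simp
  qed
  have "\<exists>T. openin (data_topology \<Omega>) T \<and> x \<in> T \<and> T \<subseteq> U" if x: "x \<in> U" for x
  proof -
    obtain \<eta> where \<eta>: "0 < \<eta>" "\<forall>v. v - x \<in> B 1 \<eta> \<longrightarrow> v \<in> U" using U_absorbs[OF x] by blast
    have "x \<in> E" using x by (simp add: U_def)
    from B_translate_nhd[OF this \<eta>(1), of 1] \<eta>(2) show ?thesis by blast
  qed
  then have U_open: "openin (data_topology \<Omega>) U" by (subst openin_subopen) blast
  have x\<^sub>0_U: "x\<^sub>0 \<in> U"
    unfolding U_def using x\<^sub>0 B_zero[of "\<delta> / 2" 1] \<delta>(1) by (auto intro!: exI[of _ "\<delta> / 2"])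
  have U: "x \<in> E \<and> x - x\<^sub>0 \<in> B 1 \<delta>" if xU: "x \<in> U" for x
  proof -
    obtain \<delta>' where "x \<in> E" "\<delta>' < \<delta>" "x - x\<^sub>0 \<in> B 1 \<delta>'" using xU by (auto simp: U_def)
    then show ?thesis using B_mono[OF order_refl less_imp_le, of \<delta>' \<delta> 1] by blast
  qed
  have U_near: "x \<in> near0" if "x \<in> U" for x using U that by (simp add: near0_def)
  \<comment> \<open>Values and first derivatives suffice: closeness below \<open>r\<close> in these
    two forces the curve (s, f, f') into \<open>K\<close>, where solutions are unique.\<close>
  define Q where "Q = {(ideriv 0, {0..1::real}), (ideriv 1, {0..1})}"
  define V where "V = uniform_core (CI 2) Q r y\<^sub>0"
  have "enat 0 < 2 + 1" "enat 1 < 2 + 1"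
    unfolding enat_less_add_one_iff zero_enat_def[symmetric] one_enat_def[symmetric] by simp_all
  then have "Q \<subseteq> {(ideriv k, {0..1}) |k. enat k < 2 + 1}" unfolding Q_def by blast
  then have V_open: "openin (CI_topology 2) V"
    unfolding V_def CI_topology_def by (intro openin_uniform_core) (auto simp: Q_def)
  have y\<^sub>0_V: "y\<^sub>0 \<in> V" unfolding V_def by (rule uniform_core_self[OF y\<^sub>0(1) r_pos])
  have "\<forall>x. \<exists>p. x \<in> U \<longrightarrow> solves x (fst p) (snd p) \<and>
      (\<forall>s\<in>{0..1}. \<bar>fst p s - c s\<bar> \<le> r / 4 \<and> \<bar>snd p s - d s\<bar> \<le> r / 4)"
    using solution_exists[OF U_near] by fastforce
  from choice[OF this] obtain p where p: "\<And>x. x \<in> U \<Longrightarrow> solves x (fst (p x)) (snd (p x))"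
    "\<And>x s. x \<in> U \<Longrightarrow> s \<in> {0..1} \<Longrightarrow> \<bar>fst (p x) s - c s\<bar> \<le> r / 4 \<and> \<bar>snd (p x) s - d s\<bar> \<le> r / 4" by blast
  define y where "y = (\<lambda>x. fst (p x))"
  define y' where "y' = (\<lambda>x. snd (p x))"
  have sol: "solves x (y x) (y' x)" if "x \<in> U" for x using p(1)[OF that] by (simp add: y_def y'_def)
  have tube4: "\<bar>y x s - c s\<bar> \<le> r / 4" "\<bar>y' x s - d s\<bar> \<le> r / 4" if "x \<in> U" "s \<in> {0..1}" for x s
    using p(2)[OF that] by (simp_all add: y_def y'_def)
  interpret C: chart \<Omega> c d r U y y' "2 * M"
  proof
    show "U \<subseteq> E" using U by blast
    show "\<exists>\<delta>>0. \<forall>v\<in>B 1 \<delta>. x + v \<in> U" if x: "x \<in> U" for x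
    proof -
      obtain \<eta> where \<eta>: "0 < \<eta>" "\<forall>v. v - x \<in> B 1 \<eta> \<longrightarrow> v \<in> U" using U_absorbs[OF x] by blast
      have "x + v \<in> U" if "v \<in> B 1 \<eta>" for v using \<eta>(2)[rule_format, of "x + v"] that by simp
      then show ?thesis using \<eta>(1) by blast
    qed
    show "(s, y x s, y' x s) \<in> K" if "x \<in> U" "s \<in> {0..1}" for x s
      using sol that by (simp add: solves_def)
    show "(y x has_real_derivative y' x s) (at s within {0..1})"
      "(y' x has_real_derivative pd [] (ph x) (s, y x s, y' x s)) (at s within {0..1})" if "x \<in> U" "s \<in> {0..1}" for x s
      using solves_derivs[OF sol that(2)] that(1) by simp_all
    show "y x 0 = fst x" "y x 1 = fst (snd x)" if "x \<in> U" for x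
      using sol[OF that] by (simp_all add: solves_def is_sol_def)
    show "stable (\<lambda>s. pd [1] (ph x) (s, y x s, y' x s)) (\<lambda>s. pd [2] (ph x) (s, y x s, y' x s)) (2 * M)"
      "solvable (\<lambda>s. pd [1] (ph x) (s, y x s, y' x s)) (\<lambda>s. pd [2] (ph x) (s, y x s, y' x s))" if "x \<in> U" for x
      using solution_linearization[OF U_near sol] that by blast+
    show "\<bar>y x' s - y x s\<bar> \<le> 2 * M * \<delta>' \<and> \<bar>y' x' s - y' x s\<bar> \<le> 2 * M * \<delta>'"
      if "x \<in> U" "x' \<in> U" "x' - x \<in> B 1 \<delta>'" "s \<in> {0..1}" for x x' \<delta>' s
      using solution_lipschitz[OF U_near[OF that(1)] U_near[OF that(2)] sol[OF that(1)] sol[OF that(2)] _ _ _ that(4), of \<delta>']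
        B_fst[OF that(3)] B_pd[OF that(3), of "[]"] by (simp add: less_imp_le)
  qed
  have zero_Es: "(\<lambda>_. 0) \<in> C.Es" using E_zero by (simp add: C.Es_def)
  let ?f = "C.graph Pos (\<lambda>_. 0)"
  have "solution_set \<Omega> \<inter> (U \<times> V) = ?f"
  proof (intro set_eqI iffI)
    fix w assume "w \<in> solution_set \<Omega> \<inter> (U \<times> V)"
    then obtain x f where w: "w = (x, f)" "x \<in> U" "f \<in> V" "(x, f) \<in> solution_set \<Omega>" by auto
    have f: "ph x \<in> CO \<Omega>" "f \<in> CI 2" "f 0 = fst x" "f 1 = fst (snd x)"
      "\<And>s. s \<in> {0..1} \<Longrightarrow> (s, f s, ideriv 1 f s) \<in> \<Omega> \<and> ideriv 2 f s = ph x (s, f s, ideriv 1 f s)"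
      using w(4) by (auto simp: solution_set_def split: prod.splits)
    have "f \<in> uniform_nhd (CI 2) Q r y\<^sub>0" using w(3) unfolding V_def by (rule subsetD[OF uniform_core_subset])
    then have "\<bar>f s - y\<^sub>0 s\<bar> < r" "\<bar>ideriv 1 f s - ideriv 1 y\<^sub>0 s\<bar> < r" if "s \<in> {0..1}" for s
      using that unfolding uniform_nhd_def Q_def by simp_all
    then have K: "(s, f s, ideriv 1 f s) \<in> K" if "s \<in> {0..1}" for s
      using that y\<^sub>0(2)[OF that] by (intro K_I) (simp_all add: less_imp_le)
    have "solves x f (ideriv 1 f)"
      unfolding solves_def is_sol_def
    proof (intro conjI ballI)
      fix s :: real assume s: "s \<in> {0..1}"
      show "(f has_real_derivative ideriv 1 f s) (at s within {0..1})" by (rule CI_2_deriv(1)[OF f(2) s])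
      show "(ideriv 1 f has_real_derivative q\<^sub>3 s * ideriv 1 f s + q\<^sub>2 s * f s + rhs x s (f s) (ideriv 1 f s)) (at s within {0..1})"
        using CI_2_deriv(2)[OF f(2) s] f(5)[OF s] pd_Nil[OF f(1)] by (simp add: rhs_def)
    qed (use f K in auto)
    from solution_unique(1)[OF U_near[OF w(2)] sol[OF w(2)] this]
    have "f = C.rep Pos x (\<lambda>_. 0)"
      using CI_outside[OF f(2)] by (auto simp: C.rep_def fun_eq_iff)
    then show "w \<in> ?f" using w by (simp add: C.graph_def)
  next
    fix w assume "w \<in> ?f"
    then obtain x where w: "w = (x, C.rep Pos x (\<lambda>_. 0))" "x \<in> U" by (auto simp: C.graph_def)
    let ?f = "C.rep Pos x (\<lambda>_. 0)"
    have CI2: "?f \<in> CI 2" using C.rep_CI(1)[OF w(2) zero_Es, of Pos] by (auto simp: CI_def)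
    have d0: "?f s = y x s" "ideriv 1 ?f s = y' x s" "ideriv 2 ?f s = pd [] (ph x) (s, y x s, y' x s)" if "s \<in> {0..1}" for s
      using that C.rep_CI(2)[OF w(2) zero_Es that, of 1 Pos] C.rep_CI(2)[OF w(2) zero_Es that, of 2 Pos]
      by (simp_all add: C.rep_def numeral_2_eq_2 C.datum_def C.pt_def)
    have K: "(s, y x s, y' x s) \<in> K" if "s \<in> {0..1}" for s using sol[OF w(2)] that by (simp add: solves_def)
    have "?f \<in> V"
      unfolding V_def uniform_core_def
    proof (intro CollectI conjI exI[of _ "r / 4"])
      show "\<forall>(D, K)\<in>Q. \<forall>z\<in>K. \<bar>D ?f z - D y\<^sub>0 z\<bar> \<le> r / 4"
        using tube4[OF w(2)] y\<^sub>0(2) d0 by (simp add: Q_def)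
    qed (use CI2 r_pos in auto)
    moreover have "(x, ?f) \<in> solution_set \<Omega>"
    proof -
      have CO: "ph x \<in> CO \<Omega>" using U_near[OF w(2)] near0_CO by blast
      have "(s, y x s, y' x s) \<in> \<Omega>" "pd [] (ph x) (s, y x s, y' x s) = ph x (s, y x s, y' x s)" if "s \<in> {0..1}" for s
        using K[OF that] K_subset pd_Nil[OF CO] by auto
      moreover have "?f 0 = fst x" "?f 1 = fst (snd x)"
        using d0(1)[of 0] d0(1)[of 1] C.y_bc[OF w(2)] by simp_all
      ultimately show ?thesis
        using CO CI2 d0 by (simp add: solution_set_def case_prod_unfold)
    qed
    ultimately show "w \<in> solution_set \<Omega> \<inter> (U \<times> V)" using w by simp
  qed
  then have "Cinf_pi (data_topology \<Omega>) (CI_topology \<infinity>) (solution_set \<Omega> \<inter> (U \<times> V))"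
    using C.Cinf_pi_graph[OF U_open zero_Es] by simp
  moreover have "openin (prod_topology (data_topology \<Omega>) (CI_topology 2)) (U \<times> V)"
    using U_open V_open by (simp add: openin_prod_Times_iff)
  moreover have "(x\<^sub>0, y\<^sub>0) \<in> U \<times> V" using x\<^sub>0_U y\<^sub>0_V by simp
  ultimately show ?thesis by blast
qed

end

text \<open>The curve is compact, so it keeps a positive distance e from the complement of an open
  set that cuts out \<Omega>. Two coordinates may each deviate by e/3 without using up e.\<close>

lemma tube_around_curve:
  assumes "openin (top_of_set ({0..1} \<times> UNIV \<times> UNIV)) \<Omega>"
    and cd: "continuous_on {0..1} c" "continuous_on {0..1} d"
    and curve: "\<And>s. s \<in> {0..1} \<Longrightarrow> (s, c s, d s) \<in> \<Omega>"
  shows "\<exists>r>0. tube \<Omega> c d r"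
proof -
  obtain T where T: "open T" "\<Omega> = ({0..1} \<times> UNIV \<times> UNIV) \<inter> T" using assms(1) by (auto simp: openin_open)
  let ?g = "\<lambda>s. (s, c s, d s)"
  have "compact (?g ` {0..1})"
    using cd by (intro compact_continuous_image continuous_intros compact_Icc)
  moreover have "?g ` {0..1} \<subseteq> T" using curve T by auto
  ultimately obtain e where e: "e > 0" "(\<Union>x\<in>?g ` {0..1}. ball x e) \<subseteq> T"
    using compact_subset_open_imp_ball_epsilon_subset[OF _ T(1)] by metis
  have "(s, a, b) \<in> \<Omega>" if s: "s \<in> {0..1}" and ab: "\<bar>a - c s\<bar> \<le> e / 3" "\<bar>b - d s\<bar> \<le> e / 3" for s a b
  proof -
    have "dist (s, c s, d s) (s, a, b) = norm (c s - a, d s - b)"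
      by (simp add: dist_norm norm_Pair)
    also have "\<dots> \<le> norm (c s - a) + norm (d s - b)" by (rule norm_Pair_le)
    also have "\<dots> \<le> e / 3 + e / 3" using ab by (simp add: abs_minus_commute)
    also have "\<dots> < e" using e(1) by simp
    finally have "(s, a, b) \<in> (\<Union>x\<in>?g ` {0..1}. ball x e)" using s by auto
    then have "(s, a, b) \<in> T" using e(2) by blast
    then show ?thesis using s T(2) by auto
  qed
  then have "tube \<Omega> c d (e / 3)" using assms(1) cd by unfold_locales
  then show ?thesis using e(1) by (intro exI[of _ "e / 3"]) simp
qed

theorem theorem5p4:
  fixes \<Omega> :: "(real \<times> real \<times> real) set"
  assumes "openin (top_of_set ({0..1} \<times> UNIV \<times> UNIV)) \<Omega>"
  shows "\<forall>w \<in> regular_solution_set \<Omega>.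
           \<exists>W. openin (prod_topology (data_topology \<Omega>) (CI_topology 2)) W \<and> w \<in> W \<and>
               Cinf_pi (data_topology \<Omega>) (CI_topology \<infinity>) (solution_set \<Omega> \<inter> W)"
proof
  fix w assume w: "w \<in> regular_solution_set \<Omega>"
  obtain \<eta>\<^sub>0 \<eta>\<^sub>1 \<phi> y where w_eq: "w = ((\<eta>\<^sub>0, \<eta>\<^sub>1, \<phi>), y)" by (metis prod.exhaust)
  have \<phi>: "\<phi> \<in> CO \<Omega>" and y: "y \<in> CI 2" and bc: "y 0 = \<eta>\<^sub>0" "y 1 = \<eta>\<^sub>1"
    and ode: "\<And>s. s \<in> {0..1} \<Longrightarrow> (s, y s, ideriv 1 y s) \<in> \<Omega> \<and> ideriv 2 y s = \<phi> (s, y s, ideriv 1 y s)"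
    and reg: "regular \<Omega> w"
    using w by (auto simp: w_eq regular_solution_set_def solution_set_def)
  interpret R: rel_open \<Omega> by unfold_locales (rule assms)
  let ?d = "ideriv 1 y"
  have cont: "continuous_on {0..1} y" "continuous_on {0..1} ?d"
    unfolding continuous_on_eq_continuous_within
    using DERIV_continuous[OF CI_2_deriv(1)[OF y]] DERIV_continuous[OF CI_2_deriv(2)[OF y]] by blast+
  define q where "q = (\<lambda>n s. R.pd [n] \<phi> (s, y s, ?d s))"
  have q_cont: "continuous_on {0..1} (q n)" for n
    unfolding q_def by (rule continuous_on_compose2[OF R.pd_continuous[OF \<phi>]]) (use cont ode in \<open>auto intro!: continuous_intros\<close>)
  have solv: "solvable (q 1) (q 2)"
  proof (rule solvable_if_dirichlet[OF q_cont q_cont])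
    have q: "q 1 = (\<lambda>s. ext_partial \<Omega> [(0, 1, 0)] \<phi> (s, y s, ?d s))" "q 2 = (\<lambda>s. ext_partial \<Omega> [(0, 0, 1)] \<phi> (s, y s, ?d s))"
      by (simp_all add: q_def R.pd_def dirvec_def)
    show "\<forall>v\<in>F0. \<exists>u\<in>F0. \<forall>s\<in>{0..1}. ideriv 2 u s - q 2 s * ideriv 1 u s - q 1 s * u s = ideriv 2 v s"
      using reg unfolding q regular_def w_eq prod.case Let_def by blast
  qed
  obtain M where st: "stable (q 1) (q 2) M" by (rule solvable_imp_stable[OF q_cont q_cont solv])
  then have M: "1 \<le> M" by (simp add: stable_def)
  obtain r0 where r0: "0 < r0" "tube \<Omega> y ?d r0"
    using tube_around_curve[OF assms cont] ode by blast
  interpret T0: tube \<Omega> y ?d r0 by (rule r0(2))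
  \<comment> \<open>The preliminary tube provides a bound for second derivatives before the final
    radius is fixed, since that radius has to be small compared with \<open>C\<close>.\<close>
  obtain C where C: "0 < C" "\<And>ns z. length ns \<le> 2 \<Longrightarrow> z \<in> T0.K \<Longrightarrow> \<bar>R.pd ns \<phi> z\<bar> < C"
    using T0.pd_bounded[OF \<phi>] by blast
  \<comment> \<open>The oscillation of a first derivative across the tube is at most 2 C r, and this
    choice keeps it below 1/(8 M), half of the deviation that \<open>close\<close> permits.\<close>
  define r where "r = min r0 (1 / (16 * M * C))"
  have r: "0 < r" "r \<le> r0" using r0(1) C(1) M by (auto simp: r_def)
  have "r \<le> 1 / (16 * M * C)" by (simp add: r_def)
  then have "2 * C * r \<le> 2 * C * (1 / (16 * M * C))" using C(1) by (intro mult_left_mono) auto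
  also have "\<dots> = 1 / (8 * M)" using C(1) by simp
  finally have Cr: "2 * C * r \<le> 1 / (8 * M)" .
  interpret T: tube \<Omega> y ?d r by unfold_locales (use cont T0.tube r(2) in auto)
  have K_sub: "T.K \<subseteq> T0.K" unfolding T.K_def T0.K_def using r(2) by auto
  \<comment> \<open>The first entry keeps solutions in the inner quarter of the tube; the second is
    the other half 1/(8 M) of the permitted deviation, spent on changing \<phi>.\<close>
  define \<delta> where "\<delta> = min (r / (16 * M)) (1 / (8 * M))"
  have \<delta>: "0 < \<delta>" "\<delta> \<le> r / (16 * M)" "\<delta> \<le> 1 / (8 * M)" using r M by (auto simp: \<delta>_def)
  interpret continuation \<Omega> y ?d r "q 1" "q 2" M \<delta> "(\<eta>\<^sub>0, \<eta>\<^sub>1, \<phi>)"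
  proof
    show "stable (q 1) (q 2) M" "solvable (q 1) (q 2)" by (rule st solv)+
    show "continuous_on {0..1} (q 1)" "continuous_on {0..1} (q 2)" by (rule q_cont)+
    show "0 < r" "0 < \<delta>" by (rule r \<delta>)+
    show "16 * M * \<delta> \<le> r" using \<delta>(2) M by (simp add: field_simps)
    show "(\<eta>\<^sub>0, \<eta>\<^sub>1, \<phi>) \<in> T.E" using \<phi> by (simp add: T.E_def)
    show "is_sol (q 1) (q 2) (fst (\<eta>\<^sub>0, \<eta>\<^sub>1, \<phi>)) (fst (snd (\<eta>\<^sub>0, \<eta>\<^sub>1, \<phi>)))
        (\<lambda>s. R.pd [] (snd (snd (\<eta>\<^sub>0, \<eta>\<^sub>1, \<phi>))) (s, y s, ?d s) - q 2 s * ?d s - q 1 s * y s) y ?d"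
      unfolding is_sol_def
    proof (intro conjI ballI)
      fix s :: real assume s: "s \<in> {0..1}"
      show "(y has_real_derivative ?d s) (at s within {0..1})" by (rule CI_2_deriv(1)[OF y s])
      show "(?d has_real_derivative q 2 s * ?d s + q 1 s * y s +
          (R.pd [] (snd (snd (\<eta>\<^sub>0, \<eta>\<^sub>1, \<phi>))) (s, y s, ?d s) - q 2 s * ?d s - q 1 s * y s)) (at s within {0..1})"
        using CI_2_deriv(2)[OF y s] ode[OF s] R.pd_Nil[OF \<phi>] by simp
    qed (simp_all add: bc)
    fix x :: bvp_data and s a b
    assume x: "x \<in> T.E" "x - (\<eta>\<^sub>0, \<eta>\<^sub>1, \<phi>) \<in> T.B 1 \<delta>" and z: "(s, a, b) \<in> T.K"
    have s: "s \<in> {0..1}" "\<bar>a - y s\<bar> \<le> r" "\<bar>b - ?d s\<bar> \<le> r" using z unfolding T.K_def by simp_all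
    have "\<bar>R.pd [n] (snd (snd x)) (s, a, b) - q n s\<bar> \<le> 1 / (4 * M)" for n
    proof -
      have "(s, a, b) \<in> \<Omega>" using z T.K_subset by blast
      then have "\<bar>R.pd [n] (snd (snd x)) (s, a, b) - R.pd [n] \<phi> (s, a, b)\<bar> < \<delta>"
        using T.B_pd[OF x(2) _ z, of "[n]"] R.pd_diff[OF _ \<phi>, of "snd (snd x)" _ "[n]"] x(1) by (simp add: T.E_def)
      moreover have "\<bar>R.pd [n] \<phi> (s, a, b) - R.pd [n] \<phi> (s, y s, ?d s)\<bar> \<le> 2 * C * r"
      proof (rule T0.K_lipschitz[OF \<phi> _ _ _ _ s(2,3)])
        show "\<bar>R.pd ([n] @ [1]) \<phi> w\<bar> \<le> C" "\<bar>R.pd ([n] @ [2]) \<phi> w\<bar> \<le> C" if "w \<in> T0.K" for w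
          using C(2)[OF _ that, of "[n] @ [1]"] C(2)[OF _ that, of "[n] @ [2]"] by simp_all
        show "(s, y s, ?d s) \<in> T0.K" unfolding T0.K_def using s(1) r0(1) by simp
        show "(s, a, b) \<in> T0.K" using z K_sub by blast
      qed
      moreover have "1 / (8 * M) + 1 / (8 * M) = 1 / (4 * M)" by simp
      ultimately show ?thesis using Cr \<delta>(3) unfolding q_def by linarith
    qed
    then show "\<bar>R.pd [1] (snd (snd x)) (s, a, b) - q 1 s\<bar> \<le> 1 / (4 * M) \<and> \<bar>R.pd [2] (snd (snd x)) (s, a, b) - q 2 s\<bar> \<le> 1 / (4 * M)"
      by blast
  qed
  show "\<exists>W. openin (prod_topology (data_topology \<Omega>) (CI_topology 2)) W \<and> w \<in> W \<and>
      Cinf_pi (data_topology \<Omega>) (CI_topology \<infinity>) (solution_set \<Omega> \<inter> W)"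
    unfolding w_eq by (rule local_solution_chart[OF y]) simp
qed

end
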